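(* Let $T$ be an $\omega$-Calderón--Zygmund operator on $\mathbb R^N$ with modulus of continuity $\omega$ satisfying the Dini condition. There is a constant $C$ depending only on $T$, $N$ and $d$ such that for every compactly supported $f\in L^1(\mathbb R^N;\mathbb R^d)$ there exists a (weakly) $\eta$-sparse family $\mathcal S=\mathcal S(f)$ of cubes, with $\eta=3^{-N}/2$, such that $$Tf(x)\in C\,\mathbf L_{\mathcal S}f(x)\qquad\text{for a.e. }x\in\mathbb R^N .$$
   Context: A modulus of continuity is an increasing subadditive function $\omega$ on $[0,\infty)$ with $\omega(0)=0$; it satisfies the Dini condition if $\int_0^1\omega(x)\frac{dx}{x}<\infty$. An operator $T$ bounded in the scalar $L^2(\mathbb R^N)$ is an $\omega$-Calderón--Zygmund operator if $Tf(x)=\int_{\mathbb R^N}K(x,y)f(y)\,dy$ for all $f\in L^2$ and $x\notin\operatorname{supp} f$, where $|K(x,y)|\le C|x-y|^{-N}$ and $|K(x,y)-K(x',y)|+|K(y,x)-K(y,x')|\le \omega\bigl(\tfrac{|x-x'|}{|x-y|}\bigr)|x-y|^{-N}$ whenever $2|x-x'|\le |x-y|$. Under the Dini condition such $T$ is of weak type $1$-$1$, and so is defined on $L^1$. On $\mathbb R^d$-valued functions $T$ acts componentwise (as $T\otimes\mathbf I_d$). A collection $\mathcal S$ of cubes (not necessarily dyadic) is (weakly) $\eta$-sparse, $0<\eta<1$, if there exist pairwise disjoint measurable sets $E_Q\subset Q$, $Q\in\mathcal S$, with $|E_Q|\ge\eta|Q|$ for all $Q\in\mathcal S$. With $\langle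 f\rangle_Q=|Q|^{-1}\int_Qf\,dx$, for $f\in L^1(Q;\mathbb R^d)$ the convex body average is $\langle\!\langle f\rangle\!\rangle_Q:=\{\langle\varphi f\rangle_Q:\ \varphi:Q\to\mathbb R\text{ measurable},\ \|\varphi\|_\infty\le1\}$, a symmetric convex compact subset of $\mathbb R^d$. The convex body valued sparse operator is $\mathbf L_{\mathcal S}f(x)=\sum_{Q\in\mathcal S}\langle\!\langle f\rangle\!\rangle_Q\mathbf 1_Q(x)$, where the sum is the Minkowski sum, i.e. $\mathbf L_{\mathcal S}f(x)$ is the set of all sums of absolutely convergent series $\sum_{Q\in\mathcal S,\,x\in Q}v_Q$ with $v_Q\in\langle\!\langle f\rangle\!\rangle_Q$. *)

theory Defs
  imports "HOL-Analysis.Analysis"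
begin

text \<open>
  Elements of \<open>L\<^sup>p\<close> are represented by functions, and all identities between them hold almost
  everywhere with respect to Lebesgue measure.  Scalars are real.
\<close>

definition square_integrable :: "(real^'n \<Rightarrow> real) \<Rightarrow> bool" where
  "square_integrable f \<longleftrightarrow>
     f \<in> borel_measurable lebesgue \<and> integrable lebesgue (\<lambda>x. (f x)\<^sup>2)"

definition norm_L2 :: "(real^'n \<Rightarrow> real) \<Rightarrow> real" where
  "norm_L2 f = sqrt (LINT x|lebesgue. (f x)\<^sup>2)"

text \<open>
  Linearity and boundedness together make \<open>T\<close> respect almost everywhere equality, so this is
  a bounded linear operator on equivalence classes; nothing is said about \<open>T f\<close> outside \<open>L\<^sup>2\<close>.
\<close>

definition bounded_operator_L2 :: "((real^'n \<Rightarrow> real) \<Rightarrow> real^'n \<Rightarrow> real) \<Rightarrow> bool" where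
  "bounded_operator_L2 T \<longleftrightarrow>
     (\<forall>f. square_integrable f \<longrightarrow> square_integrable (T f)) \<and>
     (\<forall>f g a b. square_integrable f \<longrightarrow> square_integrable g \<longrightarrow>
        (AE x in lebesgue. T (\<lambda>y. a * f y + b * g y) x = a * T f x + b * T g x)) \<and>
     (\<exists>B. \<forall>f. square_integrable f \<longrightarrow> norm_L2 (T f) \<le> B * norm_L2 f)"

text \<open>The support of an equivalence class of functions.\<close>

definition ess_support :: "(real^'n \<Rightarrow> 'b::zero) \<Rightarrow> (real^'n) set" where
  "ess_support f = - \<Union>{U. open U \<and> (AE x in lebesgue. x \<in> U \<longrightarrow> f x = 0)}"

text \<open>Only the values on \<open>[0,\<infinity>)\<close> matter; \<open>increasing\<close> means nondecreasing.\<close>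

definition modulus_of_continuity :: "(real \<Rightarrow> real) \<Rightarrow> bool" where
  "modulus_of_continuity \<omega> \<longleftrightarrow>
     \<omega> 0 = 0 \<and> mono_on {0..} \<omega> \<and> (\<forall>s\<ge>0. \<forall>t\<ge>0. \<omega> (s + t) \<le> \<omega> s + \<omega> t)"

definition dini :: "(real \<Rightarrow> real) \<Rightarrow> bool" where
  "dini \<omega> \<longleftrightarrow> set_integrable lborel {0<..1} (\<lambda>x. \<omega> x / x)"

text \<open>The values of a kernel on the diagonal are irrelevant.\<close>

definition CZ_kernel :: "(real \<Rightarrow> real) \<Rightarrow> (real^'n \<Rightarrow> real^'n \<Rightarrow> real) \<Rightarrow> bool" where
  "CZ_kernel \<omega> K \<longleftrightarrow>
     (\<exists>C. \<forall>x y. x \<noteq> y \<longrightarrow> \<bar>K x y\<bar> \<le> C / norm (x - y) ^ CARD('n)) \<and>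
     (\<forall>x x' y. x \<noteq> y \<longrightarrow> 2 * norm (x - x') \<le> norm (x - y) \<longrightarrow>
        \<bar>K x y - K x' y\<bar> + \<bar>K y x - K y x'\<bar>
          \<le> \<omega> (norm (x - x') / norm (x - y)) / norm (x - y) ^ CARD('n))"

definition CZ_operator ::
  "(real \<Rightarrow> real) \<Rightarrow> ((real^'n \<Rightarrow> real) \<Rightarrow> real^'n \<Rightarrow> real) \<Rightarrow> bool" where
  "CZ_operator \<omega> T \<longleftrightarrow>
     bounded_operator_L2 T \<and>
     (\<exists>K. CZ_kernel \<omega> K \<and>
        (\<forall>f. square_integrable f \<longrightarrow>
           (AE x in lebesgue. x \<notin> ess_support f \<longrightarrow>
              has_bochner_integral lebesgue (\<lambda>y. K x y * f y) (T f x))))"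

definition converges_in_measure ::
  "(nat \<Rightarrow> real^'n \<Rightarrow> real) \<Rightarrow> (real^'n \<Rightarrow> real) \<Rightarrow> bool" where
  "converges_in_measure u g \<longleftrightarrow>
     (\<forall>\<epsilon>>0. (\<lambda>n. emeasure lebesgue {x. \<bar>u n x - g x\<bar> > \<epsilon>}) \<longlonglongrightarrow> 0)"

text \<open>
  The extension by continuity, from \<open>L\<^sup>1 \<inter> L\<^sup>2\<close> to \<open>L\<^sup>1\<close>, of an operator of weak type 1-1.
  The function chosen is determined up to a null set, and the weak type estimate is what
  guarantees that it exists.
\<close>

definition extension_L1 ::
  "((real^'n \<Rightarrow> real) \<Rightarrow> real^'n \<Rightarrow> real) \<Rightarrow> (real^'n \<Rightarrow> real) \<Rightarrow> real^'n \<Rightarrow> real" where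
  "extension_L1 T f = (SOME g. g \<in> borel_measurable lebesgue \<and>
     (\<forall>h. (\<forall>n. integrable lebesgue (h n) \<and> square_integrable (h n)) \<longrightarrow>
          (\<lambda>n. LINT x|lebesgue. \<bar>h n x - f x\<bar>) \<longlonglongrightarrow> 0 \<longrightarrow>
          converges_in_measure (\<lambda>n. T (h n)) g))"

definition vector_extension ::
  "((real^'n \<Rightarrow> real) \<Rightarrow> real^'n \<Rightarrow> real) \<Rightarrow> (real^'n \<Rightarrow> real^'d) \<Rightarrow> real^'n \<Rightarrow> real^'d" where
  "vector_extension T f x = (\<chi> i. extension_L1 T (\<lambda>y. f y $ i) x)"

definition is_cube :: "(real^'n) set \<Rightarrow> bool" where
  "is_cube Q \<longleftrightarrow> (\<exists>a l. l > 0 \<and> Q = cbox a (\<chi> i. a $ i + l))"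

definition weakly_sparse :: "real \<Rightarrow> (real^'n) set set \<Rightarrow> bool" where
  "weakly_sparse \<eta> S \<longleftrightarrow>
     0 < \<eta> \<and> \<eta> < 1 \<and> (\<forall>Q\<in>S. is_cube Q) \<and>
     (\<exists>E. disjoint_family_on E S \<and>
        (\<forall>Q\<in>S. E Q \<in> sets lebesgue \<and> E Q \<subseteq> Q \<and>
           measure lebesgue (E Q) \<ge> \<eta> * measure lebesgue Q))"

definition average :: "(real^'n) set \<Rightarrow> (real^'n \<Rightarrow> real^'d) \<Rightarrow> real^'d" where
  "average Q f = (1 / measure lebesgue Q) *\<^sub>R (LINT x|lebesgue_on Q. f x)"

definition convex_body_average :: "(real^'n) set \<Rightarrow> (real^'n \<Rightarrow> real^'d) \<Rightarrow> (real^'d) set" where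
  "convex_body_average Q f =
     {average Q (\<lambda>x. \<phi> x *\<^sub>R f x) |\<phi>.
        \<phi> \<in> borel_measurable (lebesgue_on Q) \<and> (AE x in lebesgue_on Q. \<bar>\<phi> x\<bar> \<le> 1)}"

definition sparse_operator ::
  "(real^'n) set set \<Rightarrow> (real^'n \<Rightarrow> real^'d) \<Rightarrow> real^'n \<Rightarrow> (real^'d) set" where
  "sparse_operator S f x =
     {s. \<exists>v. (\<forall>Q\<in>{Q\<in>S. x \<in> Q}. v Q \<in> convex_body_average Q f) \<and>
             (\<lambda>Q. norm (v Q)) summable_on {Q\<in>S. x \<in> Q} \<and>
             (v has_sum s) {Q\<in>S. x \<in> Q}}"

end

theory Submission
  imports Defs
begin

text \<open>
  Write \<open>3Q\<close> for the triple of a cube \<open>Q\<close>.  On most of \<open>Q\<close> the value of \<open>T (f 1\<^bsub>3Q\<^esub>)\<close> lies in a fixed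
  multiple of the convex body average of \<open>f\<close> over \<open>3Q\<close>.  Up to a null set the exceptional points are covered by
  disjoint dyadic subcubes \<open>P\<close> of total measure at most \<open>\<bar>Q\<bar> / 2\<close>, and on each \<open>P\<close> the difference
  \<open>T (f 1\<^bsub>3Q\<^esub>) - T (f 1\<^bsub>3P\<^esub>)\<close> still lies in that multiple of the body (\<open>stopping_children\<close>).
  Iteration gives a tree of cubes.  Almost every point belongs to finitely many of them, and along
  the chain of these cubes \<open>T f\<close> telescopes into a finite sum of vectors from the bodies of their
  triples (\<open>convex_body_domination\<close>).  The triples are sparse because every \<open>Q\<close> keeps half of its
  measure outside its children (\<open>tripled_tree_sparse\<close>).  The roots of the tree partition the space
  into cubes whose triples contain the support of \<open>f\<close> (\<open>partition_with_large_triples\<close>).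

  Vectors are reduced to scalars by coordinates adapted to the body (\<open>body_coordinates\<close>): there are
  \<open>d\<close> vectors \<open>e i\<close> in a fixed multiple of the body, and functionals \<open>l i\<close>, such that
  \<open>f = (\<Sum>i. (l i \<bullet> f) e i)\<close> on \<open>3Q\<close> and the average of \<open>\<bar>l i \<bullet> f\<bar>\<close> is at most \<open>2\<close>.  So bounded scalars
  \<open>T (l i \<bullet> f)\<close> yield a vector in a multiple of the body.

  For a scalar function \<open>g\<close>, the exceptional set is where \<open>\<bar>T g\<bar>\<close> or the maximal function of \<open>g\<close> is
  large; it is small by the weak type inequalities.  The subcubes \<open>P\<close> are the stopping cubes of its
  indicator, so at least half of each \<open>P\<close> is not exceptional.  The weak type inequality for
  \<open>g 1\<^bsub>3P\<^esub>\<close> leaves a point of that half at which \<open>T (g - g 1\<^bsub>3P\<^esub>)\<close> is bounded, and by the smoothness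
  of the kernel this function varies by a bounded amount on \<open>P\<close> (\<open>far_part_bound\<close>).

  The weak type inequality for \<open>T\<close> on \<open>L\<^sup>1 \<inter> L\<^sup>2\<close> is the classical decomposition argument
  (\<open>T_weak_type\<close>).  Everything about the extension to \<open>L\<^sup>1\<close> follows from its quantitative form, which
  bounds the measure of \<open>{\<bar>T h - T f\<bar> > \<epsilon>}\<close> by a multiple of \<open>\<parallel>h - f\<parallel>\<^sub>1 / \<epsilon>\<close> for \<open>h\<close> in
  \<open>L\<^sup>1 \<inter> L\<^sup>2\<close> (\<open>Te_estimate\<close>).
\<close>

section \<open>Dyadic cubes\<close>

text \<open>
  The index \<open>(k, m)\<close> stands for a half-open cube of side \<open>2 ^ k\<close>.  Indices rather than sets carry
  the combinatorics: they form a countable type, and the dilated cube is a function of the index.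

  The grid of scale \<open>k\<close> is shifted by a third of its side, alternately in both directions.
  Consecutive grids are still nested, and the origin stays away from the boundary of its cube at
  every scale, so that these cubes exhaust the space; the unshifted grid splits into orthants that
  no cube crosses.
\<close>

type_synonym 'n dyadic = "int \<times> (int ^ 'n)"

definition shift :: "int \<Rightarrow> real" where
  "shift k = (if even k then 1/3 else - 1/3)"

definition side :: "'n::finite dyadic \<Rightarrow> real" where
  "side c = 2 powi fst c"

definition corner :: "'n::finite dyadic \<Rightarrow> real ^ 'n" where
  "corner c = (\<chi> i. (snd c $ i - shift (fst c)) * side c)"

definition cube_at :: "int \<Rightarrow> real ^ 'n \<Rightarrow> 'n::finite dyadic" where
  "cube_at k x = (k, \<chi> i. \<lfloor>x $ i / 2 powi k + shift k\<rfloor>)"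

definition dcube :: "'n::finite dyadic \<Rightarrow> (real ^ 'n) set" where
  "dcube c = {x. cube_at (fst c) x = c}"

definition tripled :: "'n::finite dyadic \<Rightarrow> (real ^ 'n) set" where
  "tripled c = cbox (\<chi> i. corner c $ i - side c) (\<chi> i. corner c $ i + 2 * side c)"

lemma side_pos [simp]: "side c > 0"
  by (simp add: side_def)

lemma fst_cube_at [simp]: "fst (cube_at k x) = k"
  by (simp add: cube_at_def)

lemma mem_dcube_iff: "x \<in> dcube c \<longleftrightarrow> cube_at (fst c) x = c"
  by (simp add: dcube_def)

lemma mem_dcube_at [simp]: "x \<in> dcube (cube_at k x)"
  by (simp add: mem_dcube_iff)

lemma mem_dcube_bounds:
  "x \<in> dcube c \<longleftrightarrow> (\<forall>i. corner c $ i \<le> x $ i \<and> x $ i < corner c $ i + side c)"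
proof -
  have "\<lfloor>x $ i / side c + shift (fst c)\<rfloor> = snd c $ i \<longleftrightarrow>
      corner c $ i \<le> x $ i \<and> x $ i < corner c $ i + side c" for i
  proof -
    have "snd c $ i \<le> x $ i / side c + shift (fst c) \<longleftrightarrow> corner c $ i \<le> x $ i"
      using pos_le_divide_eq[OF side_pos[of c], of "snd c $ i - shift (fst c)" "x $ i"]
      by (simp add: corner_def diff_le_eq)
    moreover have "x $ i / side c + shift (fst c) < snd c $ i + 1 \<longleftrightarrow> x $ i < corner c $ i + side c"
      using pos_divide_less_eq[OF side_pos[of c], of "x $ i" "snd c $ i - shift (fst c) + 1"]
      by (simp add: corner_def less_diff_eq algebra_simps)
    ultimately show ?thesis
      by (simp add: floor_eq_iff)
  qed
  then show ?thesis
    by (cases c) (simp add: mem_dcube_iff cube_at_def side_def vec_eq_iff)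
qed

lemma mem_tripled_bounds:
  "x \<in> tripled c \<longleftrightarrow> (\<forall>i. corner c $ i - side c \<le> x $ i \<and> x $ i \<le> corner c $ i + 2 * side c)"
  by (simp add: tripled_def mem_box_cart)

lemma dcube_subset_tripled: "dcube c \<subseteq> tripled c"
proof
  fix x assume x: "x \<in> dcube c"
  show "x \<in> tripled c"
    unfolding mem_tripled_bounds
  proof
    fix i
    show "corner c $ i - side c \<le> x $ i \<and> x $ i \<le> corner c $ i + 2 * side c"
      using x[unfolded mem_dcube_bounds, rule_format, of i] side_pos[of c] by linarith
  qed
qed

text \<open>With \<open>s = 3 * shift j\<close>, the coordinate \<open>m\<close> at scale \<open>j\<close> has the parent coordinate \<open>(m - s) div 2\<close>.\<close>

lemma cube_at_coarser:
  assumes "cube_at j x = cube_at j y" "j \<le> k"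
  shows "cube_at k x = cube_at k y"
proof -
  have "cube_at (j + int n) x = cube_at (j + int n) y" for n
  proof (induction n)
    case (Suc n)
    define h where "h = j + int n"
    have h: "j + int (Suc n) = h + 1"
      by (simp add: h_def)
    define s :: int where "s = (if even h then 1 else - 1)"
    have *: "\<lfloor>z / 2 powi (h + 1) + shift (h + 1)\<rfloor> = (\<lfloor>z / 2 powi h + shift h\<rfloor> - s) div 2" for z :: real
    proof -
      have "z / 2 powi (h + 1) + shift (h + 1) = ((z / 2 powi h + shift h) - real_of_int s) / real_of_int 2"
        by (simp add: power_int_add shift_def s_def field_simps)
      then have "\<lfloor>z / 2 powi (h + 1) + shift (h + 1)\<rfloor> = \<lfloor>(z / 2 powi h + shift h) - real_of_int s\<rfloor> div 2"
        by (simp only: floor_divide_real_eq_div)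
      then show ?thesis
        by simp
    qed
    have "\<lfloor>x $ i / 2 powi h + shift h\<rfloor> = \<lfloor>y $ i / 2 powi h + shift h\<rfloor>" for i
      using Suc.IH by (simp add: cube_at_def vec_eq_iff h_def)
    then show ?case
      unfolding h by (simp add: cube_at_def vec_eq_iff *)
  qed (use assms in simp)
  from this[of "nat (k - j)"] show ?thesis
    using assms by simp
qed

lemma dcube_nested:
  assumes "x \<in> dcube b" "x \<in> dcube c" "fst b \<le> fst c"
  shows "dcube b \<subseteq> dcube c"
proof
  fix y assume "y \<in> dcube b"
  then have "cube_at (fst b) y = cube_at (fst b) x"
    using assms by (simp add: mem_dcube_iff)
  then show "y \<in> dcube c"
    using cube_at_coarser[OF _ assms(3), of y x] assms(2) by (simp add: mem_dcube_iff)
qed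

lemma dcube_same_scale: "x \<in> dcube b \<Longrightarrow> x \<in> dcube c \<Longrightarrow> fst b = fst c \<Longrightarrow> b = c"
  by (metis mem_dcube_iff)

lemma corner_mem_dcube: "corner c \<in> dcube c"
  by (simp add: mem_dcube_bounds)

lemma dcube_nonempty: "dcube c \<noteq> {}"
  using corner_mem_dcube by blast

lemma dcube_borel [measurable]: "dcube c \<in> sets borel"
proof -
  have "dcube c = (\<Inter>i. {x. corner c $ i \<le> x $ i} \<inter> {x. x $ i < corner c $ i + side c})"
    by (auto simp: mem_dcube_bounds)
  also have "\<dots> \<in> sets borel"
    by (intro sets.countable_INT'' sets.Int borel_closed borel_open closed_Collect_le
        open_Collect_less continuous_intros) auto
  finally show ?thesis .
qed

lemma dcube_lebesgue [measurable]: "dcube c \<in> sets lebesgue"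
  by (simp add: sets_completionI_sets)

lemma tripled_lebesgue [measurable]: "tripled c \<in> sets lebesgue"
  by (simp add: tripled_def)

lemma emeasure_dcube: "emeasure lebesgue (dcube (c :: 'n::finite dyadic)) = ennreal (side c ^ CARD('n))"
proof -
  let ?a = "corner c" and ?b = "\<chi> i. corner c $ i + side c"
  have P: "(\<Prod>b\<in>Basis. (?b - ?a) \<bullet> b) = side c ^ CARD('n)"
    by (simp add: Basis_vec_def axis_eq_axis inner_axis prod.UNION_disjoint cart_eq_inner_axis[symmetric]
       algebra_simps prod.reindex inj_on_def UNION_singleton_eq_range)
  have le: "?a \<bullet> b \<le> ?b \<bullet> b" if "b \<in> Basis" for b
    using that by (auto simp: Basis_vec_def inner_axis algebra_simps less_imp_le)
  have "emeasure lborel (dcube c) \<le> emeasure lborel (cbox ?a ?b)"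
    by (intro emeasure_mono subsetI) (simp_all add: mem_dcube_bounds mem_box_cart order_less_le)
  moreover have "emeasure lborel (box ?a ?b) \<le> emeasure lborel (dcube c)"
    by (intro emeasure_mono subsetI) (simp_all add: mem_dcube_bounds mem_box_cart order_less_le)
  ultimately have "emeasure lborel (dcube c) = ennreal (side c ^ CARD('n))"
    using emeasure_lborel_box[of ?a ?b, OF le] emeasure_lborel_cbox[of ?a ?b, OF le]
    unfolding P by (metis antisym)
  then show ?thesis
    by simp
qed

lemma measure_dcube: "measure lebesgue (dcube (c :: 'n::finite dyadic)) = side c ^ CARD('n)"
  using emeasure_dcube[of c] by (simp add: measure_def less_imp_le)

lemma dcube_lmeasurable [simp]: "dcube c \<in> lmeasurable"
  by (simp add: fmeasurable_def emeasure_dcube)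

lemma is_cube_tripled: "is_cube (tripled c)"
  unfolding is_cube_def
  by (rule exI[of _ "\<chi> i. corner c $ i - side c"], rule exI[of _ "3 * side c"])
    (simp add: tripled_def algebra_simps)

lemma measure_tripled: "measure lebesgue (tripled (c :: 'n::finite dyadic)) = (3 * side c) ^ CARD('n)"
proof -
  have "corner c $ i - side c \<le> corner c $ i + 2 * side c" for i
    using side_pos[of c] by linarith
  then have "measure lborel (tripled c) = (\<Prod>i\<in>(UNIV::'n set). 3 * side c)"
    unfolding tripled_def
    by (subst content_cbox_cart) (auto simp: interval_ne_empty_cart)
  then show ?thesis
    by (simp add: tripled_def)
qed

lemma tripled_inject: "tripled b = tripled c \<longleftrightarrow> b = c"
proof
  assume eq: "tripled b = tripled c"
  have ne: "tripled b \<noteq> {}"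
    using dcube_subset_tripled dcube_nonempty by blast
  have *: "corner b $ i - side b = corner c $ i - side c"
    "corner b $ i + 2 * side b = corner c $ i + 2 * side c" for i
    using eq ne unfolding tripled_def by (auto simp: eq_cbox vec_eq_iff)
  have s: "side b = side c"
    using *[of undefined] by linarith
  then have f: "fst b = fst c"
    using power_int_strict_increasing[of "fst b" "fst c" "2::real"]
      power_int_strict_increasing[of "fst c" "fst b" "2::real"]
    by (metis side_def linorder_neqE less_irrefl one_less_numeral_iff semiring_norm(76))
  have "corner b = corner c"
    using *(1) s by (simp add: vec_eq_iff)
  then have "snd b = snd c"
    using s f side_pos[of c] by (simp add: vec_eq_iff corner_def)
  then show "b = c"
    using f by (simp add: prod_eq_iff)
qed simp

lemma dcube_subset_bounds:
  assumes sub: "dcube b \<subseteq> dcube c"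
  shows "corner c $ i \<le> corner b $ i" "corner b $ i + side b \<le> corner c $ i + side c"
proof -
  show "corner c $ i \<le> corner b $ i"
    using subsetD[OF sub corner_mem_dcube[of b]] unfolding mem_dcube_bounds by simp
  show "corner b $ i + side b \<le> corner c $ i + side c"
  proof (rule dense_le_bounded)
    show "corner b $ i < corner b $ i + side b"
      by simp
    fix t assume t: "corner b $ i < t" "t < corner b $ i + side b"
    have "(\<chi> j. if j = i then t else corner b $ j) \<in> dcube b"
      using t by (auto simp: mem_dcube_bounds)
    then have "(\<chi> j. if j = i then t else corner b $ j) \<in> dcube c"
      using sub by blast
    then show "t \<le> corner c $ i + side c"
      by (auto simp: mem_dcube_bounds dest!: spec[of _ i])
  qed
qed

lemma tripled_mono:
  assumes sub: "dcube b \<subseteq> dcube c"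
  shows "tripled b \<subseteq> tripled c"
proof
  fix x assume x: "x \<in> tripled b"
  show "x \<in> tripled c"
    unfolding mem_tripled_bounds
  proof
    fix i
    show "corner c $ i - side c \<le> x $ i \<and> x $ i \<le> corner c $ i + 2 * side c"
      using dcube_subset_bounds[OF sub, of i] x[unfolded mem_tripled_bounds, rule_format, of i]
      by linarith
  qed
qed

lemma dist_le_in_tripled:
  fixes x y :: "real ^ 'n"
  assumes "x \<in> dcube c" "y \<in> tripled c"
  shows "norm (x - y) \<le> real CARD('n) * (2 * side c)"
proof -
  have "\<bar>(x - y) $ i\<bar> \<le> 2 * side c" for i
    unfolding abs_le_iff using assms(1)[unfolded mem_dcube_bounds, rule_format, of i]
      assms(2)[unfolded mem_tripled_bounds, rule_format, of i]
    by simp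
  then have "(\<Sum>i\<in>UNIV. \<bar>(x - y) $ i\<bar>) \<le> real CARD('n) * (2 * side c)"
    by (intro sum_bounded_above) auto
  then show ?thesis
    using norm_le_l1_cart[of "x - y"] by linarith
qed

lemma dist_le_in_dcube:
  fixes x y :: "real ^ 'n"
  assumes "x \<in> dcube c" "y \<in> dcube c"
  shows "norm (x - y) \<le> real CARD('n) * side c"
proof -
  have "\<bar>(x - y) $ i\<bar> \<le> side c" for i
    unfolding abs_le_iff using assms(1)[unfolded mem_dcube_bounds, rule_format, of i]
      assms(2)[unfolded mem_dcube_bounds, rule_format, of i]
    by simp
  then have "(\<Sum>i\<in>UNIV. \<bar>(x - y) $ i\<bar>) \<le> real CARD('n) * side c"
    by (intro sum_bounded_above) auto
  then show ?thesis
    using norm_le_l1_cart[of "x - y"] by linarith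
qed

lemma dist_ge_outside_tripled:
  fixes x y :: "real ^ 'n"
  assumes "x \<in> dcube c" "y \<notin> tripled c"
  shows "side c \<le> norm (x - y)"
proof -
  obtain i where i: "\<not> (corner c $ i - side c \<le> y $ i \<and> y $ i \<le> corner c $ i + 2 * side c)"
    using assms(2) by (auto simp: mem_tripled_bounds)
  have "side c \<le> \<bar>(x - y) $ i\<bar>"
    using i assms(1)[unfolded mem_dcube_bounds, rule_format, of i]
    by (auto simp: abs_if)
  then show ?thesis
    using component_le_norm_cart[of "x - y" i] by linarith
qed

lemma dcube_subset_interior_tripled: "dcube c \<subseteq> interior (tripled c)"
proof
  fix x assume x: "x \<in> dcube c"
  have "y \<in> tripled c" if "dist x y < side c" for y
    using dist_ge_outside_tripled[OF x, of y] that by (auto simp: dist_norm)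
  then have "ball x (side c) \<subseteq> tripled c"
    by auto
  then show "x \<in> interior (tripled c)"
    using mem_interior side_pos by blast
qed

text \<open>
  Every stopping-time construction below selects the maximal cubes of a family whose scales are
  bounded above.
\<close>

lemma maximal_dyadic_cubes:
  fixes G :: "'n::finite dyadic set"
  assumes "\<And>c. c \<in> G \<Longrightarrow> fst c \<le> K"
  obtains P where "P \<subseteq> G" "disjoint_family_on dcube P" "(\<Union>c\<in>P. dcube c) = (\<Union>c\<in>G. dcube c)"
    "\<And>b c x. b \<in> P \<Longrightarrow> x \<in> dcube b \<Longrightarrow> x \<in> dcube c \<Longrightarrow> fst b < fst c \<Longrightarrow> c \<notin> G"
proof
  define P where "P = {b \<in> G. \<forall>x c. x \<in> dcube b \<longrightarrow> x \<in> dcube c \<longrightarrow> fst b < fst c \<longrightarrow> c \<notin> G}"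
  show "P \<subseteq> G"
    by (auto simp: P_def)
  show *: "\<And>b c x. b \<in> P \<Longrightarrow> x \<in> dcube b \<Longrightarrow> x \<in> dcube c \<Longrightarrow> fst b < fst c \<Longrightarrow> c \<notin> G"
    using \<open>P \<subseteq> G\<close> by (simp add: P_def del: split_paired_All)
  show "disjoint_family_on dcube P"
    unfolding disjoint_family_on_def
  proof (intro ballI impI equals0I)
    fix b c x assume bc: "b \<in> P" "c \<in> P" "b \<noteq> c" "x \<in> dcube b \<inter> dcube c"
    then have "fst b \<noteq> fst c"
      using dcube_same_scale by blast
    then consider "fst b < fst c" | "fst c < fst b"
      by linarith
    then show False
      using *[of b x c] *[of c x b] bc \<open>P \<subseteq> G\<close> by cases auto
  qed
  have "\<exists>b\<in>P. x \<in> dcube b" if c: "c \<in> G" "x \<in> dcube c" for c x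
  proof -
    define n where "n c = nat (K - fst c)" for c :: "'n dyadic"
    obtain b where b: "b \<in> G" "x \<in> dcube b" and least: "\<And>a. a \<in> G \<Longrightarrow> x \<in> dcube a \<Longrightarrow> n b \<le> n a"
      using ex_has_least_nat[of "\<lambda>b. b \<in> G \<and> x \<in> dcube b" c n] c by blast
    have "a \<notin> G" if a: "y \<in> dcube b" "y \<in> dcube a" "fst b < fst a" for y a
    proof
      assume "a \<in> G"
      moreover have "x \<in> dcube a"
        using dcube_nested[OF a(1,2)] a(3) b by auto
      ultimately have "n b \<le> n a"
        by (rule least)
      with a(3) assms[OF \<open>a \<in> G\<close>] assms[OF \<open>b \<in> G\<close>] show False
        by (simp add: n_def)
    qed
    then have "b \<in> P"
      using b(1) unfolding P_def by blast
    then show ?thesis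
      using b(2) by blast
  qed
  then show "(\<Union>c\<in>P. dcube c) = (\<Union>c\<in>G. dcube c)"
    using \<open>P \<subseteq> G\<close> by blast
qed

section \<open>Stopping cubes and maximal averages\<close>

lemma emeasure_ball_cart:
  "r \<ge> 0 \<Longrightarrow> emeasure lebesgue (ball (x :: real^'n) r) = ennreal (unit_ball_vol (real CARD('n)) * r ^ CARD('n))"
  using emeasure_ball[of r x] by simp

lemma emeasure_cball_cart:
  "r \<ge> 0 \<Longrightarrow> emeasure lebesgue (cball (x :: real^'n) r) = ennreal (unit_ball_vol (real CARD('n)) * r ^ CARD('n))"
  using emeasure_cball[of r x] by simp

text \<open>With densities for \<open>M\<close> and \<open>M'\<close>, a bound for averages on the cubes becomes one on their union.\<close>

lemma emeasure_dyadic_union_mono: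
  assumes P: "disjoint_family_on dcube P"
    and sets: "sets M = sets lebesgue" "sets M' = sets lebesgue"
    and le: "\<And>c. c \<in> P \<Longrightarrow> emeasure M (dcube c) \<le> emeasure M' (dcube c)"
  shows "emeasure M (\<Union>c\<in>P. dcube c) \<le> emeasure M' (\<Union>c\<in>P. dcube c)"
proof -
  have "emeasure M (\<Union>c\<in>P. dcube c) = (\<integral>\<^sup>+c. emeasure M (dcube c) \<partial>count_space P)"
    using P sets by (intro emeasure_UN_countable) auto
  also have "\<dots> \<le> (\<integral>\<^sup>+c. emeasure M' (dcube c) \<partial>count_space P)"
    using le by (intro nn_integral_mono) simp
  also have "\<dots> = emeasure M' (\<Union>c\<in>P. dcube c)"
    using P sets by (intro emeasure_UN_countable[symmetric]) auto
  finally show ?thesis .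
qed

lemma dyadic_union_lebesgue [measurable]: "(\<Union>c\<in>P. dcube c) \<in> sets lebesgue"
  by (rule sets.countable_UN'') auto

lemma emeasure_density_const_mult:
  "A \<in> sets M \<Longrightarrow> emeasure (density M (\<lambda>_. a)) A = a * emeasure M A"
  by (simp add: emeasure_density nn_integral_cmult_indicator)

lemma cubes_small_in_open:
  fixes x :: "real ^ 'n"
  assumes "open U" "x \<in> U"
  obtains c where "fst c \<le> 0" "x \<in> dcube c" "dcube c \<subseteq> U"
proof -
  obtain e where e: "e > 0" "ball x e \<subseteq> U"
    using assms openE by blast
  obtain n where n: "(1/2) ^ n < e / real CARD('n)"
    using e real_arch_pow_inv[of "e / real CARD('n)" "1/2"] by auto
  let ?c = "cube_at (- int n) x"
  have s: "side ?c = (1/2) ^ n"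
    by (simp add: side_def power_int_minus power_one_over inverse_eq_divide)
  have "dcube ?c \<subseteq> ball x e"
  proof
    fix y assume "y \<in> dcube ?c"
    then have "norm (x - y) \<le> real CARD('n) * (1/2) ^ n"
      using dist_le_in_dcube[of x ?c y] s by simp
    also have "\<dots> < e"
      using n by (simp add: field_simps)
    finally show "y \<in> ball x e"
      by (simp add: dist_norm)
  qed
  then show ?thesis
    using e by (intro that[of ?c]) auto
qed

text \<open>
  The differentiation theorem for dyadic cubes, in the form used for stopping cubes, follows from
  outer regularity: up to arbitrarily small measure \<open>D\<close> is a disjoint union of dyadic cubes that
  meet \<open>D\<close>, and on each of them the average of \<open>F\<close> is at most \<open>\<alpha>\<close>, although \<open>F \<ge> \<beta>\<close> on \<open>D\<close>.
\<close>

lemma null_set_of_small_dyadic_averages: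
  fixes F :: "real ^ 'n \<Rightarrow> ennreal"
  assumes F [measurable]: "F \<in> borel_measurable lebesgue" and fin: "(\<integral>\<^sup>+x. F x \<partial>lebesgue) < \<infinity>"
    and D [measurable]: "D \<in> sets lebesgue"
    and \<alpha>: "0 < \<alpha>" "\<alpha> < \<beta>"
    and big: "\<And>x. x \<in> D \<Longrightarrow> ennreal \<beta> \<le> F x"
    and avg: "\<And>x c. x \<in> D \<Longrightarrow> x \<in> dcube c \<Longrightarrow>
      (\<integral>\<^sup>+y\<in>dcube c. F y \<partial>lebesgue) \<le> ennreal \<alpha> * emeasure lebesgue (dcube c)"
  shows "D \<in> null_sets lebesgue"
proof -
  have bigD: "ennreal \<beta> * emeasure lebesgue D \<le> (\<integral>\<^sup>+y\<in>D. F y \<partial>lebesgue)"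
  proof -
    have "ennreal \<beta> * emeasure lebesgue D = (\<integral>\<^sup>+y. ennreal \<beta> * indicator D y \<partial>lebesgue)"
      by (simp add: nn_integral_cmult_indicator)
    also have "\<dots> \<le> (\<integral>\<^sup>+y\<in>D. F y \<partial>lebesgue)"
      by (intro nn_integral_mono) (auto simp: big split: split_indicator)
    finally show ?thesis .
  qed
  also have "\<dots> \<le> (\<integral>\<^sup>+y. F y \<partial>lebesgue)"
    by (intro nn_integral_mono) (auto split: split_indicator)
  finally have "emeasure lebesgue D < \<infinity>"
    using fin \<alpha> by (cases "emeasure lebesgue D = top") (auto simp: ennreal_mult_top less_top)
  then obtain m where m: "m \<ge> 0" "emeasure lebesgue D = ennreal m"
    by (cases "emeasure lebesgue D") auto
  have "\<beta> * m \<le> \<alpha> * m + \<alpha> * e" if "e > 0" for e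
  proof -
    obtain U where U: "open U" "D \<subseteq> U" "emeasure lebesgue (U - D) < ennreal e"
      using sets_lebesgue_outer_open[OF D \<open>e > 0\<close>] by metis
    have [measurable]: "U \<in> sets lebesgue"
      using U(1) by auto
    have bound: "fst c \<le> 0" if "c \<in> {c. fst c \<le> 0 \<and> dcube c \<subseteq> U}" for c :: "'n dyadic"
      using that by simp
    \<comment> \<open>disjoint cubes filling \<open>U\<close>; those that meet \<open>D\<close> still cover it\<close>
    obtain P where P: "P \<subseteq> {c. fst c \<le> 0 \<and> dcube c \<subseteq> U}" "disjoint_family_on dcube P"
      "(\<Union>c\<in>P. dcube c) = (\<Union>c\<in>{c. fst c \<le> 0 \<and> dcube c \<subseteq> U}. dcube c)"
      by (rule maximal_dyadic_cubes[OF bound])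
    define P' where "P' = {c \<in> P. dcube c \<inter> D \<noteq> {}}"
    have DP: "D \<subseteq> (\<Union>c\<in>P'. dcube c)"
    proof
      fix x assume x: "x \<in> D"
      then obtain c where "fst c \<le> 0" "x \<in> dcube c" "dcube c \<subseteq> U"
        using cubes_small_in_open[OF U(1)] U(2) by blast
      then have "x \<in> (\<Union>c\<in>P. dcube c)"
        unfolding P(3) by blast
      then show "x \<in> (\<Union>c\<in>P'. dcube c)"
        using x by (auto simp: P'_def)
    qed
    have "ennreal \<beta> * emeasure lebesgue D \<le> (\<integral>\<^sup>+y\<in>D. F y \<partial>lebesgue)"
      by (rule bigD)
    also have "\<dots> \<le> (\<integral>\<^sup>+y\<in>(\<Union>c\<in>P'. dcube c). F y \<partial>lebesgue)"
      using DP by (intro nn_integral_mono) (auto split: split_indicator)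
    also have "\<dots> = emeasure (density lebesgue F) (\<Union>c\<in>P'. dcube c)"
      by (simp add: emeasure_density)
    also have "\<dots> \<le> emeasure (density lebesgue (\<lambda>_. ennreal \<alpha>)) (\<Union>c\<in>P'. dcube c)"
    proof (rule emeasure_dyadic_union_mono)
      show "disjoint_family_on dcube P'"
        using P(2) by (auto simp: P'_def disjoint_family_on_def)
      show "emeasure (density lebesgue F) (dcube c) \<le> emeasure (density lebesgue (\<lambda>_. ennreal \<alpha>)) (dcube c)"
        if c: "c \<in> P'" for c
      proof -
        obtain x where "x \<in> D" "x \<in> dcube c"
          using c by (auto simp: P'_def)
        from avg[OF this] show ?thesis
          by (simp add: emeasure_density_const_mult emeasure_density)
      qed
    qed simp_all
    also have "\<dots> = ennreal \<alpha> * emeasure lebesgue (\<Union>c\<in>P'. dcube c)"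
      by (simp add: emeasure_density_const_mult)
    also have "\<dots> \<le> ennreal \<alpha> * emeasure lebesgue U"
      using P(1) by (intro mult_left_mono emeasure_mono) (auto simp: P'_def)
    also have "emeasure lebesgue U = emeasure lebesgue D + emeasure lebesgue (U - D)"
      using U(2) by (subst plus_emeasure) (auto simp: Un_absorb1)
    also have "ennreal \<alpha> * \<dots> \<le> ennreal \<alpha> * (ennreal m + ennreal e)"
      using U(3) m by (intro mult_left_mono add_mono) (auto intro: less_imp_le)
    also have "\<dots> = ennreal (\<alpha> * m + \<alpha> * e)"
      using m that \<alpha> by (simp flip: ennreal_plus ennreal_mult add: distrib_left)
    finally have "ennreal (\<beta> * m) \<le> ennreal (\<alpha> * m + \<alpha> * e)"
      using m \<alpha> by (simp add: ennreal_mult)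
    then show ?thesis
      using m \<alpha> that by (subst (asm) ennreal_le_iff) simp_all
  qed
  then have "(\<beta> - \<alpha>) * m \<le> 0 + e" if "e > 0" for e
    using that[THEN divide_pos_pos, OF \<alpha>(1)] \<alpha>(1) by (fastforce simp: algebra_simps)
  then have "(\<beta> - \<alpha>) * m \<le> 0"
    by (rule field_le_epsilon)
  then have "m = 0"
    using m \<alpha> by (simp add: mult_le_0_iff)
  then show ?thesis
    using m by (simp add: null_sets_def)
qed

text \<open>
  The cubes are the maximal ones on which the average exceeds \<open>\<alpha>\<close>; their parents violate this,
  whence the upper bound.
\<close>

theorem calderon_zygmund_cubes:
  fixes F :: "real ^ 'n \<Rightarrow> ennreal"
  assumes F [measurable]: "F \<in> borel_measurable lebesgue" and fin: "(\<integral>\<^sup>+x. F x \<partial>lebesgue) < \<infinity>"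
    and \<alpha>: "0 < \<alpha>"
  obtains P where "disjoint_family_on dcube P"
    "\<And>c. c \<in> P \<Longrightarrow> ennreal \<alpha> * emeasure lebesgue (dcube c) < (\<integral>\<^sup>+x\<in>dcube c. F x \<partial>lebesgue)"
    "\<And>c. c \<in> P \<Longrightarrow> (\<integral>\<^sup>+x\<in>dcube c. F x \<partial>lebesgue) \<le> ennreal (2 ^ CARD('n) * \<alpha>) * emeasure lebesgue (dcube c)"
    "AE x in lebesgue. x \<notin> (\<Union>c\<in>P. dcube c) \<longrightarrow> F x \<le> ennreal \<alpha>"
proof -
  define G where "G = {c. ennreal \<alpha> * emeasure lebesgue (dcube c) < (\<integral>\<^sup>+x\<in>dcube c. F x \<partial>lebesgue)}"
  obtain I where I: "I \<ge> 0" "(\<integral>\<^sup>+x. F x \<partial>lebesgue) = ennreal I"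
    using fin by (cases "\<integral>\<^sup>+x. F x \<partial>lebesgue") auto
  obtain K :: nat where K: "I / \<alpha> < 2 ^ K"
    using real_arch_pow[of 2 "I / \<alpha>"] by auto
  have bound: "fst c \<le> int K" if "c \<in> G" for c :: "'n dyadic"
  proof (rule ccontr)
    assume "\<not> fst c \<le> int K"
    then have "(2::real) powi int K \<le> side c"
      unfolding side_def by (intro power_int_increasing) auto
    then have "2 ^ K \<le> side c"
      by simp
    also have "side c \<le> side c ^ CARD('n)"
      using order_trans[OF one_le_power[of "2::real" K] \<open>2 ^ K \<le> side c\<close>]
      by (intro self_le_power) auto
    finally have "I / \<alpha> < side c ^ CARD('n)"
      using K by simp
    then have "ennreal I \<le> ennreal (\<alpha> * side c ^ CARD('n))"
      using \<alpha> I by (intro ennreal_leI) (simp add: field_simps)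
    also have "\<dots> = ennreal \<alpha> * emeasure lebesgue (dcube c)"
      using \<alpha> by (simp add: emeasure_dcube ennreal_mult less_imp_le)
    also have "\<dots> < (\<integral>\<^sup>+x\<in>dcube c. F x \<partial>lebesgue)"
      using that by (simp add: G_def)
    also have "\<dots> \<le> (\<integral>\<^sup>+x. F x \<partial>lebesgue)"
      by (intro nn_integral_mono) (auto split: split_indicator)
    finally show False
      using I by simp
  qed
  obtain P where P: "P \<subseteq> G" "disjoint_family_on dcube P"
    "(\<Union>c\<in>P. dcube c) = (\<Union>c\<in>G. dcube c)"
    "\<And>b c x. b \<in> P \<Longrightarrow> x \<in> dcube b \<Longrightarrow> x \<in> dcube c \<Longrightarrow> fst b < fst c \<Longrightarrow> c \<notin> G"
  proof (rule maximal_dyadic_cubes[of G "int K"])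
    show "\<And>c. c \<in> G \<Longrightarrow> fst c \<le> int K"
      by (rule bound)
  qed (rule that)
  show ?thesis
  proof (rule that[OF P(2)])
    fix c assume c: "c \<in> P"
    then show "ennreal \<alpha> * emeasure lebesgue (dcube c) < (\<integral>\<^sup>+x\<in>dcube c. F x \<partial>lebesgue)"
      using P(1) by (auto simp: G_def)
    obtain x where x: "x \<in> dcube c"
      using dcube_nonempty by blast
    let ?p = "cube_at (fst c + 1) x"
    have side: "side ?p = 2 * side c"
      by (simp add: side_def power_int_add)
    have "?p \<notin> G"
      by (rule P(4)[OF c x]) simp_all
    then have "(\<integral>\<^sup>+x\<in>dcube ?p. F x \<partial>lebesgue) \<le> ennreal \<alpha> * emeasure lebesgue (dcube ?p)"
      by (simp add: G_def)
    also have "\<dots> = ennreal (2 ^ CARD('n) * \<alpha>) * emeasure lebesgue (dcube c)"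
      using \<alpha> unfolding emeasure_dcube side
      by (simp add: power_mult_distrib mult_ac less_imp_le flip: ennreal_mult)
    finally have *: "(\<integral>\<^sup>+x\<in>dcube ?p. F x \<partial>lebesgue) \<le> \<dots>" .
    have "dcube c \<subseteq> dcube ?p"
      by (rule dcube_nested[OF x]) simp_all
    then have "(\<integral>\<^sup>+x\<in>dcube c. F x \<partial>lebesgue) \<le> (\<integral>\<^sup>+x\<in>dcube ?p. F x \<partial>lebesgue)"
      by (intro nn_integral_mono) (auto split: split_indicator)
    with * show "(\<integral>\<^sup>+x\<in>dcube c. F x \<partial>lebesgue) \<le> ennreal (2 ^ CARD('n) * \<alpha>) * emeasure lebesgue (dcube c)"
      by simp
  next
    let ?D = "\<lambda>n::nat. {x. x \<notin> (\<Union>c\<in>P. dcube c) \<and> ennreal (\<alpha> + 1 / real (Suc n)) \<le> F x}"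
    have null: "?D n \<in> null_sets lebesgue" for n
    proof (rule null_set_of_small_dyadic_averages[OF F fin _ \<alpha>, where \<beta> = "\<alpha> + 1 / real (Suc n)"])
      have "?D n = space lebesgue \<inter> {x. x \<notin> (\<Union>c\<in>P. dcube c)} \<inter> {x \<in> space lebesgue. ennreal (\<alpha> + 1 / real (Suc n)) \<le> F x}"
        by auto
      also have "\<dots> = (space lebesgue - (\<Union>c\<in>P. dcube c)) \<inter> {x \<in> space lebesgue. ennreal (\<alpha> + 1 / real (Suc n)) \<le> F x}"
        by auto
      also have "\<dots> \<in> sets lebesgue"
        by measurable
      finally show "?D n \<in> sets lebesgue" .
      show "(\<integral>\<^sup>+y\<in>dcube c. F y \<partial>lebesgue) \<le> ennreal \<alpha> * emeasure lebesgue (dcube c)"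
        if "x \<in> ?D n" "x \<in> dcube c" for x c
        using that P(3) by (force simp: G_def not_less)
    qed auto
    have "AE x in lebesgue. \<forall>n. x \<notin> ?D n"
      unfolding AE_all_countable using null AE_not_in by blast
    then show "AE x in lebesgue. x \<notin> (\<Union>c\<in>P. dcube c) \<longrightarrow> F x \<le> ennreal \<alpha>"
    proof (rule AE_mp, intro AE_I2 impI)
      fix x assume x: "\<forall>n. x \<notin> ?D n" "x \<notin> (\<Union>c\<in>P. dcube c)"
      have *: "F x \<le> ennreal (\<alpha> + 1 / real (Suc n))" for n
        using x by (auto simp: not_le intro: less_imp_le)
      have "(\<lambda>n. ennreal (\<alpha> + 1 / real (Suc n))) \<longlonglongrightarrow> ennreal (\<alpha> + 0)"
        by (intro tendsto_ennrealI tendsto_add tendsto_const LIMSEQ_Suc lim_1_over_n)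
      then show "F x \<le> ennreal \<alpha>"
        using * by (intro LIMSEQ_le_const[of _ _ "F x"]) auto
    qed
  qed
qed

text \<open>
  The superlevel set of the uncentred maximal function, written as the union of the balls
  themselves, which makes it open.
\<close>

definition large_averages :: "real \<Rightarrow> (real ^ 'n \<Rightarrow> ennreal) \<Rightarrow> (real ^ 'n) set" where
  "large_averages A F = (\<Union>(z, r) \<in> {(z, r). 0 < r \<and>
      ennreal A * emeasure lebesgue (ball z r) < (\<integral>\<^sup>+y\<in>ball z r. F y \<partial>lebesgue)}. ball z r)"

lemma large_averages_lebesgue [measurable]: "large_averages A F \<in> sets lebesgue"
proof -
  have "open (large_averages A F)"
    unfolding large_averages_def by (intro open_UN) auto
  then show ?thesis
    by auto
qed

lemma emeasure_UN_countable_le: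
  assumes "countable C" "\<And>i. i \<in> C \<Longrightarrow> A i \<in> sets M"
  shows "emeasure M (\<Union>i\<in>C. A i) \<le> (\<integral>\<^sup>+i. emeasure M (A i) \<partial>count_space C)"
proof -
  have U: "(\<Union>i\<in>C. A i) \<in> sets M"
    using assms by (intro sets.countable_UN') auto
  have "emeasure M (\<Union>i\<in>C. A i) = (\<integral>\<^sup>+x. indicator (\<Union>i\<in>C. A i) x \<partial>M)"
    using U by simp
  also have "\<dots> \<le> (\<integral>\<^sup>+x. (\<integral>\<^sup>+i. indicator (A i) x \<partial>count_space C) \<partial>M)"
  proof (intro nn_integral_mono)
    fix x
    show "indicator (\<Union>i\<in>C. A i) x \<le> (\<integral>\<^sup>+i. indicator (A i) x \<partial>count_space C)"
    proof (cases "x \<in> (\<Union>i\<in>C. A i)")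
      case True
      then obtain i where "i \<in> C" "x \<in> A i" by blast
      then show ?thesis
        using True nn_integral_ge_point[of i C "\<lambda>i. indicator (A i) x"] by simp
    qed simp
  qed
  also have "\<dots> = (\<integral>\<^sup>+i. (\<integral>\<^sup>+x. indicator (A i) x \<partial>M) \<partial>count_space C)"
    using assms by (intro nn_integral_count_space_nn_integral) auto
  also have "\<dots> = (\<integral>\<^sup>+i. emeasure M (A i) \<partial>count_space C)"
    using assms by (intro nn_integral_cong) simp
  finally show ?thesis .
qed

text \<open>Vitali's covering lemma selects disjoint balls whose fivefold dilates cover the set.\<close>

theorem hardy_littlewood_weak_type:
  fixes F :: "real ^ 'n \<Rightarrow> ennreal"
  assumes F [measurable]: "F \<in> borel_measurable lebesgue" and A: "0 < A"
  shows "ennreal A * emeasure lebesgue (large_averages A F) \<le> 5 ^ CARD('n) * (\<integral>\<^sup>+x. F x \<partial>lebesgue)"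
proof (cases "(\<integral>\<^sup>+x. F x \<partial>lebesgue) = \<infinity>")
  case True
  then show ?thesis by (simp add: ennreal_mult_top)
next
  case False
  then obtain I where I: "I \<ge> 0" "(\<integral>\<^sup>+x. F x \<partial>lebesgue) = ennreal I"
    by (cases "\<integral>\<^sup>+x. F x \<partial>lebesgue") auto
  let ?N = "CARD('n)" and ?v = "unit_ball_vol (real CARD('n))"
  define S where "S = {(z :: real^'n, r). 0 < r \<and>
      ennreal A * emeasure lebesgue (ball z r) < (\<integral>\<^sup>+y\<in>ball z r. F y \<partial>lebesgue)}"
  have r: "0 < snd i \<and> snd i \<le> max 1 (I / (A * ?v))" if "i \<in> S" for i
  proof -
    obtain z r where i: "i = (z, r)" by (cases i)
    have "0 < r" and *: "ennreal A * emeasure lebesgue (ball z r) < (\<integral>\<^sup>+y\<in>ball z r. F y \<partial>lebesgue)"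
      using that by (auto simp: S_def i)
    have "(\<integral>\<^sup>+y\<in>ball z r. F y \<partial>lebesgue) \<le> (\<integral>\<^sup>+x. F x \<partial>lebesgue)"
      by (intro nn_integral_mono) (auto split: split_indicator)
    with * have "ennreal (A * (?v * r ^ ?N)) < ennreal I"
      using A \<open>0 < r\<close> I(2) unfolding emeasure_ball_cart[OF less_imp_le[OF \<open>0 < r\<close>]]
      by (simp add: ennreal_mult less_imp_le)
    then have "A * ?v * r ^ ?N < I"
      using A \<open>0 < r\<close> by (simp add: ennreal_less_iff less_imp_le mult.assoc)
    then have "r ^ ?N < I / (A * ?v)"
      using A by (simp add: field_simps)
    moreover have "r \<le> max 1 (r ^ ?N)"
    proof (cases "r \<le> 1")
      case False
      then have "r \<le> r ^ ?N" by (intro self_le_power) auto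
      then show ?thesis by simp
    qed simp
    ultimately show ?thesis
      using \<open>0 < r\<close> i by auto
  qed
  have cov: "large_averages A F \<subseteq> (\<Union>i\<in>S. cball (fst i) (snd i))"
    by (fastforce simp: large_averages_def S_def)
  obtain C where C: "countable C" "C \<subseteq> S"
     "pairwise (\<lambda>i j. disjnt (cball (fst i) (snd i)) (cball (fst j) (snd j))) C"
     "large_averages A F \<subseteq> (\<Union>i\<in>C. cball (fst i) (5 * snd i))"
    by (rule Vitali_covering_lemma_cballs[OF cov r])
  have "ennreal A * emeasure lebesgue (large_averages A F)
      \<le> ennreal A * emeasure lebesgue (\<Union>i\<in>C. cball (fst i) (5 * snd i))"
    using C by (intro mult_left_mono emeasure_mono sets.countable_UN') auto
  also have "\<dots> \<le> ennreal A * (\<integral>\<^sup>+i. emeasure lebesgue (cball (fst i) (5 * snd i)) \<partial>count_space C)"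
    using C by (intro mult_left_mono emeasure_UN_countable_le) auto
  also have "\<dots> = (\<integral>\<^sup>+i. ennreal A * emeasure lebesgue (cball (fst i) (5 * snd i)) \<partial>count_space C)"
    by (rule nn_integral_cmult[symmetric]) simp
  also have "\<dots> \<le> (\<integral>\<^sup>+i. 5 ^ ?N * (\<integral>\<^sup>+y\<in>cball (fst i) (snd i). F y \<partial>lebesgue) \<partial>count_space C)"
  proof (intro nn_integral_mono)
    fix i assume "i \<in> space (count_space C)"
    then have i: "i \<in> S" "snd i > 0"
      using subsetD[OF C(2), of i] r[of i] by auto
    have "emeasure lebesgue (cball (fst i) (5 * snd i)) = ennreal (5 ^ ?N * (?v * snd i ^ ?N))"
      using i emeasure_cball_cart[of "5 * snd i" "fst i"] by (simp add: power_mult_distrib ac_simps)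
    also have "\<dots> = 5 ^ ?N * emeasure lebesgue (ball (fst i) (snd i))"
      unfolding emeasure_ball_cart[OF less_imp_le[OF i(2)]]
      using i by (subst ennreal_mult) (auto simp: less_imp_le simp flip: ennreal_power)
    finally have "ennreal A * emeasure lebesgue (cball (fst i) (5 * snd i))
        = 5 ^ ?N * (ennreal A * emeasure lebesgue (ball (fst i) (snd i)))"
      by (simp only: ac_simps)
    also have "\<dots> \<le> 5 ^ ?N * (\<integral>\<^sup>+y\<in>ball (fst i) (snd i). F y \<partial>lebesgue)"
      using i by (intro mult_left_mono) (auto simp: S_def intro: less_imp_le)
    also have "\<dots> \<le> 5 ^ ?N * (\<integral>\<^sup>+y\<in>cball (fst i) (snd i). F y \<partial>lebesgue)"
      by (intro mult_left_mono nn_integral_mono) (auto split: split_indicator)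
    finally show "ennreal A * emeasure lebesgue (cball (fst i) (5 * snd i))
      \<le> 5 ^ ?N * (\<integral>\<^sup>+y\<in>cball (fst i) (snd i). F y \<partial>lebesgue)" .
  qed
  also have "\<dots> = 5 ^ ?N * (\<integral>\<^sup>+i. emeasure (density lebesgue F) (cball (fst i) (snd i)) \<partial>count_space C)"
    by (subst nn_integral_cmult) (auto simp: emeasure_density)
  also have "\<dots> = 5 ^ ?N * emeasure (density lebesgue F) (\<Union>i\<in>C. cball (fst i) (snd i))"
    using C by (subst emeasure_UN_countable)
      (auto simp: disjoint_family_on_def pairwise_def disjnt_def)
  also have "\<dots> \<le> 5 ^ ?N * emeasure (density lebesgue F) UNIV"
    by (intro mult_left_mono emeasure_mono) auto
  also have "\<dots> = 5 ^ ?N * (\<integral>\<^sup>+x. F x \<partial>lebesgue)"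
    by (simp add: emeasure_density)
  finally show ?thesis .
qed

text \<open>
  Summation over the dyadic annuli around \<open>x\<close>: a kernel of size \<open>w k / (2 ^ k * r) ^ N\<close> on the
  \<open>k\<close>-th annulus, integrated against a measure of growth \<open>a * R ^ N\<close>.
\<close>

lemma annuli_bound:
  fixes x :: "real ^ 'n" and F G :: "real ^ 'n \<Rightarrow> ennreal" and w :: "nat \<Rightarrow> real"
  assumes F [measurable]: "F \<in> borel_measurable lebesgue" and G [measurable]: "G \<in> borel_measurable lebesgue"
    and r: "0 < r" and a: "0 \<le> a" and w: "\<And>k. 0 \<le> w k" "summable w"
    and growth: "\<And>R. R \<ge> r \<Longrightarrow> (\<integral>\<^sup>+y\<in>ball x R. G y \<partial>lebesgue) \<le> ennreal (a * R ^ CARD('n))"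
    and pt: "AE y in lebesgue. \<forall>k\<ge>1. 2 ^ k * r \<le> norm (x - y) \<longrightarrow> norm (x - y) < 2 ^ Suc k * r \<longrightarrow>
       F y \<le> ennreal (w k / (2 ^ k * r) ^ CARD('n)) * G y"
  shows "(\<integral>\<^sup>+y\<in>{y. 2 * r \<le> norm (x - y)}. F y \<partial>lebesgue) \<le> ennreal (2 ^ CARD('n) * a * suminf w)"
proof -
  define S where "S k = {y. 2 ^ Suc k * r \<le> norm (x - y)} \<inter> {y. norm (x - y) < 2 ^ Suc (Suc k) * r}" for k
  have S [measurable]: "S k \<in> sets lebesgue" for k
  proof -
    have "S k \<in> sets borel"
      unfolding S_def
      by (intro sets.Int borel_closed borel_open closed_Collect_le open_Collect_less continuous_intros)
    then show ?thesis
      by (rule sets_completionI_sets[of _ lborel, simplified])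
  qed
  have dis: "disjoint_family S"
    unfolding disjoint_family_on_def
  proof (intro ballI impI)
    have *: "S j \<inter> S k = {}" if "j < k" for j k
    proof -
      have "(2::real) ^ Suc (Suc j) * r \<le> 2 ^ Suc k * r"
        using that r by (intro mult_right_mono power_increasing) auto
      then show ?thesis
        by (auto simp: S_def mult_ac)
    qed
    then show "S j \<inter> S k = {}" if "j \<noteq> k" for j k
      using that *[of j k] *[of k j] by (cases j k rule: linorder_cases) auto
  qed
  have cov: "{y. 2 * r \<le> norm (x - y)} \<subseteq> (\<Union>k. S k)"
  proof
    fix y assume "y \<in> {y. 2 * r \<le> norm (x - y)}"
    then have y: "2 * r \<le> norm (x - y)" by simp
    obtain m :: nat where m: "norm (x - y) / r < 2 ^ m"
      using real_arch_pow[of 2 "norm (x - y) / r"] by auto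
    define n where "n = (LEAST n. norm (x - y) < 2 ^ n * r)"
    have n: "norm (x - y) < 2 ^ n * r"
      unfolding n_def by (rule LeastI[of _ m]) (use m r in \<open>simp add: field_simps\<close>)
    have "n \<ge> 2"
    proof (rule ccontr)
      assume "\<not> n \<ge> 2"
      then have "n = 0 \<or> n = 1" by linarith
      then show False
        using n y r by auto
    qed
    then obtain k where k: "n = Suc (Suc k)"
      by (metis add_2_eq_Suc le_Suc_ex)
    have "\<not> norm (x - y) < 2 ^ Suc k * r"
      using not_less_Least[of "Suc k" "\<lambda>n. norm (x - y) < 2 ^ n * r"] k by (simp add: n_def)
    then have "y \<in> S k"
      using n k by (simp add: S_def)
    then show "y \<in> (\<Union>k. S k)" by blast
  qed
  have "(\<integral>\<^sup>+y\<in>{y. 2 * r \<le> norm (x - y)}. F y \<partial>lebesgue) \<le> (\<integral>\<^sup>+y\<in>(\<Union>k. S k). F y \<partial>lebesgue)"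
    using cov by (intro nn_integral_mono) (auto split: split_indicator)
  also have "\<dots> = emeasure (density lebesgue F) (\<Union>k. S k)"
    by (simp add: emeasure_density)
  also have "\<dots> = (\<Sum>k. emeasure (density lebesgue F) (S k))"
    using dis by (intro suminf_emeasure[symmetric]) auto
  also have "\<dots> \<le> (\<Sum>k. ennreal (2 ^ CARD('n) * a * w (Suc k)))"
  proof (intro suminf_le summableI)
    fix k
    let ?c = "w (Suc k) / (2 ^ Suc k * r) ^ CARD('n)"
    have c: "0 \<le> ?c"
      using w r by simp
    have "emeasure (density lebesgue F) (S k) = (\<integral>\<^sup>+y\<in>S k. F y \<partial>lebesgue)"
      by (simp add: emeasure_density)
    also have "\<dots> \<le> (\<integral>\<^sup>+y. ennreal ?c * (G y * indicator (ball x (2 ^ Suc (Suc k) * r)) y) \<partial>lebesgue)"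
    proof (rule nn_integral_mono_AE, rule AE_mp[OF pt], intro AE_I2 impI)
      fix y assume y: "\<forall>k\<ge>1. 2 ^ k * r \<le> norm (x - y) \<longrightarrow> norm (x - y) < 2 ^ Suc k * r \<longrightarrow>
        F y \<le> ennreal (w k / (2 ^ k * r) ^ CARD('n)) * G y"
      show "F y * indicator (S k) y \<le> ennreal ?c * (G y * indicator (ball x (2 ^ Suc (Suc k) * r)) y)"
      proof (cases "y \<in> S k")
        case True
        then have "F y \<le> ennreal ?c * G y" "y \<in> ball x (2 ^ Suc (Suc k) * r)"
          using y[rule_format, of "Suc k"] by (auto simp: S_def dist_norm)
        then show ?thesis using True by simp
      qed simp
    qed
    also have "\<dots> = ennreal ?c * (\<integral>\<^sup>+y\<in>ball x (2 ^ Suc (Suc k) * r). G y \<partial>lebesgue)"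
      by (rule nn_integral_cmult) (intro borel_measurable_times_ennreal borel_measurable_indicator G; simp)
    also have "\<dots> \<le> ennreal ?c * ennreal (a * (2 ^ Suc (Suc k) * r) ^ CARD('n))"
    proof (intro mult_left_mono growth)
      show "r \<le> 2 ^ Suc (Suc k) * r"
        using r one_le_power[of "2::real" "Suc (Suc k)"] by simp
    qed simp
    also have "\<dots> = ennreal (?c * (a * (2 ^ Suc (Suc k) * r) ^ CARD('n)))"
      using c by (rule ennreal_mult'[symmetric])
    also have "?c * (a * (2 ^ Suc (Suc k) * r) ^ CARD('n)) = 2 ^ CARD('n) * a * w (Suc k)"
    proof -
      have "(2 ^ Suc (Suc k) * r) ^ CARD('n) = 2 ^ CARD('n) * (2 ^ Suc k * r) ^ CARD('n)"
        by (simp only: power_Suc[of 2 "Suc k"] power_mult_distrib mult.assoc)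
      then show ?thesis
        using r by simp
    qed
    finally show "emeasure (density lebesgue F) (S k) \<le> ennreal (2 ^ CARD('n) * a * w (Suc k))" .
  qed
  also have "\<dots> = ennreal (\<Sum>k. 2 ^ CARD('n) * a * w (Suc k))"
    using w a by (intro suminf_ennreal2) (auto intro!: summable_mult simp: summable_Suc_iff)
  also have "\<dots> \<le> ennreal (2 ^ CARD('n) * a * suminf w)"
  proof (intro ennreal_leI)
    have "(\<Sum>k. w (Suc k)) \<le> suminf w"
      using w suminf_split_head[of w] by simp
    then show "(\<Sum>k. 2 ^ CARD('n) * a * w (Suc k)) \<le> 2 ^ CARD('n) * a * suminf w"
      using w a by (subst suminf_mult) (auto intro!: mult_left_mono simp: summable_Suc_iff)
  qed
  finally show ?thesis .
qed

section \<open>Weak type of the operator on \<open>L\<^sup>1 \<inter> L\<^sup>2\<close>\<close>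

lemma markov_le:
  fixes F :: "'a \<Rightarrow> ennreal"
  assumes [measurable]: "F \<in> borel_measurable M"
  shows "t * emeasure M {x \<in> space M. t < F x} \<le> (\<integral>\<^sup>+x. F x \<partial>M)"
proof -
  have "t * emeasure M {x \<in> space M. t < F x} = (\<integral>\<^sup>+x. t * indicator {x \<in> space M. t < F x} x \<partial>M)"
    by (simp add: nn_integral_cmult_indicator)
  also have "\<dots> \<le> (\<integral>\<^sup>+x. F x \<partial>M)"
    by (intro nn_integral_mono) (auto split: split_indicator)
  finally show ?thesis .
qed

lemma emeasure_le_divide:
  assumes "ennreal t * e \<le> ennreal s" "0 < t" "0 \<le> s"
  shows "e \<le> ennreal (s / t)"
proof (cases e)
  case (real r)
  then have "t * r \<le> s"
    using assms by (simp flip: ennreal_mult)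
  then show ?thesis
    using assms real by (simp add: field_simps)
next
  case top
  then show ?thesis using assms by (simp add: ennreal_mult_top top_unique)
qed

lemma superlevel_lebesgue [measurable (raw)]:
  fixes u :: "real ^ 'n \<Rightarrow> real"
  assumes [measurable]: "u \<in> borel_measurable lebesgue"
  shows "{x. t < u x} \<in> sets lebesgue"
proof -
  have "{x \<in> space lebesgue. t < u x} \<in> sets lebesgue"
    by measurable
  then show ?thesis by simp
qed

lemma markov_real:
  assumes [measurable]: "u \<in> borel_measurable lebesgue" and t: "0 < t" and s: "0 \<le> s"
    and int: "(\<integral>\<^sup>+x. ennreal \<bar>u x\<bar> \<partial>lebesgue) \<le> ennreal s"
  shows "emeasure lebesgue {x. t < \<bar>u x\<bar>} \<le> ennreal (s / t)"
proof -
  have "ennreal t * emeasure lebesgue {x \<in> space lebesgue. ennreal t < ennreal \<bar>u x\<bar>} \<le> ennreal s"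
    by (rule order_trans[OF markov_le int]) simp
  then have "ennreal t * emeasure lebesgue {x. t < \<bar>u x\<bar>} \<le> ennreal s"
    using t by (simp add: ennreal_less_iff)
  then show ?thesis
    using t s by (rule emeasure_le_divide)
qed

abbreviation norm_L1 :: "(real ^ 'n \<Rightarrow> real) \<Rightarrow> real" where
  "norm_L1 f \<equiv> (LINT x|lebesgue. \<bar>f x\<bar>)"

lemma nn_set_integral_real:
  fixes h :: "real ^ 'n \<Rightarrow> real"
  assumes "integrable lebesgue h" "A \<in> sets lebesgue"
  shows "(\<integral>\<^sup>+y\<in>A. ennreal \<bar>h y\<bar> \<partial>lebesgue) = ennreal (LINT y|lebesgue. indicator A y * \<bar>h y\<bar>)"
proof -
  have int: "integrable lebesgue (\<lambda>y. indicator A y * \<bar>h y\<bar>)"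
    using assms integrable_mult_indicator[of A lebesgue "\<lambda>y. \<bar>h y\<bar>"] by simp
  have "(\<integral>\<^sup>+y\<in>A. ennreal \<bar>h y\<bar> \<partial>lebesgue) = (\<integral>\<^sup>+y. ennreal (indicator A y * \<bar>h y\<bar>) \<partial>lebesgue)"
    by (intro nn_integral_cong) (auto split: split_indicator)
  also have "\<dots> = ennreal (LINT y|lebesgue. indicator A y * \<bar>h y\<bar>)"
    using int by (intro nn_integral_eq_integral) auto
  finally show ?thesis .
qed

lemma nn_integral_real:
  fixes h :: "real ^ 'n \<Rightarrow> real"
  assumes "integrable lebesgue h"
  shows "(\<integral>\<^sup>+y. ennreal \<bar>h y\<bar> \<partial>lebesgue) = ennreal (norm_L1 h)"
  using assms by (intro nn_integral_eq_integral) auto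

lemma integrable_mult_ind:
  fixes h :: "'a \<Rightarrow> real"
  assumes "integrable M h" "A \<in> sets M"
  shows "integrable M (\<lambda>y. h y * indicator A y)" "integrable M (\<lambda>y. indicator A y * h y)"
  using integrable_mult_indicator[OF assms(2,1)] by (simp_all add: mult.commute)

lemma square_integrable_measurable [measurable_dest]:
  "square_integrable f \<Longrightarrow> f \<in> borel_measurable lebesgue"
  by (simp add: square_integrable_def)

lemma square_integrable_mult:
  "square_integrable f \<Longrightarrow> square_integrable (\<lambda>x. c * f x)"
  by (auto simp: square_integrable_def power_mult_distrib)

lemma square_integrable_bounded_mult:
  assumes f: "square_integrable f" and [measurable]: "g \<in> borel_measurable lebesgue"
    and g: "\<And>x. \<bar>g x\<bar> \<le> 1"
  shows "square_integrable (\<lambda>x. f x * g x)"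
  unfolding square_integrable_def
proof
  have [measurable]: "f \<in> borel_measurable lebesgue"
    using f by measurable
  show "(\<lambda>x. f x * g x) \<in> borel_measurable lebesgue"
    by measurable
  show "integrable lebesgue (\<lambda>x. (f x * g x)\<^sup>2)"
  proof (rule Bochner_Integration.integrable_bound)
    show "integrable lebesgue (\<lambda>x. (f x)\<^sup>2)"
      using f by (simp add: square_integrable_def)
    have "(g x)\<^sup>2 \<le> 1" for x
      using g[of x] by (simp add: abs_square_le_1)
    then show "AE x in lebesgue. norm ((f x * g x)\<^sup>2) \<le> norm ((f x)\<^sup>2)"
      by (auto simp: power_mult_distrib mult_left_le)
  qed measurable
qed

lemma square_integrable_add:
  assumes f: "square_integrable f" and g: "square_integrable g"
  shows "square_integrable (\<lambda>x. f x + g x)"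
  unfolding square_integrable_def
proof
  have [measurable]: "f \<in> borel_measurable lebesgue" "g \<in> borel_measurable lebesgue"
    using f g by (auto simp: square_integrable_def)
  show "(\<lambda>x. f x + g x) \<in> borel_measurable lebesgue"
    by measurable
  show "integrable lebesgue (\<lambda>x. (f x + g x)\<^sup>2)"
  proof (rule Bochner_Integration.integrable_bound)
    show "integrable lebesgue (\<lambda>x. 2 * (f x)\<^sup>2 + 2 * (g x)\<^sup>2)"
      using f g by (simp add: square_integrable_def)
    have "(a + b)\<^sup>2 \<le> 2 * a\<^sup>2 + 2 * b\<^sup>2" for a b :: real
      using sum_squares_bound[of a b] by (simp add: power2_sum)
    then show "AE x in lebesgue. norm ((f x + g x)\<^sup>2) \<le> norm (2 * (f x)\<^sup>2 + 2 * (g x)\<^sup>2)"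
      by (auto intro!: AE_I2)
  qed measurable
qed

lemma square_integrable_diff:
  "square_integrable f \<Longrightarrow> square_integrable g \<Longrightarrow> square_integrable (\<lambda>x. f x - g x)"
  using square_integrable_add[of f "\<lambda>x. (-1) * g x"] square_integrable_mult[of g "-1"] by simp

lemma square_integrable_zero: "square_integrable (\<lambda>_. 0)"
  by (simp add: square_integrable_def)

lemma square_integrable_sum:
  "(\<And>i. i \<in> I \<Longrightarrow> square_integrable (f i)) \<Longrightarrow> square_integrable (\<lambda>x. \<Sum>i\<in>I. f i x)"
  by (induction I rule: infinite_finite_induct)
    (auto intro: square_integrable_add simp: square_integrable_zero)

lemma square_integrable_indicator:
  "A \<in> lmeasurable \<Longrightarrow> square_integrable (\<lambda>x. indicator A x)"
  by (auto simp: square_integrable_def fmeasurable_def power2_eq_square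
      simp flip: indicator_inter_arith intro!: integrable_real_indicator)

lemma square_integrable_of_bounded:
  assumes g: "integrable lebesgue g" and M: "AE x in lebesgue. \<bar>g x\<bar> \<le> M"
  shows "square_integrable g" "(LINT x|lebesgue. (g x)\<^sup>2) \<le> M * norm_L1 g"
proof -
  have [measurable]: "g \<in> borel_measurable lebesgue"
    using g by auto
  have bd: "AE x in lebesgue. (g x)\<^sup>2 \<le> M * \<bar>g x\<bar>"
    using M
  proof (rule AE_mp, intro AE_I2 impI)
    fix x assume "\<bar>g x\<bar> \<le> M"
    then have "\<bar>g x\<bar> * \<bar>g x\<bar> \<le> M * \<bar>g x\<bar>"
      by (rule mult_right_mono) simp
    then show "(g x)\<^sup>2 \<le> M * \<bar>g x\<bar>"
      by (simp add: power2_eq_square)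
  qed
  have int: "integrable lebesgue (\<lambda>x. (g x)\<^sup>2)"
  proof (rule Bochner_Integration.integrable_bound)
    show "integrable lebesgue (\<lambda>x. M * \<bar>g x\<bar>)"
      using g by simp
    show "AE x in lebesgue. norm ((g x)\<^sup>2) \<le> norm (M * \<bar>g x\<bar>)"
      using bd by (rule AE_mp) (auto intro!: AE_I2)
  qed measurable
  then show "square_integrable g"
    by (simp add: square_integrable_def)
  show "(LINT x|lebesgue. (g x)\<^sup>2) \<le> M * norm_L1 g"
    using int g bd by (subst integral_mult_right_zero[symmetric]) (rule integral_mono_AE, auto)
qed

lemma not_in_ess_supportI:
  assumes "open U" "x \<in> U" "\<And>y. y \<in> U \<Longrightarrow> f y = 0"
  shows "x \<notin> ess_support f"
  using assms unfolding ess_support_def by auto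

text \<open>
  Summability of \<open>\<omega>\<close> along the powers of \<open>1/2\<close> is the form in which the Dini condition enters.
\<close>

locale calderon_zygmund =
  fixes T :: "(real ^ 'n \<Rightarrow> real) \<Rightarrow> real ^ 'n \<Rightarrow> real"
    and K :: "real ^ 'n \<Rightarrow> real ^ 'n \<Rightarrow> real" and \<omega> :: "real \<Rightarrow> real" and B \<kappa> :: real
  assumes \<omega>_mono: "mono_on {0..} \<omega>" and \<omega>_0: "\<omega> 0 = 0"
    and \<omega>_summable: "summable (\<lambda>k. \<omega> ((1/2) ^ k))"
    and T_square_integrable: "square_integrable f \<Longrightarrow> square_integrable (T f)"
    and T_linear: "square_integrable f \<Longrightarrow> square_integrable g \<Longrightarrow>
        AE x in lebesgue. T (\<lambda>y. a * f y + b * g y) x = a * T f x + b * T g x"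
    and T_bounded: "square_integrable f \<Longrightarrow> norm_L2 (T f) \<le> B * norm_L2 f"
    and B_nonneg: "0 \<le> B" and \<kappa>_nonneg: "0 \<le> \<kappa>"
    and K_size: "x \<noteq> y \<Longrightarrow> \<bar>K x y\<bar> \<le> \<kappa> / norm (x - y) ^ CARD('n)"
    and K_smooth: "x \<noteq> y \<Longrightarrow> 2 * norm (x - x') \<le> norm (x - y) \<Longrightarrow>
        \<bar>K x y - K x' y\<bar> + \<bar>K y x - K y x'\<bar>
          \<le> \<omega> (norm (x - x') / norm (x - y)) / norm (x - y) ^ CARD('n)"
    and T_kernel: "square_integrable f \<Longrightarrow>
        AE x in lebesgue. x \<notin> ess_support f \<longrightarrow>
          has_bochner_integral lebesgue (\<lambda>y. K x y * f y) (T f x)"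
begin

definition D :: real where "D = (\<Sum>k. \<omega> ((1/2) ^ k))"

lemma \<omega>_nonneg: "0 \<le> t \<Longrightarrow> 0 \<le> \<omega> t"
  using mono_onD[OF \<omega>_mono, of 0 t] \<omega>_0 by simp

lemma D_nonneg: "0 \<le> D"
  unfolding D_def by (intro suminf_nonneg \<omega>_summable \<omega>_nonneg) simp

lemma K_smooth_annulus:
  assumes "norm (x - x') \<le> r" "0 < r" "1 \<le> k" "2 ^ k * r \<le> norm (x - y)"
  shows "\<bar>K x y - K x' y\<bar> \<le> \<omega> ((1/2) ^ k) / (2 ^ k * r) ^ CARD('n)"
    and "\<bar>K y x - K y x'\<bar> \<le> \<omega> ((1/2) ^ k) / (2 ^ k * r) ^ CARD('n)"
proof -
  have pos: "0 < 2 ^ k * r"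
    using assms by simp
  then have "0 < norm (x - y)"
    using assms by linarith
  then have ne: "x \<noteq> y" "0 < norm (x - y)"
    by auto
  have "(2::real) ^ 1 \<le> 2 ^ k"
    using assms by (intro power_increasing) auto
  then have "2 * r \<le> 2 ^ k * r"
    using assms by simp
  then have "2 * norm (x - x') \<le> norm (x - y)"
    using assms by linarith
  note * = K_smooth[OF ne(1) this]
  have "norm (x - x') / norm (x - y) \<le> r / (2 ^ k * r)"
    using assms pos by (intro frac_le) auto
  also have "\<dots> = (1/2) ^ k"
    using assms by (simp add: power_one_over)
  finally have "\<omega> (norm (x - x') / norm (x - y)) \<le> \<omega> ((1/2) ^ k)"
    using \<omega>_mono by (auto simp: mono_on_def)
  moreover have "(2 ^ k * r) ^ CARD('n) \<le> norm (x - y) ^ CARD('n)"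
    using pos assms by (intro power_mono) auto
  ultimately have **: "\<omega> (norm (x - x') / norm (x - y)) / norm (x - y) ^ CARD('n)
      \<le> \<omega> ((1/2) ^ k) / (2 ^ k * r) ^ CARD('n)"
    using pos ne by (intro frac_le \<omega>_nonneg) auto
  show "\<bar>K x y - K x' y\<bar> \<le> \<omega> ((1/2) ^ k) / (2 ^ k * r) ^ CARD('n)"
    and "\<bar>K y x - K y x'\<bar> \<le> \<omega> ((1/2) ^ k) / (2 ^ k * r) ^ CARD('n)"
    using * ** by auto
qed

lemma T_measurable: "square_integrable f \<Longrightarrow> T f \<in> borel_measurable lebesgue"
  using T_square_integrable square_integrable_measurable by blast

lemma T_add:
  "square_integrable f \<Longrightarrow> square_integrable g \<Longrightarrow>
    AE x in lebesgue. T (\<lambda>y. f y + g y) x = T f x + T g x"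
  using T_linear[of f g 1 1] by simp

lemma T_diff:
  "square_integrable f \<Longrightarrow> square_integrable g \<Longrightarrow>
    AE x in lebesgue. T (\<lambda>y. f y - g y) x = T f x - T g x"
  using T_linear[of f g 1 "-1"] by simp

lemma T_sum:
  assumes "finite I" "\<And>i. i \<in> I \<Longrightarrow> square_integrable (f i)"
  shows "AE x in lebesgue. T (\<lambda>y. \<Sum>i\<in>I. f i y) x = (\<Sum>i\<in>I. T (f i) x)"
  using assms
proof (induction I)
  case empty
  then show ?case
    using T_linear[OF square_integrable_zero square_integrable_zero, of 0 0] by simp
next
  case (insert i I)
  have "AE x in lebesgue. T (\<lambda>y. f i y + (\<Sum>i\<in>I. f i y)) x = T (f i) x + T (\<lambda>y. \<Sum>i\<in>I. f i y) x"
    using insert.prems by (intro T_add square_integrable_sum) auto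
  moreover have "AE x in lebesgue. T (\<lambda>y. \<Sum>i\<in>I. f i y) x = (\<Sum>i\<in>I. T (f i) x)"
    using insert by auto
  ultimately show ?case
    using insert.hyps by (auto elim!: AE_mp)
qed

lemma T_weak_L2:
  assumes f: "square_integrable f" and t: "0 < t"
  shows "emeasure lebesgue {x. t < \<bar>T f x\<bar>} \<le> ennreal (B\<^sup>2 * (LINT x|lebesgue. (f x)\<^sup>2) / t\<^sup>2)"
proof -
  have Tf: "square_integrable (T f)"
    by (rule T_square_integrable[OF f])
  then have [measurable]: "T f \<in> borel_measurable lebesgue" by measurable
  have nn: "0 \<le> (LINT x|lebesgue. (f x)\<^sup>2)" "0 \<le> (LINT x|lebesgue. (T f x)\<^sup>2)"
    by (auto intro: integral_nonneg_AE)
  have "sqrt (LINT x|lebesgue. (T f x)\<^sup>2) \<le> B * sqrt (LINT x|lebesgue. (f x)\<^sup>2)"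
    using T_bounded[OF f] by (simp add: norm_L2_def)
  then have "(sqrt (LINT x|lebesgue. (T f x)\<^sup>2))\<^sup>2 \<le> (B * sqrt (LINT x|lebesgue. (f x)\<^sup>2))\<^sup>2"
    using nn by (intro power_mono) auto
  then have le: "(LINT x|lebesgue. (T f x)\<^sup>2) \<le> B\<^sup>2 * (LINT x|lebesgue. (f x)\<^sup>2)"
    using nn by (simp add: power_mult_distrib)
  have "emeasure lebesgue {x. t\<^sup>2 < \<bar>(T f x)\<^sup>2\<bar>} \<le> ennreal (B\<^sup>2 * (LINT x|lebesgue. (f x)\<^sup>2) / t\<^sup>2)"
  proof (rule markov_real)
    show "(\<integral>\<^sup>+x. ennreal \<bar>(T f x)\<^sup>2\<bar> \<partial>lebesgue) \<le> ennreal (B\<^sup>2 * (LINT x|lebesgue. (f x)\<^sup>2))"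
      using Tf le by (subst nn_integral_real) (auto simp: square_integrable_def)
  qed (use t nn in auto)
  moreover have "{x. t < \<bar>T f x\<bar>} \<subseteq> {x. t\<^sup>2 < \<bar>(T f x)\<^sup>2\<bar>}"
    using t by (auto simp: abs_le_square_iff power2_less_imp_less dest: power_strict_mono[of t _ 2])
  moreover have "{x. t\<^sup>2 < \<bar>(T f x)\<^sup>2\<bar>} \<in> sets lebesgue"
    by (intro superlevel_lebesgue) measurable
  ultimately show ?thesis
    by (blast intro: order_trans emeasure_mono)
qed

text \<open>
  The cancellation of \<open>b\<close> lets the kernel be replaced by its increment, whose smoothness is
  summed over the annuli around \<open>z\<close>.
\<close>

lemma T_atom:
  assumes b: "square_integrable b" "integrable lebesgue b" and mean: "(LINT y|lebesgue. b y) = 0"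
    and supp: "\<And>y. b y \<noteq> 0 \<Longrightarrow> norm (z - y) \<le> r" and r: "0 < r"
  shows "(\<integral>\<^sup>+x\<in>{x. 2 * r \<le> norm (z - x)}. ennreal \<bar>T b x\<bar> \<partial>lebesgue)
    \<le> ennreal (2 ^ CARD('n) * (unit_ball_vol (real CARD('n)) * norm_L1 b) * D)"
  unfolding D_def
proof (rule annuli_bound[where G = "\<lambda>_. ennreal (norm_L1 b)"])
  have [measurable]: "T b \<in> borel_measurable lebesgue"
    by (rule T_measurable[OF b(1)])
  show "(\<lambda>x. ennreal \<bar>T b x\<bar>) \<in> borel_measurable lebesgue"
    by measurable
  have nn: "0 \<le> norm_L1 b"
    by simp
  show "0 \<le> unit_ball_vol (real CARD('n)) * norm_L1 b"
    using nn by simp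
  show "(\<integral>\<^sup>+y\<in>ball z R. ennreal (norm_L1 b) \<partial>lebesgue)
      \<le> ennreal (unit_ball_vol (real CARD('n)) * norm_L1 b * R ^ CARD('n))" if "r \<le> R" for R
  proof -
    have "(\<integral>\<^sup>+y\<in>ball z R. ennreal (norm_L1 b) \<partial>lebesgue)
        = ennreal (norm_L1 b) * emeasure lebesgue (ball z R)"
      by (rule nn_integral_cmult_indicator) simp
    also have "\<dots> = ennreal (unit_ball_vol (real CARD('n)) * norm_L1 b * R ^ CARD('n))"
      using that r nn by (subst emeasure_ball_cart) (auto simp: mult_ac simp flip: ennreal_mult)
    finally show ?thesis by simp
  qed
  show "AE x in lebesgue. \<forall>k\<ge>1. 2 ^ k * r \<le> norm (z - x) \<longrightarrow> norm (z - x) < 2 ^ Suc k * r \<longrightarrow>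
      ennreal \<bar>T b x\<bar> \<le> ennreal (\<omega> ((1/2) ^ k) / (2 ^ k * r) ^ CARD('n)) * ennreal (norm_L1 b)"
    using T_kernel[OF b(1)]
  proof (rule AE_mp, intro AE_I2 impI allI)
    fix x k assume rep: "x \<notin> ess_support b \<longrightarrow> has_bochner_integral lebesgue (\<lambda>y. K x y * b y) (T b x)"
      and k: "1 \<le> k" and lo: "2 ^ k * r \<le> norm (z - x)"
    have "(2::real) ^ 1 \<le> 2 ^ k"
      using k by (intro power_increasing) auto
    then have "2 * r \<le> 2 ^ k * r"
      using r by simp
    with lo r have far: "r < norm (z - x)"
      by linarith
    have "x \<notin> ess_support b"
    proof (rule not_in_ess_supportI)
      show "open (- cball z r)" "x \<in> - cball z r"
        using far by (auto simp: dist_norm)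
      show "b y = 0" if "y \<in> - cball z r" for y
        using that supp[of y] by (auto simp: dist_norm)
    qed
    with rep have T: "has_bochner_integral lebesgue (\<lambda>y. K x y * b y) (T b x)"
      by blast
    have "has_bochner_integral lebesgue (\<lambda>y. K x z * b y) (K x z * (LINT y|lebesgue. b y))"
      by (intro has_bochner_integral_mult_right has_bochner_integral_integrable b)
    from has_bochner_integral_diff[OF T this]
    have T': "has_bochner_integral lebesgue (\<lambda>y. K x y * b y - K x z * b y) (T b x)"
      using mean by simp
    let ?c = "\<omega> ((1/2) ^ k) / (2 ^ k * r) ^ CARD('n)"
    have "\<bar>T b x\<bar> = \<bar>LINT y|lebesgue. K x y * b y - K x z * b y\<bar>"
      using T' by (simp add: has_bochner_integral_integral_eq)
    also have "\<dots> \<le> norm_L1 (\<lambda>y. K x y * b y - K x z * b y)"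
      by (rule integral_abs_bound)
    also have "\<dots> \<le> (LINT y|lebesgue. ?c * \<bar>b y\<bar>)"
    proof (rule integral_mono)
      show "integrable lebesgue (\<lambda>y. \<bar>K x y * b y - K x z * b y\<bar>)"
        using T' by (simp add: has_bochner_integral_iff)
      show "integrable lebesgue (\<lambda>y. ?c * \<bar>b y\<bar>)"
        using b by simp
      fix y
      show "\<bar>K x y * b y - K x z * b y\<bar> \<le> ?c * \<bar>b y\<bar>"
      proof (cases "b y = 0")
        case False
        have "\<bar>K x z - K x y\<bar> \<le> ?c"
          by (rule K_smooth_annulus(2)[OF supp[OF False] r k lo])
        then have "\<bar>K x y - K x z\<bar> * \<bar>b y\<bar> \<le> ?c * \<bar>b y\<bar>"
          by (intro mult_right_mono) auto
        then show ?thesis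
          by (simp add: abs_mult left_diff_distrib[symmetric])
      qed simp
    qed
    also have "\<dots> = ?c * norm_L1 b"
      by simp
    finally show "ennreal \<bar>T b x\<bar> \<le> ennreal ?c * ennreal (norm_L1 b)"
      using r by (subst ennreal_mult[symmetric]) (auto intro!: ennreal_leI divide_nonneg_nonneg \<omega>_nonneg)
  qed
qed (use r in \<open>auto intro: \<omega>_summable \<omega>_nonneg\<close>)

text \<open>
  The function splits as \<open>h = g + b + e\<close> over the stopping cubes: \<open>g\<close> is bounded, \<open>b\<close> is a
  finite sum of atoms, and \<open>e\<close> is the part of \<open>h\<close> on the remaining stopping cubes.  Keeping only
  finitely many atoms avoids having to exchange \<open>T\<close> with an infinite sum; the price is \<open>e\<close>, whose
  \<open>L\<^sup>2\<close> norm is arbitrarily small.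
\<close>

lemma T_weak_type_explicit:
  fixes W :: real
  assumes W: "W = unit_ball_vol (real CARD('n)) * (2 * real CARD('n)) ^ CARD('n) + 9 * B\<^sup>2 * 2 ^ CARD('n)
      + 6 * 2 ^ CARD('n) * unit_ball_vol (real CARD('n)) * D"
    and h: "integrable lebesgue h" "square_integrable h" and \<alpha>: "0 < \<alpha>"
  shows "emeasure lebesgue {x. \<alpha> < \<bar>T h x\<bar>} \<le> ennreal (W * norm_L1 h / \<alpha>)"
proof -
  let ?N = "CARD('n)" and ?v = "unit_ball_vol (real CARD('n))"
  define I where "I A = (LINT y|lebesgue. indicator A y * \<bar>h y\<bar>)" for A
  define J where "J = norm_L1 h"
  have [measurable]: "h \<in> borel_measurable lebesgue"
    using h by auto
  have J: "0 \<le> J" "(\<integral>\<^sup>+x. ennreal \<bar>h x\<bar> \<partial>lebesgue) = ennreal J"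
    using h by (auto simp: J_def nn_integral_real)
  have I: "(\<integral>\<^sup>+y\<in>A. ennreal \<bar>h y\<bar> \<partial>lebesgue) = ennreal (I A)" "0 \<le> I A" if "A \<in> sets lebesgue" for A
    using nn_set_integral_real[OF h(1) that] by (auto simp: I_def intro!: integral_nonneg_AE)
  have intI: "integrable lebesgue (\<lambda>y. indicator A y * \<bar>h y\<bar>)" if "A \<in> sets lebesgue" for A
    using h that by (intro integrable_mult_ind) auto
  obtain P where P: "disjoint_family_on dcube P"
    "\<And>c. c \<in> P \<Longrightarrow> ennreal \<alpha> * emeasure lebesgue (dcube c) < (\<integral>\<^sup>+x\<in>dcube c. ennreal \<bar>h x\<bar> \<partial>lebesgue)"
    "\<And>c. c \<in> P \<Longrightarrow> (\<integral>\<^sup>+x\<in>dcube c. ennreal \<bar>h x\<bar> \<partial>lebesgue) \<le> ennreal (2 ^ ?N * \<alpha>) * emeasure lebesgue (dcube c)"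
    "AE x in lebesgue. x \<notin> (\<Union>c\<in>P. dcube c) \<longrightarrow> ennreal \<bar>h x\<bar> \<le> ennreal \<alpha>"
    using calderon_zygmund_cubes[of "\<lambda>x. ennreal \<bar>h x\<bar>" \<alpha>] J \<alpha> by auto
  have up: "I (dcube c) \<le> 2 ^ ?N * \<alpha> * side c ^ ?N" if "c \<in> P" for c
    using P(3)[OF that] \<alpha> I[of "dcube c"]
    by (subst (asm) emeasure_dcube, subst (asm) ennreal_mult[symmetric])
      (auto simp: less_imp_le)
  define \<Omega> where "\<Omega> = (\<Union>c\<in>P. dcube c)"
  have [measurable]: "\<Omega> \<in> sets lebesgue"
    by (simp add: \<Omega>_def)
  have [simp]: "- \<Omega> \<in> sets lebesgue"
    using sets.compl_sets[of \<Omega> lebesgue] by (simp add: Compl_eq_Diff_UNIV)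
  have \<Omega>: "ennreal \<alpha> * emeasure lebesgue \<Omega> \<le> ennreal J"
  proof -
    have "emeasure (density lebesgue (\<lambda>_. ennreal \<alpha>)) \<Omega> \<le> emeasure (density lebesgue (\<lambda>x. ennreal \<bar>h x\<bar>)) \<Omega>"
      unfolding \<Omega>_def using P(2)
      by (intro emeasure_dyadic_union_mono[OF P(1)])
        (auto simp: emeasure_density_const_mult emeasure_density less_imp_le)
    also have "\<dots> = (\<integral>\<^sup>+x\<in>\<Omega>. ennreal \<bar>h x\<bar> \<partial>lebesgue)"
      by (simp add: emeasure_density)
    also have "\<dots> \<le> (\<integral>\<^sup>+x. ennreal \<bar>h x\<bar> \<partial>lebesgue)"
      by (intro nn_integral_mono) (auto split: split_indicator)
    finally show ?thesis
      using J by (simp add: emeasure_density_const_mult)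
  qed
  define z :: "'n dyadic \<Rightarrow> real^'n" where "z c = corner c" for c
  define r :: "'n dyadic \<Rightarrow> real" where "r c = real ?N * side c" for c
  have r: "0 < r c" "norm (z c - y) \<le> r c" if "y \<in> dcube c" for c y
    using dist_le_in_dcube[OF corner_mem_dcube that] by (auto simp: z_def r_def)
  have [simp]: "side c \<noteq> 0" for c :: "'n dyadic"
    using side_pos[of c] by linarith
  have rpos: "0 < r c" for c
    by (simp add: r_def)
  \<comment> \<open>outside \<open>\<Omega>'\<close> every atom is seen from twice the radius of its support\<close>
  define \<Omega>' where "\<Omega>' = (\<Union>c\<in>P. ball (z c) (2 * r c))"
  have [measurable]: "\<Omega>' \<in> sets lebesgue"
  proof -
    have "open \<Omega>'" unfolding \<Omega>'_def by auto
    then show ?thesis by auto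
  qed
  have \<Omega>': "emeasure lebesgue \<Omega>' \<le> ennreal (?v * (2 * real ?N) ^ ?N * J / \<alpha>)"
  proof -
    let ?q = "?v * (2 * real ?N) ^ ?N"
    have "emeasure lebesgue \<Omega>' \<le> (\<integral>\<^sup>+c. emeasure lebesgue (ball (z c) (2 * r c)) \<partial>count_space P)"
      unfolding \<Omega>'_def by (intro emeasure_UN_countable_le) auto
    also have "\<dots> = (\<integral>\<^sup>+c. ennreal ?q * emeasure lebesgue (dcube c) \<partial>count_space P)"
    proof (intro nn_integral_cong)
      fix c
      have "emeasure lebesgue (ball (z c) (2 * r c)) = ennreal (?v * (2 * r c) ^ ?N)"
        using rpos[of c] by (intro emeasure_ball_cart) simp
      also have "?v * (2 * r c) ^ ?N = ?q * side c ^ ?N"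
        by (simp add: r_def power_mult_distrib)
      also have "ennreal \<dots> = ennreal ?q * emeasure lebesgue (dcube c)"
        unfolding emeasure_dcube by (rule ennreal_mult) (simp_all add: less_imp_le)
      finally show "emeasure lebesgue (ball (z c) (2 * r c)) = ennreal ?q * emeasure lebesgue (dcube c)" .
    qed
    also have "\<dots> = ennreal ?q * (\<integral>\<^sup>+c. emeasure lebesgue (dcube c) \<partial>count_space P)"
      by (rule nn_integral_cmult) simp
    also have "\<dots> = ennreal ?q * emeasure lebesgue \<Omega>"
      unfolding \<Omega>_def using P(1) by (subst emeasure_UN_countable) auto
    also have "\<dots> \<le> ennreal ?q * ennreal (J / \<alpha>)"
      by (intro mult_left_mono emeasure_le_divide[OF \<Omega> \<alpha> J(1)]) simp
    also have "\<dots> = ennreal (?q * J / \<alpha>)"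
      using J \<alpha> by (simp flip: ennreal_mult)
    finally show ?thesis .
  qed
  define m where "m c = (LINT y|lebesgue. h y * indicator (dcube c) y) / side c ^ ?N" for c :: "'n dyadic"
  have mI: "\<bar>m c\<bar> * side c ^ ?N \<le> I (dcube c)" for c
  proof -
    have "\<bar>LINT y|lebesgue. h y * indicator (dcube c) y\<bar> \<le> norm_L1 (\<lambda>y. h y * indicator (dcube c) y)"
      by (rule integral_abs_bound)
    also have "\<dots> = I (dcube c)"
      unfolding I_def by (intro Bochner_Integration.integral_cong) (auto simp: abs_mult)
    finally show ?thesis
      by (simp add: m_def abs_divide less_imp_le)
  qed
  have m: "\<bar>m c\<bar> \<le> 2 ^ ?N * \<alpha>" if "c \<in> P" for c
  proof -
    have "\<bar>m c\<bar> * side c ^ ?N \<le> 2 ^ ?N * \<alpha> * side c ^ ?N"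
      using mI[of c] up[OF that] by linarith
    then show ?thesis
      by (rule mult_right_le_imp_le) simp
  qed
  define b where "b c y = (h y - m c) * indicator (dcube c) y" for c y
  have b_eq: "b c = (\<lambda>y. h y * indicator (dcube c) y - m c * indicator (dcube c) y)" for c
    by (auto simp: b_def left_diff_distrib)
  have ind: "integrable lebesgue (\<lambda>y. indicator (dcube c) y :: real)" for c :: "'n dyadic"
    by (intro integrable_real_indicator) (auto simp: emeasure_dcube)
  have b_int: "integrable lebesgue (b c)" for c
    unfolding b_eq using h ind by (intro Bochner_Integration.integrable_diff integrable_mult_ind integrable_mult_right) auto
  have b_sq: "square_integrable (b c)" for c
    unfolding b_eq using h
    by (intro square_integrable_diff square_integrable_bounded_mult square_integrable_mult square_integrable_indicator)
      (auto split: split_indicator)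
  have b_mean: "(LINT y|lebesgue. b c y) = 0" for c
  proof -
    have "(LINT y|lebesgue. b c y) = (LINT y|lebesgue. h y * indicator (dcube c) y) - (LINT y|lebesgue. m c * indicator (dcube c) y)"
      unfolding b_eq using h ind by (intro Bochner_Integration.integral_diff integrable_mult_ind integrable_mult_right) auto
    also have "(LINT y|lebesgue. m c * indicator (dcube c) y) = m c * side c ^ ?N"
      using measure_dcube[of c] by simp
    finally show ?thesis
      by (simp add: m_def)
  qed
  have b_norm: "norm_L1 (\<lambda>y. b c y) \<le> 2 * I (dcube c)" for c
  proof -
    have "norm_L1 (\<lambda>y. b c y) \<le> (LINT y|lebesgue. indicator (dcube c) y * \<bar>h y\<bar> + \<bar>m c\<bar> * indicator (dcube c) y)"
    proof (rule integral_mono)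
      show "integrable lebesgue (\<lambda>y. \<bar>b c y\<bar>)"
        by (rule integrable_abs[OF b_int])
      show "integrable lebesgue (\<lambda>y. indicator (dcube c) y * \<bar>h y\<bar> + \<bar>m c\<bar> * indicator (dcube c) y)"
        by (intro Bochner_Integration.integrable_add integrable_mult_right ind intI) simp
    qed (auto simp: b_def abs_mult split: split_indicator)
    also have "\<dots> = I (dcube c) + \<bar>m c\<bar> * side c ^ ?N"
      unfolding I_def using intI[of "dcube c"] ind measure_dcube[of c]
      by (subst Bochner_Integration.integral_add) auto
    finally show ?thesis
      using mI[of c] by linarith
  qed
  have main: "emeasure lebesgue {x. \<alpha> < \<bar>T h x\<bar>} \<le> ennreal (W * J / \<alpha>)
      + ennreal (B\<^sup>2 * (LINT x|lebesgue. (h x * indicator (\<Omega> - (\<Union>c\<in>Q. dcube c)) x)\<^sup>2) / (\<alpha> / 3)\<^sup>2)"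
    if Q: "finite Q" "Q \<subseteq> P" for Q
  proof -
    have disj: "disjoint_family_on dcube Q"
      using P(1) Q(2) by (rule disjoint_family_on_mono[rotated])
    define \<Omega>Q where "\<Omega>Q = (\<Union>c\<in>Q. dcube c)"
    have [measurable]: "\<Omega>Q \<in> sets lebesgue"
      by (simp add: \<Omega>Q_def)
    have sub: "\<Omega>Q \<subseteq> \<Omega>"
      using Q by (auto simp: \<Omega>Q_def \<Omega>_def)
    have indQ: "indicator \<Omega>Q x = (\<Sum>c\<in>Q. indicator (dcube c) x :: real)" for x
      unfolding \<Omega>Q_def using Q disj by (simp add: indicator_UN_disjoint)
    define g where "g x = h x * indicator (- \<Omega>) x + (\<Sum>c\<in>Q. m c * indicator (dcube c) x)" for x
    define e where "e x = h x * indicator (\<Omega> - \<Omega>Q) x" for x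
    define bQ where "bQ x = (\<Sum>c\<in>Q. b c x)" for x
    have ind_sum: "integrable lebesgue (\<lambda>x. \<Sum>c\<in>Q. a c * indicator (dcube c) x)" for a :: "'n dyadic \<Rightarrow> real"
      by (intro Bochner_Integration.integrable_sum integrable_mult_right ind)
    have g_int: "integrable lebesgue g"
      unfolding g_def by (intro Bochner_Integration.integrable_add ind_sum integrable_mult_ind h) simp
    \<comment> \<open>off the stopping cubes \<open>\<bar>h\<bar> \<le> \<alpha>\<close>, and on a stopping cube the average is at most \<open>2 ^ N * \<alpha>\<close>\<close>
    have g_bd: "AE x in lebesgue. \<bar>g x\<bar> \<le> 2 ^ ?N * \<alpha>"
      using P(4)
    proof (rule AE_mp, intro AE_I2 impI)
      fix x assume x: "x \<notin> (\<Union>c\<in>P. dcube c) \<longrightarrow> ennreal \<bar>h x\<bar> \<le> ennreal \<alpha>"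
      show "\<bar>g x\<bar> \<le> 2 ^ ?N * \<alpha>"
      proof (cases "x \<in> \<Omega>")
        case False
        then have "\<bar>h x\<bar> \<le> \<alpha>"
          using x \<alpha> by (simp add: \<Omega>_def)
        moreover have "\<alpha> \<le> 2 ^ ?N * \<alpha>"
          using \<alpha> one_le_power[of "2::real" ?N] by simp
        moreover have "(\<Sum>c\<in>Q. m c * indicator (dcube c) x) = 0"
        proof (intro sum.neutral ballI)
          fix c assume "c \<in> Q"
          then have "x \<notin> dcube c"
            using False sub by (auto simp: \<Omega>Q_def)
          then show "m c * indicator (dcube c) x = 0" by simp
        qed
        ultimately show ?thesis
          using False by (simp add: g_def)
      next
        case True
        then have gx: "g x = (\<Sum>c\<in>Q. m c * indicator (dcube c) x)"
          by (simp add: g_def)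
        show ?thesis
        proof (cases "x \<in> \<Omega>Q")
          case True
          then obtain c where c: "c \<in> Q" "x \<in> dcube c"
            by (auto simp: \<Omega>Q_def)
          have "(\<Sum>c'\<in>Q - {c}. m c' * indicator (dcube c') x) = 0"
          proof (intro sum.neutral ballI)
            fix c' assume "c' \<in> Q - {c}"
            then have "x \<notin> dcube c'"
              using c disj by (auto simp: disjoint_family_on_def)
            then show "m c' * indicator (dcube c') x = 0" by simp
          qed
          then have "g x = m c"
            unfolding gx sum.remove[OF Q(1) c(1)] using c(2) by simp
          then show ?thesis
            using m[of c] c Q by auto
        next
          case False
          then have "g x = 0"
            unfolding gx by (intro sum.neutral) (auto simp: \<Omega>Q_def)
          then show ?thesis
            using \<alpha> by simp
        qed
      qed
    qed
    note g_sq = square_integrable_of_bounded[OF g_int g_bd]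
    have IQ: "(\<Sum>c\<in>Q. I (dcube c)) = I \<Omega>Q"
    proof -
      have "I \<Omega>Q = (LINT y|lebesgue. (\<Sum>c\<in>Q. indicator (dcube c) y * \<bar>h y\<bar>))"
        unfolding I_def indQ by (simp add: sum_distrib_right)
      also have "\<dots> = (\<Sum>c\<in>Q. I (dcube c))"
        unfolding I_def using intI by (intro Bochner_Integration.integral_sum) auto
      finally show ?thesis ..
    qed
    have IJ: "I (- \<Omega>) + I \<Omega>Q \<le> J"
    proof -
      have "I (- \<Omega>) + I \<Omega>Q = (LINT y|lebesgue. indicator (- \<Omega>) y * \<bar>h y\<bar> + indicator \<Omega>Q y * \<bar>h y\<bar>)"
        unfolding I_def using intI[of "- \<Omega>"] intI[of \<Omega>Q] by (intro Bochner_Integration.integral_add[symmetric]) auto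
      also have "\<dots> \<le> J"
        unfolding J_def using h intI[of "- \<Omega>"] intI[of \<Omega>Q] sub
        by (intro integral_mono) (auto split: split_indicator)
      finally show ?thesis .
    qed
    have g_norm: "norm_L1 g \<le> J"
    proof -
      have "norm_L1 g \<le> (LINT x|lebesgue. indicator (- \<Omega>) x * \<bar>h x\<bar> + (\<Sum>c\<in>Q. \<bar>m c\<bar> * indicator (dcube c) x))"
      proof (rule integral_mono)
        show "integrable lebesgue (\<lambda>x. indicator (- \<Omega>) x * \<bar>h x\<bar> + (\<Sum>c\<in>Q. \<bar>m c\<bar> * indicator (dcube c) x))"
          by (intro Bochner_Integration.integrable_add ind_sum intI) simp
        fix x
        have "\<bar>\<Sum>c\<in>Q. m c * indicator (dcube c) x\<bar> \<le> (\<Sum>c\<in>Q. \<bar>m c\<bar> * indicator (dcube c) x)"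
          by (rule order_trans[OF sum_abs]) (simp add: abs_mult)
        then show "\<bar>g x\<bar> \<le> indicator (- \<Omega>) x * \<bar>h x\<bar> + (\<Sum>c\<in>Q. \<bar>m c\<bar> * indicator (dcube c) x)"
          unfolding g_def by (intro order_trans[OF abs_triangle_ineq] add_mono) (auto simp: abs_mult)
      qed (use g_int in simp)
      also have "\<dots> = I (- \<Omega>) + (\<Sum>c\<in>Q. \<bar>m c\<bar> * side c ^ ?N)"
        unfolding I_def using intI[of "- \<Omega>"] ind_sum[of "\<lambda>c. \<bar>m c\<bar>"] ind
        by (subst Bochner_Integration.integral_add)
          (auto simp: Bochner_Integration.integral_sum integrable_mult_right measure_dcube[simplified])
      also have "\<dots> \<le> I (- \<Omega>) + (\<Sum>c\<in>Q. I (dcube c))"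
        using mI by (intro add_mono sum_mono) auto
      finally show ?thesis
        using IQ IJ by simp
    qed
    have \<alpha>3: "0 < \<alpha> / 3"
      using \<alpha> by simp
    have g_weak: "emeasure lebesgue {x. \<alpha> / 3 < \<bar>T g x\<bar>} \<le> ennreal (9 * B\<^sup>2 * 2 ^ ?N * J / \<alpha>)"
    proof (rule order_trans[OF T_weak_L2[OF g_sq(1) \<alpha>3]], rule ennreal_leI)
      have "(LINT x|lebesgue. (g x)\<^sup>2) \<le> 2 ^ ?N * \<alpha> * J"
        using g_sq(2) g_norm \<alpha> by (meson order_trans mult_left_mono mult_nonneg_nonneg less_imp_le zero_le_power zero_le_numeral)
      then have "B\<^sup>2 * (LINT x|lebesgue. (g x)\<^sup>2) \<le> B\<^sup>2 * (2 ^ ?N * \<alpha> * J)"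
        by (intro mult_left_mono) auto
      then have "B\<^sup>2 * (LINT x|lebesgue. (g x)\<^sup>2) / (\<alpha> / 3)\<^sup>2 \<le> B\<^sup>2 * (2 ^ ?N * \<alpha> * J) / (\<alpha> / 3)\<^sup>2"
        by (intro divide_right_mono) auto
      also have "\<dots> = 9 * B\<^sup>2 * 2 ^ ?N * J / \<alpha>"
        using \<alpha> by (simp add: power2_eq_square field_simps)
      finally show "B\<^sup>2 * (LINT x|lebesgue. (g x)\<^sup>2) / (\<alpha> / 3)\<^sup>2 \<le> 9 * B\<^sup>2 * 2 ^ ?N * J / \<alpha>" .
    qed
    have e_sq: "square_integrable e"
      unfolding e_def using h by (intro square_integrable_bounded_mult) (auto split: split_indicator)
    have bQ_sq: "square_integrable bQ"
      unfolding bQ_def by (intro square_integrable_sum b_sq)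
    have [measurable]: "T (b c) \<in> borel_measurable lebesgue" for c
      by (rule T_measurable[OF b_sq])
    have [measurable]: "T bQ \<in> borel_measurable lebesgue" "T g \<in> borel_measurable lebesgue"
      "T e \<in> borel_measurable lebesgue" "T h \<in> borel_measurable lebesgue"
      using bQ_sq g_sq e_sq h by (auto intro: T_measurable)
    have b_weak: "emeasure lebesgue {x. \<alpha> / 3 < \<bar>T bQ x * indicator (- \<Omega>') x\<bar>} \<le> ennreal (6 * 2 ^ ?N * ?v * D * J / \<alpha>)"
    proof -
      have "(\<integral>\<^sup>+x. ennreal \<bar>T bQ x * indicator (- \<Omega>') x\<bar> \<partial>lebesgue)
          \<le> (\<integral>\<^sup>+x. (\<Sum>c\<in>Q. ennreal \<bar>T (b c) x\<bar> * indicator {x. 2 * r c \<le> norm (z c - x)} x) \<partial>lebesgue)"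
      proof (rule nn_integral_mono_AE, rule AE_mp[OF T_sum[OF Q(1), of b, OF b_sq]], intro AE_I2 impI)
        fix x assume x: "T (\<lambda>y. \<Sum>i\<in>Q. b i y) x = (\<Sum>i\<in>Q. T (b i) x)"
        show "ennreal \<bar>T bQ x * indicator (- \<Omega>') x\<bar>
            \<le> (\<Sum>c\<in>Q. ennreal \<bar>T (b c) x\<bar> * indicator {x. 2 * r c \<le> norm (z c - x)} x)"
        proof (cases "x \<in> \<Omega>'")
          case False
          then have out: "2 * r c \<le> norm (z c - x)" if "c \<in> Q" for c
            using that Q(2) by (force simp: \<Omega>'_def dist_norm)
          have "T bQ x = (\<Sum>i\<in>Q. T (b i) x)"
            using x by (simp add: bQ_def[abs_def])
          then have "\<bar>T bQ x\<bar> \<le> (\<Sum>i\<in>Q. \<bar>T (b i) x\<bar>)"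
            by simp
          then have "ennreal \<bar>T bQ x * indicator (- \<Omega>') x\<bar> \<le> ennreal (\<Sum>i\<in>Q. \<bar>T (b i) x\<bar>)"
            using False by (intro ennreal_leI) simp
          also have "\<dots> = (\<Sum>c\<in>Q. ennreal \<bar>T (b c) x\<bar> * indicator {x. 2 * r c \<le> norm (z c - x)} x)"
            using out by (simp flip: sum_ennreal)
          finally show ?thesis .
        qed simp
      qed
      also have "\<dots> = (\<Sum>c\<in>Q. \<integral>\<^sup>+x\<in>{x. 2 * r c \<le> norm (z c - x)}. ennreal \<bar>T (b c) x\<bar> \<partial>lebesgue)"
      proof (rule nn_integral_sum)
        fix c
        have "closed {x. 2 * r c \<le> norm (z c - x)}"
          by (intro closed_Collect_le continuous_intros)
        then have [measurable]: "{x. 2 * r c \<le> norm (z c - x)} \<in> sets lebesgue"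
          by auto
        show "(\<lambda>x. ennreal \<bar>T (b c) x\<bar> * indicator {x. 2 * r c \<le> norm (z c - x)} x) \<in> borel_measurable lebesgue"
          by measurable
      qed
      also have "\<dots> \<le> (\<Sum>c\<in>Q. ennreal (2 ^ ?N * (?v * (2 * I (dcube c))) * D))"
      proof (rule sum_mono)
        fix c
        have "(\<integral>\<^sup>+x\<in>{x. 2 * r c \<le> norm (z c - x)}. ennreal \<bar>T (b c) x\<bar> \<partial>lebesgue)
            \<le> ennreal (2 ^ ?N * (?v * norm_L1 (\<lambda>y. b c y)) * D)"
        proof (rule T_atom[OF b_sq b_int b_mean _ rpos])
          show "norm (z c - y) \<le> r c" if "b c y \<noteq> 0" for y
            using that by (intro r) (auto simp: b_def split: split_indicator_asm)
        qed
        also have "\<dots> \<le> ennreal (2 ^ ?N * (?v * (2 * I (dcube c))) * D)"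
          using b_norm D_nonneg by (intro ennreal_leI mult_right_mono mult_left_mono) auto
        finally show "(\<integral>\<^sup>+x\<in>{x. 2 * r c \<le> norm (z c - x)}. ennreal \<bar>T (b c) x\<bar> \<partial>lebesgue)
            \<le> ennreal (2 ^ ?N * (?v * (2 * I (dcube c))) * D)" .
      qed
      also have "\<dots> = ennreal (\<Sum>c\<in>Q. 2 ^ ?N * (?v * (2 * I (dcube c))) * D)"
        using I(2) D_nonneg by (intro sum_ennreal mult_nonneg_nonneg) auto
      also have "(\<Sum>c\<in>Q. 2 ^ ?N * (?v * (2 * I (dcube c))) * D) = 2 * 2 ^ ?N * ?v * D * I \<Omega>Q"
        unfolding IQ[symmetric] sum_distrib_left by (intro sum.cong) (simp_all add: mult_ac)
      also have "ennreal \<dots> \<le> ennreal (2 * 2 ^ ?N * ?v * D * J)"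
        using IJ I(2)[of "- \<Omega>"] D_nonneg by (intro ennreal_leI mult_left_mono) auto
      finally have "(\<integral>\<^sup>+x. ennreal \<bar>T bQ x * indicator (- \<Omega>') x\<bar> \<partial>lebesgue) \<le> ennreal (2 * 2 ^ ?N * ?v * D * J)" .
      then have "emeasure lebesgue {x. \<alpha> / 3 < \<bar>T bQ x * indicator (- \<Omega>') x\<bar>} \<le> ennreal (2 * 2 ^ ?N * ?v * D * J / (\<alpha> / 3))"
        using \<alpha>3 J D_nonneg by (intro markov_real) auto
      then show ?thesis
        by (simp add: mult_ac)
    qed
    have split: "h = (\<lambda>y. (g y + bQ y) + e y)"
    proof
      fix y
      have "bQ y = h y * indicator \<Omega>Q y - (\<Sum>c\<in>Q. m c * indicator (dcube c) y)"
        unfolding bQ_def b_eq indQ by (simp add: sum_subtractf sum_distrib_left)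
      then show "h y = (g y + bQ y) + e y"
        using sub by (auto simp: g_def e_def split: split_indicator)
    qed
    have T_split: "AE x in lebesgue. T h x = T g x + T bQ x + T e x"
      using T_add[OF square_integrable_add[OF g_sq(1) bQ_sq] e_sq] T_add[OF g_sq(1) bQ_sq]
      by (subst (asm) split[symmetric]) (auto elim!: AE_mp)
    have "emeasure lebesgue {x. \<alpha> < \<bar>T h x\<bar>} \<le> emeasure lebesgue
        ((\<Omega>' \<union> {x. \<alpha> / 3 < \<bar>T g x\<bar>}) \<union> {x. \<alpha> / 3 < \<bar>T bQ x * indicator (- \<Omega>') x\<bar>} \<union> {x. \<alpha> / 3 < \<bar>T e x\<bar>})"
    proof (rule emeasure_mono_AE)
      show "AE x in lebesgue. x \<in> {x. \<alpha> < \<bar>T h x\<bar>} \<longrightarrow> x \<in> (\<Omega>' \<union> {x. \<alpha> / 3 < \<bar>T g x\<bar>}) \<union> {x. \<alpha> / 3 < \<bar>T bQ x * indicator (- \<Omega>') x\<bar>} \<union> {x. \<alpha> / 3 < \<bar>T e x\<bar>}"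
        using T_split by (rule AE_mp) (auto intro!: AE_I2 split: split_indicator)
    qed measurable
    also have "\<dots> \<le> ((emeasure lebesgue \<Omega>' + emeasure lebesgue {x. \<alpha> / 3 < \<bar>T g x\<bar>})
        + emeasure lebesgue {x. \<alpha> / 3 < \<bar>T bQ x * indicator (- \<Omega>') x\<bar>}) + emeasure lebesgue {x. \<alpha> / 3 < \<bar>T e x\<bar>}"
      by (intro order_trans[OF emeasure_subadditive] add_mono order_refl) measurable
    also have "\<dots> \<le> ((ennreal (?v * (2 * real ?N) ^ ?N * J / \<alpha>) + ennreal (9 * B\<^sup>2 * 2 ^ ?N * J / \<alpha>))
        + ennreal (6 * 2 ^ ?N * ?v * D * J / \<alpha>)) + ennreal (B\<^sup>2 * (LINT x|lebesgue. (e x)\<^sup>2) / (\<alpha> / 3)\<^sup>2)"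
      by (intro add_mono \<Omega>' g_weak b_weak T_weak_L2 e_sq \<alpha>3)
    also have "(ennreal (?v * (2 * real ?N) ^ ?N * J / \<alpha>) + ennreal (9 * B\<^sup>2 * 2 ^ ?N * J / \<alpha>))
        + ennreal (6 * 2 ^ ?N * ?v * D * J / \<alpha>) = ennreal (W * J / \<alpha>)"
    proof -
      have "0 \<le> ?v * (2 * real ?N) ^ ?N * J / \<alpha>" "0 \<le> 9 * B\<^sup>2 * 2 ^ ?N * J / \<alpha>" "0 \<le> 6 * 2 ^ ?N * ?v * D * J / \<alpha>"
        using J \<alpha> D_nonneg by auto
      then show ?thesis
        by (simp add: W distrib_right add_divide_distrib flip: ennreal_plus)
    qed
    finally show ?thesis
      by (simp add: e_def \<Omega>Q_def)
  qed
  \<comment> \<open>exhausting the stopping cubes makes the contribution of \<open>e\<close> vanish\<close>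
  define Q where "Q n = {c \<in> P. to_nat c < n}" for n
  have finQ: "finite (Q n)" for n
    by (rule finite_subset[of _ "to_nat -` {..<n}"]) (auto simp: Q_def intro: finite_vimageI)
  have "(\<lambda>n. LINT x|lebesgue. (h x * indicator (\<Omega> - (\<Union>c\<in>Q n. dcube c)) x)\<^sup>2) \<longlonglongrightarrow> (LINT x|(lebesgue :: (real ^ 'n) measure). (0::real))"
  proof (rule integral_dominated_convergence)
    show "integrable lebesgue (\<lambda>x. (h x)\<^sup>2)"
      using h by (simp add: square_integrable_def)
    show "AE x in lebesgue. (\<lambda>n. (h x * indicator (\<Omega> - (\<Union>c\<in>Q n. dcube c)) x)\<^sup>2) \<longlonglongrightarrow> 0"
    proof (intro AE_I2)
      fix x
      have "\<forall>\<^sub>F n in sequentially. (h x * indicator (\<Omega> - (\<Union>c\<in>Q n. dcube c)) x)\<^sup>2 = 0"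
      proof (cases "x \<in> \<Omega>")
        case True
        then obtain c where c: "c \<in> P" "x \<in> dcube c"
          by (auto simp: \<Omega>_def)
        show ?thesis
          using eventually_gt_at_top[of "to_nat c"]
        proof eventually_elim
          case (elim n)
          then have "x \<notin> \<Omega> - (\<Union>c\<in>Q n. dcube c)"
            using c unfolding Q_def by blast
          then show ?case by simp
        qed
      qed simp
      then show "(\<lambda>n. (h x * indicator (\<Omega> - (\<Union>c\<in>Q n. dcube c)) x)\<^sup>2) \<longlonglongrightarrow> 0"
        by (rule tendsto_eventually)
    qed
    show "AE x in lebesgue. norm ((h x * indicator (\<Omega> - (\<Union>c\<in>Q n. dcube c)) x)\<^sup>2) \<le> (h x)\<^sup>2" for n
      by (auto split: split_indicator)
  qed measurable
  then have "(\<lambda>n. ennreal (W * J / \<alpha>)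
      + ennreal (B\<^sup>2 * (LINT x|lebesgue. (h x * indicator (\<Omega> - (\<Union>c\<in>Q n. dcube c)) x)\<^sup>2) / (\<alpha> / 3)\<^sup>2))
      \<longlonglongrightarrow> ennreal (W * J / \<alpha>) + ennreal (B\<^sup>2 * 0 / (\<alpha> / 3)\<^sup>2)"
    using \<alpha> by (intro tendsto_add tendsto_const tendsto_ennrealI tendsto_divide tendsto_mult) auto
  then have "emeasure lebesgue {x. \<alpha> < \<bar>T h x\<bar>} \<le> ennreal (W * J / \<alpha>) + ennreal (B\<^sup>2 * 0 / (\<alpha> / 3)\<^sup>2)"
    by (rule LIMSEQ_le_const) (intro exI allI impI main[OF finQ], auto simp: Q_def)
  then show ?thesis
    by (simp add: J_def)
qed

text \<open>
  From here on only the inequality matters, so its constant is named without its value.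
\<close>

definition W :: real where
  "W = (SOME W. 0 \<le> W \<and> (\<forall>h \<alpha>. integrable lebesgue h \<longrightarrow> square_integrable h \<longrightarrow> 0 < \<alpha> \<longrightarrow>
     emeasure lebesgue {x. \<alpha> < \<bar>T h x\<bar>} \<le> ennreal (W * norm_L1 h / \<alpha>)))"

lemma W_nonneg: "0 \<le> W"
  and T_weak_type: "integrable lebesgue h \<Longrightarrow> square_integrable h \<Longrightarrow> 0 < \<alpha> \<Longrightarrow>
     emeasure lebesgue {x. \<alpha> < \<bar>T h x\<bar>} \<le> ennreal (W * norm_L1 h / \<alpha>)"
proof -
  define W0 where "W0 = unit_ball_vol (real CARD('n)) * (2 * real CARD('n)) ^ CARD('n) + 9 * B\<^sup>2 * 2 ^ CARD('n)
      + 6 * 2 ^ CARD('n) * unit_ball_vol (real CARD('n)) * D"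
  have "0 \<le> W0"
    unfolding W0_def using D_nonneg by (intro add_nonneg_nonneg mult_nonneg_nonneg) auto
  then have "\<exists>W. 0 \<le> W \<and> (\<forall>h \<alpha>. integrable lebesgue h \<longrightarrow> square_integrable h \<longrightarrow> 0 < \<alpha> \<longrightarrow>
     emeasure lebesgue {x. \<alpha> < \<bar>T h x\<bar>} \<le> ennreal (W * norm_L1 h / \<alpha>))"
    using T_weak_type_explicit[OF W0_def] by blast
  from someI_ex[OF this, folded W_def]
  show "0 \<le> W" and "integrable lebesgue h \<Longrightarrow> square_integrable h \<Longrightarrow> 0 < \<alpha> \<Longrightarrow>
     emeasure lebesgue {x. \<alpha> < \<bar>T h x\<bar>} \<le> ennreal (W * norm_L1 h / \<alpha>)"
    by blast+
qed

end

section \<open>The extension to \<open>L\<^sup>1\<close>\<close>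

definition trunc :: "nat \<Rightarrow> ('a \<Rightarrow> real) \<Rightarrow> 'a \<Rightarrow> real" where
  "trunc n f x = (if \<bar>f x\<bar> \<le> real n then f x else 0)"

lemma trunc_measurable [measurable]:
  assumes [measurable]: "f \<in> borel_measurable M"
  shows "trunc n f \<in> borel_measurable M"
  unfolding trunc_def[abs_def] by measurable

lemma trunc_integrable:
  fixes f :: "real ^ 'n \<Rightarrow> real"
  assumes "integrable lebesgue f"
  shows "integrable lebesgue (trunc n f)" "square_integrable (trunc n f)"
proof -
  have [measurable]: "f \<in> borel_measurable lebesgue"
    using assms by auto
  show int: "integrable lebesgue (trunc n f)"
    by (rule Bochner_Integration.integrable_bound[OF assms]) (auto simp: trunc_def)
  show "square_integrable (trunc n f)"
    by (rule square_integrable_of_bounded[OF int, of "real n"]) (simp add: trunc_def)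
qed

lemma trunc_eventually_eq: "\<forall>\<^sub>F n in sequentially. trunc n f x = f x"
proof -
  obtain m :: nat where "\<bar>f x\<bar> \<le> real m"
    using real_arch_simple by blast
  then show ?thesis
    by (intro eventually_sequentiallyI[of m]) (auto simp: trunc_def)
qed

lemma trunc_tendsto_L1:
  fixes f :: "real ^ 'n \<Rightarrow> real"
  assumes "integrable lebesgue f"
  shows "(\<lambda>n. LINT x|lebesgue. \<bar>trunc n f x - f x\<bar>) \<longlonglongrightarrow> 0"
proof -
  have [measurable]: "f \<in> borel_measurable lebesgue"
    using assms by auto
  have "(\<lambda>n. LINT x|lebesgue. \<bar>trunc n f x - f x\<bar>) \<longlonglongrightarrow> (LINT x|(lebesgue :: (real ^ 'n) measure). (0::real))"
  proof (rule integral_dominated_convergence)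
    show "integrable lebesgue (\<lambda>x. \<bar>f x\<bar>)"
      using assms by simp
    show "AE x in lebesgue. (\<lambda>n. \<bar>trunc n f x - f x\<bar>) \<longlonglongrightarrow> 0"
      by (intro AE_I2 tendsto_eventually eventually_mono[OF trunc_eventually_eq]) simp
    show "AE x in lebesgue. norm \<bar>trunc n f x - f x\<bar> \<le> \<bar>f x\<bar>" for n
      by (simp add: trunc_def)
  qed measurable
  then show ?thesis by simp
qed

lemma fast_subsequence:
  fixes X e :: "nat \<Rightarrow> real"
  assumes X: "X \<longlonglongrightarrow> 0" and e: "\<And>n. 0 < e n"
  obtains r where "strict_mono r" "\<And>n. X (r n) \<le> e n"
proof -
  have "\<exists>N. \<forall>m\<ge>N. X m \<le> e n" for n
    using order_tendstoD(2)[OF X e[of n]] unfolding eventually_sequentially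
    by (blast intro: less_imp_le)
  then obtain N where N: "\<And>n m. m \<ge> N n \<Longrightarrow> X m \<le> e n"
    by metis
  define r where "r = rec_nat (N 0) (\<lambda>n k. Suc k + N (Suc n))"
  have "r n \<ge> N n" for n
    by (cases n) (auto simp: r_def)
  moreover have "strict_mono r"
    by (rule strict_monoI_Suc) (simp add: r_def)
  ultimately show ?thesis
    using that N by blast
qed

text \<open>The Borel--Cantelli lemma in the form used for rapidly converging sequences.\<close>

lemma AE_eventually_small:
  fixes v :: "nat \<Rightarrow> real ^ 'n \<Rightarrow> real"
  assumes [measurable]: "\<And>n. v n \<in> borel_measurable lebesgue"
    and fast: "\<And>n. emeasure lebesgue {x. (1/2) ^ n < \<bar>v n x\<bar>} \<le> ennreal (M * (1/2) ^ n)"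
  shows "AE x in lebesgue. \<forall>\<^sub>F n in sequentially. norm (v n x) \<le> (1/2) ^ n"
proof -
  let ?A = "\<lambda>n. {x. (1/2) ^ n < \<bar>v n x\<bar>}"
  have M: "measure lebesgue (?A n) \<le> \<bar>M\<bar> * (1/2) ^ n" for n
  proof -
    have "emeasure lebesgue (?A n) \<le> ennreal (\<bar>M\<bar> * (1/2) ^ n)"
      by (rule order_trans[OF fast]) (intro ennreal_leI mult_right_mono, auto)
    then show ?thesis
      unfolding measure_def by (intro enn2real_leI) auto
  qed
  have "AE x in lebesgue. eventually (\<lambda>n. x \<in> space lebesgue - ?A n) sequentially"
  proof (rule borel_cantelli_AE1)
    show "?A n \<in> sets lebesgue" for n
      by (intro superlevel_lebesgue) measurable
    show "emeasure lebesgue (?A n) < \<infinity>" for n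
      using fast[of n] by (auto simp: less_top[symmetric] top_unique)
    show "summable (\<lambda>n. measure lebesgue (?A n))"
      by (rule summable_comparison_test'[of "\<lambda>n. \<bar>M\<bar> * (1/2) ^ n" 0])
        (auto intro!: summable_mult M simp: M)
  qed
  then show ?thesis
  proof (rule AE_mp, intro AE_I2 impI)
    fix x assume "eventually (\<lambda>n. x \<in> space lebesgue - ?A n) sequentially"
    then show "\<forall>\<^sub>F n in sequentially. norm (v n x) \<le> (1/2) ^ n"
      by eventually_elim auto
  qed
qed

lemma AE_tendsto_of_fast:
  fixes u :: "nat \<Rightarrow> real ^ 'n \<Rightarrow> real" and g :: "real ^ 'n \<Rightarrow> real"
  assumes [measurable]: "\<And>n. u n \<in> borel_measurable lebesgue" "g \<in> borel_measurable lebesgue"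
    and fast: "\<And>n. emeasure lebesgue {x. (1/2) ^ n < \<bar>u n x - g x\<bar>} \<le> ennreal (M * (1/2) ^ n)"
  shows "AE x in lebesgue. (\<lambda>n. u n x) \<longlonglongrightarrow> g x"
proof -
  have "AE x in lebesgue. \<forall>\<^sub>F n in sequentially. norm (u n x - g x) \<le> (1/2) ^ n"
    by (rule AE_eventually_small[OF _ fast]) measurable
  then show ?thesis
  proof (rule AE_mp, intro AE_I2 impI)
    fix x assume ev: "\<forall>\<^sub>F n in sequentially. norm (u n x - g x) \<le> (1/2) ^ n"
    have "(\<lambda>n. (1/2) ^ n :: real) \<longlonglongrightarrow> 0"
      by (rule LIMSEQ_power_zero) simp
    then have "(\<lambda>n. u n x - g x) \<longlonglongrightarrow> 0"
      by (rule Lim_null_comparison[OF ev])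
    then show "(\<lambda>n. u n x) \<longlonglongrightarrow> g x"
      by (simp add: LIM_zero_iff)
  qed
qed

lemma fast_Cauchy_limit:
  fixes u :: "nat \<Rightarrow> real ^ 'n \<Rightarrow> real"
  assumes [measurable]: "\<And>n. u n \<in> borel_measurable lebesgue"
    and fast: "\<And>n. emeasure lebesgue {x. (1/2) ^ n < \<bar>u (Suc n) x - u n x\<bar>} \<le> ennreal (M * (1/2) ^ n)"
  obtains g where "g \<in> borel_measurable lebesgue" "AE x in lebesgue. (\<lambda>n. u n x) \<longlonglongrightarrow> g x"
proof
  show "(\<lambda>x. lim (\<lambda>n. u n x)) \<in> borel_measurable lebesgue"
    by measurable
  have "AE x in lebesgue. \<forall>\<^sub>F n in sequentially. norm (u (Suc n) x - u n x) \<le> (1/2) ^ n"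
    by (rule AE_eventually_small[OF _ fast]) measurable
  then show "AE x in lebesgue. (\<lambda>n. u n x) \<longlonglongrightarrow> lim (\<lambda>n. u n x)"
  proof (rule AE_mp, intro AE_I2 impI)
    fix x assume ev: "\<forall>\<^sub>F n in sequentially. norm (u (Suc n) x - u n x) \<le> (1/2) ^ n"
    let ?v = "\<lambda>n. u (Suc n) x - u n x"
    have "summable (\<lambda>n. (1/2) ^ n :: real)"
      by (simp add: summable_geometric)
    then have "summable ?v"
      by (rule summable_comparison_test_ev[OF ev])
    then have "(\<lambda>n. \<Sum>k<n. ?v k) \<longlonglongrightarrow> suminf ?v"
      by (rule summable_LIMSEQ)
    then have "(\<lambda>n. u n x - u 0 x) \<longlonglongrightarrow> suminf ?v"
      by (simp only: sum_lessThan_telescope[of "\<lambda>k. u k x"])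
    then have "(\<lambda>n. (u n x - u 0 x) + u 0 x) \<longlonglongrightarrow> suminf ?v + u 0 x"
      by (intro tendsto_add tendsto_const)
    then have "convergent (\<lambda>n. u n x)"
      by (auto simp: convergent_def)
    then show "(\<lambda>n. u n x) \<longlonglongrightarrow> lim (\<lambda>n. u n x)"
      by (simp add: convergent_LIMSEQ_iff)
  qed
qed

lemma emeasure_superlevel_triangle:
  fixes u v w :: "real ^ 'n \<Rightarrow> real"
  assumes [measurable]: "u \<in> borel_measurable lebesgue" "v \<in> borel_measurable lebesgue" "w \<in> borel_measurable lebesgue"
  shows "emeasure lebesgue {x. s + t < \<bar>u x - w x\<bar>}
    \<le> emeasure lebesgue {x. s < \<bar>u x - v x\<bar>} + emeasure lebesgue {x. t < \<bar>v x - w x\<bar>}"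
proof -
  have [measurable]: "{x. s < \<bar>u x - v x\<bar>} \<in> sets lebesgue" "{x. t < \<bar>v x - w x\<bar>} \<in> sets lebesgue"
    by (intro superlevel_lebesgue; measurable)+
  have "emeasure lebesgue {x. s + t < \<bar>u x - w x\<bar>} \<le> emeasure lebesgue ({x. s < \<bar>u x - v x\<bar>} \<union> {x. t < \<bar>v x - w x\<bar>})"
    by (intro emeasure_mono) auto
  also have "\<dots> \<le> emeasure lebesgue {x. s < \<bar>u x - v x\<bar>} + emeasure lebesgue {x. t < \<bar>v x - w x\<bar>}"
    by (intro emeasure_subadditive) auto
  finally show ?thesis .
qed

lemma integral_abs_triangle:
  fixes f g h :: "'a \<Rightarrow> real"
  assumes "integrable M f" "integrable M g" "integrable M h"
  shows "(LINT x|M. \<bar>f x - h x\<bar>) \<le> (LINT x|M. \<bar>f x - g x\<bar>) + (LINT x|M. \<bar>g x - h x\<bar>)"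
proof -
  have "(LINT x|M. \<bar>f x - h x\<bar>) \<le> (LINT x|M. \<bar>f x - g x\<bar> + \<bar>g x - h x\<bar>)"
    using assms by (intro integral_mono) auto
  also have "\<dots> = (LINT x|M. \<bar>f x - g x\<bar>) + (LINT x|M. \<bar>g x - h x\<bar>)"
    using assms by (intro Bochner_Integration.integral_add) auto
  finally show ?thesis .
qed

context calderon_zygmund
begin

lemma T_weak_diff:
  assumes "integrable lebesgue h" "square_integrable h" "integrable lebesgue k" "square_integrable k" "0 < \<alpha>"
  shows "emeasure lebesgue {x. \<alpha> < \<bar>T h x - T k x\<bar>} \<le> ennreal (W * norm_L1 (\<lambda>x. h x - k x) / \<alpha>)"
proof -
  have [measurable]: "T h \<in> borel_measurable lebesgue" "T k \<in> borel_measurable lebesgue"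
    "T (\<lambda>x. h x - k x) \<in> borel_measurable lebesgue"
    by (intro T_measurable square_integrable_diff assms)+
  have "emeasure lebesgue {x. \<alpha> < \<bar>T h x - T k x\<bar>} = emeasure lebesgue {x. \<alpha> < \<bar>T (\<lambda>x. h x - k x) x\<bar>}"
    by (intro emeasure_eq_AE superlevel_lebesgue, rule AE_mp[OF T_diff[OF assms(2,4)]]) auto
  also have "\<dots> \<le> ennreal (W * norm_L1 (\<lambda>x. h x - k x) / \<alpha>)"
    using assms by (intro T_weak_type square_integrable_diff) auto
  finally show ?thesis .
qed

abbreviation Te :: "(real ^ 'n \<Rightarrow> real) \<Rightarrow> real ^ 'n \<Rightarrow> real" where
  "Te \<equiv> extension_L1 T"

text \<open>
  The quantitative form of the extension property.  It contains the convergence in measure that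
  characterises the extension, its uniqueness, and (for \<open>h = 0\<close>) its weak type.
\<close>

lemma extension_candidate:
  assumes f: "integrable lebesgue f"
  obtains g where "g \<in> borel_measurable lebesgue"
    "\<And>h \<epsilon>. integrable lebesgue h \<Longrightarrow> square_integrable h \<Longrightarrow> 0 < \<epsilon> \<Longrightarrow>
      emeasure lebesgue {x. \<epsilon> < \<bar>T h x - g x\<bar>} \<le> ennreal (2 * W * norm_L1 (\<lambda>x. h x - f x) / \<epsilon>)"
proof -
  obtain r where r: "strict_mono r" "\<And>n. norm_L1 (\<lambda>x. trunc (r n) f x - f x) \<le> (1/4) ^ n"
    using fast_subsequence[OF trunc_tendsto_L1[OF f], of "\<lambda>n. (1/4) ^ n"] by auto
  define t where "t n = trunc (r n) f" for n
  have t: "integrable lebesgue (t n)" "square_integrable (t n)" for n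
    using trunc_integrable[OF f] by (auto simp: t_def)
  have tf: "norm_L1 (\<lambda>x. t n x - f x) \<le> (1/4) ^ n" for n
    using r(2) by (simp add: t_def)
  have tf0: "(\<lambda>n. LINT x|lebesgue. \<bar>t n x - f x\<bar>) \<longlonglongrightarrow> 0"
    using LIMSEQ_subseq_LIMSEQ[OF trunc_tendsto_L1[OF f] r(1)] by (simp add: t_def o_def)
  have [measurable]: "T (t n) \<in> borel_measurable lebesgue" for n
    by (rule T_measurable[OF t(2)])
  have "emeasure lebesgue {x. (1/2) ^ n < \<bar>T (t (Suc n)) x - T (t n) x\<bar>} \<le> ennreal (2 * W * (1/2) ^ n)" for n
  proof (rule order_trans[OF T_weak_diff[OF t t]], simp, rule ennreal_leI)
    have "norm_L1 (\<lambda>x. t (Suc n) x - t n x) \<le> norm_L1 (\<lambda>x. t (Suc n) x - f x) + norm_L1 (\<lambda>x. f x - t n x)"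
      by (intro integral_abs_triangle t f)
    also have "\<dots> \<le> (1/4) ^ Suc n + (1/4) ^ n"
      using tf[of n] tf[of "Suc n"] by (simp add: abs_minus_commute)
    also have "\<dots> \<le> 2 * (1/4) ^ n"
      by simp
    finally have "W * norm_L1 (\<lambda>x. t (Suc n) x - t n x) \<le> W * (2 * (1/4) ^ n)"
      by (rule mult_left_mono[OF _ W_nonneg])
    then have "W * norm_L1 (\<lambda>x. t (Suc n) x - t n x) / (1/2) ^ n \<le> W * (2 * (1/4) ^ n) / (1/2) ^ n"
      by (rule divide_right_mono) simp
    also have "\<dots> = 2 * W * ((1/4) ^ n / (1/2) ^ n)"
      by simp
    also have "(1/4) ^ n / (1/2) ^ n = (1/2 :: real) ^ n"
      by (simp add: power_divide[symmetric])
    finally show "W * norm_L1 (\<lambda>x. t (Suc n) x - t n x) / (1/2) ^ n \<le> 2 * W * (1/2) ^ n" .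
  qed
  then obtain g where [measurable]: "g \<in> borel_measurable lebesgue" and g: "AE x in lebesgue. (\<lambda>n. T (t n) x) \<longlonglongrightarrow> g x"
    using fast_Cauchy_limit[of "\<lambda>n. T (t n)" "2 * W"] by auto
  show ?thesis
  proof (rule that)
    show "g \<in> borel_measurable lebesgue" by measurable
    fix h :: "real ^ 'n \<Rightarrow> real" and \<epsilon> :: real
    assume h: "integrable lebesgue h" "square_integrable h" and \<epsilon>: "0 < \<epsilon>"
    have [measurable]: "T h \<in> borel_measurable lebesgue"
      by (rule T_measurable[OF h(2)])
    let ?A = "\<lambda>n. {x. \<epsilon> / 2 < \<bar>T h x - T (t n) x\<bar>}"
    have A [measurable]: "?A n \<in> sets lebesgue" for n
      by (intro superlevel_lebesgue) measurable
    have sets: "{x. \<epsilon> < \<bar>T h x - g x\<bar>} \<in> sets lebesgue"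
      by (intro superlevel_lebesgue) measurable
    \<comment> \<open>Fatou's lemma for the indicators of the superlevel sets\<close>
    have "emeasure lebesgue {x. \<epsilon> < \<bar>T h x - g x\<bar>} = (\<integral>\<^sup>+x. indicator {x. \<epsilon> < \<bar>T h x - g x\<bar>} x \<partial>lebesgue)"
      using sets by simp
    also have "\<dots> \<le> (\<integral>\<^sup>+x. liminf (\<lambda>n. indicator (?A n) x) \<partial>lebesgue)"
    proof (rule nn_integral_mono_AE, rule AE_mp[OF g], intro AE_I2 impI)
      fix x assume lim: "(\<lambda>n. T (t n) x) \<longlonglongrightarrow> g x"
      show "indicator {x. \<epsilon> < \<bar>T h x - g x\<bar>} x \<le> liminf (\<lambda>n. indicator (?A n) x :: ennreal)"
      proof (cases "\<epsilon> < \<bar>T h x - g x\<bar>")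
        case True
        have "(\<lambda>n. \<bar>T h x - T (t n) x\<bar>) \<longlonglongrightarrow> \<bar>T h x - g x\<bar>"
          by (intro tendsto_rabs tendsto_diff tendsto_const lim)
        then have "\<forall>\<^sub>F n in sequentially. \<epsilon> / 2 < \<bar>T h x - T (t n) x\<bar>"
          using True \<epsilon> by (intro order_tendstoD(1)) auto
        then have "\<forall>\<^sub>F n in sequentially. 1 \<le> (indicator (?A n) x :: ennreal)"
          by eventually_elim simp
        then have "1 \<le> liminf (\<lambda>n. indicator (?A n) x :: ennreal)"
          by (rule Liminf_bounded)
        then show ?thesis using True by simp
      qed simp
    qed
    also have "\<dots> \<le> liminf (\<lambda>n. \<integral>\<^sup>+x. indicator (?A n) x \<partial>lebesgue)"
      by (rule nn_integral_liminf) measurable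
    also have "\<dots> = liminf (\<lambda>n. emeasure lebesgue (?A n))"
      using A by simp
    also have "\<dots> \<le> liminf (\<lambda>n. ennreal (W * (norm_L1 (\<lambda>x. h x - f x) + norm_L1 (\<lambda>x. t n x - f x)) / (\<epsilon> / 2)))"
    proof (intro Liminf_mono always_eventually allI)
      fix n
      have "norm_L1 (\<lambda>x. h x - t n x) \<le> norm_L1 (\<lambda>x. h x - f x) + norm_L1 (\<lambda>x. f x - t n x)"
        by (intro integral_abs_triangle t f h)
      then have "W * norm_L1 (\<lambda>x. h x - t n x) / (\<epsilon> / 2)
          \<le> W * (norm_L1 (\<lambda>x. h x - f x) + norm_L1 (\<lambda>x. t n x - f x)) / (\<epsilon> / 2)"
        using \<epsilon> W_nonneg by (intro divide_right_mono mult_left_mono) (auto simp: abs_minus_commute)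
      moreover have "emeasure lebesgue (?A n) \<le> ennreal (W * norm_L1 (\<lambda>x. h x - t n x) / (\<epsilon> / 2))"
        using \<epsilon> by (intro T_weak_diff h t) simp
      ultimately show "emeasure lebesgue (?A n) \<le> ennreal (W * (norm_L1 (\<lambda>x. h x - f x) + norm_L1 (\<lambda>x. t n x - f x)) / (\<epsilon> / 2))"
        by (meson order_trans ennreal_leI)
    qed
    also have "\<dots> = ennreal (W * (norm_L1 (\<lambda>x. h x - f x) + 0) / (\<epsilon> / 2))"
      using \<epsilon> by (intro lim_imp_Liminf tendsto_ennrealI tendsto_divide tendsto_mult tendsto_add tendsto_const tf0) auto
    also have "W * (norm_L1 (\<lambda>x. h x - f x) + 0) / (\<epsilon> / 2) = 2 * W * norm_L1 (\<lambda>x. h x - f x) / \<epsilon>"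
      by simp
    finally show "emeasure lebesgue {x. \<epsilon> < \<bar>T h x - g x\<bar>} \<le> ennreal (2 * W * norm_L1 (\<lambda>x. h x - f x) / \<epsilon>)" .
  qed
qed

lemma Te_measurable: "integrable lebesgue f \<Longrightarrow> Te f \<in> borel_measurable lebesgue"
  and Te_converges: "integrable lebesgue f \<Longrightarrow> (\<And>n. integrable lebesgue (h n) \<and> square_integrable (h n)) \<Longrightarrow>
      (\<lambda>n. LINT x|lebesgue. \<bar>h n x - f x\<bar>) \<longlonglongrightarrow> 0 \<Longrightarrow> converges_in_measure (\<lambda>n. T (h n)) (Te f)"
proof -
  define R where "R f g \<longleftrightarrow> g \<in> borel_measurable lebesgue \<and>
     (\<forall>h. (\<forall>n. integrable lebesgue (h n) \<and> square_integrable (h n)) \<longrightarrow>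
          (\<lambda>n. LINT x|lebesgue. \<bar>h n x - f x\<bar>) \<longlonglongrightarrow> 0 \<longrightarrow>
          converges_in_measure (\<lambda>n. T (h n)) g)" for f g
  have "R f (Te f)" if f: "integrable lebesgue f" for f
  proof -
    obtain g where g: "g \<in> borel_measurable lebesgue"
      and est: "\<And>h \<epsilon>. integrable lebesgue h \<Longrightarrow> square_integrable h \<Longrightarrow> 0 < \<epsilon> \<Longrightarrow>
        emeasure lebesgue {x. \<epsilon> < \<bar>T h x - g x\<bar>} \<le> ennreal (2 * W * norm_L1 (\<lambda>x. h x - f x) / \<epsilon>)"
      using extension_candidate[OF f] by blast
    have "R f g"
      unfolding R_def converges_in_measure_def
    proof (intro conjI g allI impI)
      fix h :: "nat \<Rightarrow> real ^ 'n \<Rightarrow> real" and \<epsilon> :: real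
      assume h: "\<forall>n. integrable lebesgue (h n) \<and> square_integrable (h n)"
        and lim: "(\<lambda>n. LINT x|lebesgue. \<bar>h n x - f x\<bar>) \<longlonglongrightarrow> 0" and \<epsilon>: "0 < \<epsilon>"
      have "(\<lambda>n. ennreal (2 * W * norm_L1 (\<lambda>x. h n x - f x) / \<epsilon>)) \<longlonglongrightarrow> ennreal (2 * W * 0 / \<epsilon>)"
        using \<epsilon> by (intro tendsto_ennrealI tendsto_divide tendsto_mult tendsto_const lim) auto
      then have lim': "(\<lambda>n. ennreal (2 * W * norm_L1 (\<lambda>x. h n x - f x) / \<epsilon>)) \<longlonglongrightarrow> 0"
        by simp
      show "(\<lambda>n. emeasure lebesgue {x. \<bar>T (h n) x - g x\<bar> > \<epsilon>}) \<longlonglongrightarrow> 0"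
        by (rule tendsto_sandwich[OF _ _ tendsto_const lim']) (use est h \<epsilon> in auto)
    qed
    then have "R f (SOME g. R f g)"
      by (rule someI[of "R f"])
    then show ?thesis
      by (simp add: extension_L1_def R_def[abs_def])
  qed
  then show "integrable lebesgue f \<Longrightarrow> Te f \<in> borel_measurable lebesgue"
    and "integrable lebesgue f \<Longrightarrow> (\<And>n. integrable lebesgue (h n) \<and> square_integrable (h n)) \<Longrightarrow>
      (\<lambda>n. LINT x|lebesgue. \<bar>h n x - f x\<bar>) \<longlonglongrightarrow> 0 \<Longrightarrow> converges_in_measure (\<lambda>n. T (h n)) (Te f)"
    unfolding R_def by blast+
qed

lemma Te_estimate:
  assumes f: "integrable lebesgue f" and h: "integrable lebesgue h" "square_integrable h" and \<epsilon>: "0 < \<epsilon>"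
  shows "emeasure lebesgue {x. \<epsilon> < \<bar>T h x - Te f x\<bar>} \<le> ennreal (2 * W * norm_L1 (\<lambda>x. h x - f x) / \<epsilon>)"
proof -
  note tr = trunc_integrable[OF f]
  have [measurable]: "T h \<in> borel_measurable lebesgue" "T (trunc n f) \<in> borel_measurable lebesgue"
    "Te f \<in> borel_measurable lebesgue" for n
    by (intro T_measurable Te_measurable h tr f)+
  let ?I = "LINT x|lebesgue. \<bar>h x - f x\<bar>"
  have conv: "converges_in_measure (\<lambda>n. T (trunc n f)) (Te f)"
    by (intro Te_converges trunc_tendsto_L1 f conjI tr)
  let ?X = "\<lambda>n. ennreal (W * (?I + norm_L1 (\<lambda>x. trunc n f x - f x)) / (\<epsilon> / 2)) + emeasure lebesgue {x. \<epsilon> / 2 < \<bar>T (trunc n f) x - Te f x\<bar>}"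
  have "emeasure lebesgue {x. \<epsilon> < \<bar>T h x - Te f x\<bar>} \<le> ?X n" for n
  proof -
    have "emeasure lebesgue {x. \<epsilon> / 2 + \<epsilon> / 2 < \<bar>T h x - Te f x\<bar>}
        \<le> emeasure lebesgue {x. \<epsilon> / 2 < \<bar>T h x - T (trunc n f) x\<bar>} + emeasure lebesgue {x. \<epsilon> / 2 < \<bar>T (trunc n f) x - Te f x\<bar>}"
      by (rule emeasure_superlevel_triangle) measurable
    also have "emeasure lebesgue {x. \<epsilon> / 2 < \<bar>T h x - T (trunc n f) x\<bar>} \<le> ennreal (W * norm_L1 (\<lambda>x. h x - trunc n f x) / (\<epsilon> / 2))"
      using \<epsilon> by (intro T_weak_diff h tr) simp
    also have "\<dots> \<le> ennreal (W * (?I + norm_L1 (\<lambda>x. trunc n f x - f x)) / (\<epsilon> / 2))"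
      using \<epsilon> W_nonneg integral_abs_triangle[OF h(1) f tr(1)[of n]]
      by (intro ennreal_leI divide_right_mono mult_left_mono) (auto simp: abs_minus_commute)
    finally show ?thesis
      by (simp add: add_mono)
  qed
  moreover have "?X \<longlonglongrightarrow> ennreal (W * (?I + 0) / (\<epsilon> / 2)) + 0"
  proof (rule tendsto_add)
    show "(\<lambda>n. ennreal (W * (?I + norm_L1 (\<lambda>x. trunc n f x - f x)) / (\<epsilon> / 2))) \<longlonglongrightarrow> ennreal (W * (?I + 0) / (\<epsilon> / 2))"
      using \<epsilon> by (intro tendsto_add tendsto_ennrealI tendsto_divide tendsto_mult tendsto_const trunc_tendsto_L1 f) simp
    show "(\<lambda>n. emeasure lebesgue {x. \<epsilon> / 2 < \<bar>T (trunc n f) x - Te f x\<bar>}) \<longlonglongrightarrow> 0"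
      using conv \<epsilon> half_gt_zero[OF \<epsilon>] unfolding converges_in_measure_def by blast
  qed
  ultimately have "emeasure lebesgue {x. \<epsilon> < \<bar>T h x - Te f x\<bar>} \<le> ennreal (W * (?I + 0) / (\<epsilon> / 2)) + 0"
    by (intro LIMSEQ_le_const) auto
  then show ?thesis
    by (simp add: mult_ac)
qed

lemma Te_weak_type:
  assumes f: "integrable lebesgue f" and \<epsilon>: "0 < \<epsilon>"
  shows "emeasure lebesgue {x. \<epsilon> < \<bar>Te f x\<bar>} \<le> ennreal (2 * W * norm_L1 f / \<epsilon>)"
proof -
  have [measurable]: "Te f \<in> borel_measurable lebesgue" "T (\<lambda>_. 0) \<in> borel_measurable lebesgue"
    by (intro T_measurable Te_measurable square_integrable_zero f)+
  have "AE x in lebesgue. T (\<lambda>_. 0) x = 0"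
    using T_linear[OF square_integrable_zero square_integrable_zero, of 0 0] by simp
  then have "emeasure lebesgue {x. \<epsilon> < \<bar>Te f x\<bar>} = emeasure lebesgue {x. \<epsilon> < \<bar>T (\<lambda>_. 0) x - Te f x\<bar>}"
    by (intro emeasure_eq_AE superlevel_lebesgue) (auto elim!: AE_mp)
  also have "\<dots> \<le> ennreal (2 * W * norm_L1 (\<lambda>x. 0 - f x) / \<epsilon>)"
    by (intro Te_estimate f \<epsilon> square_integrable_zero) simp
  finally show ?thesis by simp
qed

lemma Te_AE_limit:
  assumes f: "integrable lebesgue f" and h: "\<And>n. integrable lebesgue (h n)" "\<And>n. square_integrable (h n)"
    and fast: "\<And>n. norm_L1 (\<lambda>x. h n x - f x) \<le> (1/4) ^ n"
  shows "AE x in lebesgue. (\<lambda>n. T (h n) x) \<longlonglongrightarrow> Te f x"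
proof (rule AE_tendsto_of_fast[where M = "2 * W"])
  show "T (h n) \<in> borel_measurable lebesgue" "Te f \<in> borel_measurable lebesgue" for n
    by (intro T_measurable Te_measurable h f)+
  show "emeasure lebesgue {x. (1/2) ^ n < \<bar>T (h n) x - Te f x\<bar>} \<le> ennreal (2 * W * (1/2) ^ n)" for n
  proof (rule order_trans[OF Te_estimate[OF f h]], simp, rule ennreal_leI)
    have "2 * W * norm_L1 (\<lambda>x. h n x - f x) / (1/2) ^ n \<le> 2 * W * (1/4) ^ n / (1/2) ^ n"
      using fast[of n] W_nonneg by (intro divide_right_mono mult_left_mono) auto
    also have "\<dots> = 2 * W * ((1/4) ^ n / (1/2) ^ n)"
      by simp
    also have "(1/4) ^ n / (1/2) ^ n = (1/2 :: real) ^ n"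
      by (simp add: power_divide[symmetric])
    finally show "2 * W * norm_L1 (\<lambda>x. h n x - f x) / (1/2) ^ n \<le> 2 * W * (1/2) ^ n" .
  qed
qed

text \<open>
  One sequence of truncation levels serves both functions, so that all three limits hold along it
  almost everywhere.
\<close>

lemma Te_linear:
  assumes f: "integrable lebesgue f" and g: "integrable lebesgue g"
  shows "AE x in lebesgue. Te (\<lambda>y. a * f y + b * g y) x = a * Te f x + b * Te g x"
proof -
  let ?X = "\<lambda>n. (1 + \<bar>a\<bar> + \<bar>b\<bar>) * (norm_L1 (\<lambda>x. trunc n f x - f x) + norm_L1 (\<lambda>x. trunc n g x - g x))"
  have "?X \<longlonglongrightarrow> (1 + \<bar>a\<bar> + \<bar>b\<bar>) * (0 + 0)"
    by (intro tendsto_intros trunc_tendsto_L1 f g)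
  then obtain r where "\<And>n. ?X (r n) \<le> (1/4) ^ n"
    using fast_subsequence[of ?X "\<lambda>n. (1/4) ^ n"] by auto
  then obtain p q where "\<And>n. p n = trunc (r n) f" "\<And>n. q n = trunc (r n) g"
    and bd: "\<And>n. (1 + \<bar>a\<bar> + \<bar>b\<bar>) * (norm_L1 (\<lambda>x. p n x - f x) + norm_L1 (\<lambda>x. q n x - g x)) \<le> (1/4) ^ n"
    by auto
  then have p: "integrable lebesgue (p n)" "square_integrable (p n)"
    and q: "integrable lebesgue (q n)" "square_integrable (q n)" for n
    using trunc_integrable[OF f] trunc_integrable[OF g] by auto
  let ?P = "\<lambda>n. LINT x|lebesgue. \<bar>p n x - f x\<bar>" and ?Q = "\<lambda>n. LINT x|lebesgue. \<bar>q n x - g x\<bar>"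
  have nn: "0 \<le> ?P n" "0 \<le> ?Q n" for n by auto
  have nn': "0 \<le> \<bar>a\<bar> * ?P n" "0 \<le> \<bar>b\<bar> * ?P n" "0 \<le> \<bar>a\<bar> * ?Q n" "0 \<le> \<bar>b\<bar> * ?Q n" for n
    by auto
  have "?P n \<le> (1/4) ^ n" "?Q n \<le> (1/4) ^ n" and ab: "\<bar>a\<bar> * ?P n + \<bar>b\<bar> * ?Q n \<le> (1/4) ^ n" for n
    using bd[of n] nn[of n] nn'[of n] unfolding distrib_left distrib_right mult_1 by linarith+
  then have limf: "AE x in lebesgue. (\<lambda>n. T (p n) x) \<longlonglongrightarrow> Te f x"
    and limg: "AE x in lebesgue. (\<lambda>n. T (q n) x) \<longlonglongrightarrow> Te g x"
    using p q f g by (auto intro!: Te_AE_limit)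
  have sq: "square_integrable (\<lambda>y. a * p n y + b * q n y)" for n
    by (intro square_integrable_add square_integrable_mult p q)
  have lim: "AE x in lebesgue. (\<lambda>n. T (\<lambda>y. a * p n y + b * q n y) x) \<longlonglongrightarrow> Te (\<lambda>y. a * f y + b * g y) x"
  proof (rule Te_AE_limit)
    fix n
    have "norm_L1 (\<lambda>x. a * p n x + b * q n x - (a * f x + b * g x))
        \<le> (LINT x|lebesgue. \<bar>a\<bar> * \<bar>p n x - f x\<bar> + \<bar>b\<bar> * \<bar>q n x - g x\<bar>)"
    proof (rule integral_mono)
      fix x
      have "a * p n x + b * q n x - (a * f x + b * g x) = a * (p n x - f x) + b * (q n x - g x)"
        by (simp add: algebra_simps)
      then show "\<bar>a * p n x + b * q n x - (a * f x + b * g x)\<bar> \<le> \<bar>a\<bar> * \<bar>p n x - f x\<bar> + \<bar>b\<bar> * \<bar>q n x - g x\<bar>"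
        using abs_triangle_ineq[of "a * (p n x - f x)" "b * (q n x - g x)"] by (simp add: abs_mult)
    qed (use p q f g in auto)
    also have "\<dots> = \<bar>a\<bar> * ?P n + \<bar>b\<bar> * ?Q n"
      using p q f g by (subst Bochner_Integration.integral_add) auto
    finally show "norm_L1 (\<lambda>x. a * p n x + b * q n x - (a * f x + b * g x)) \<le> (1/4) ^ n"
      using ab[of n] by linarith
  qed (use p q f g sq in auto)
  have "AE x in lebesgue. \<forall>n. T (\<lambda>y. a * p n y + b * q n y) x = a * T (p n) x + b * T (q n) x"
    unfolding AE_all_countable using T_linear p q by blast
  then show ?thesis
    using lim limf limg
  proof eventually_elim
    case (elim x)
    have "(\<lambda>n. a * T (p n) x + b * T (q n) x) \<longlonglongrightarrow> a * Te f x + b * Te g x"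
      by (intro tendsto_intros elim)
    moreover have "(\<lambda>n. a * T (p n) x + b * T (q n) x) \<longlonglongrightarrow> Te (\<lambda>y. a * f y + b * g y) x"
      using elim by simp
    ultimately show ?case
      by (rule LIMSEQ_unique[symmetric])
  qed
qed

lemma Te_cong:
  assumes "integrable lebesgue f" "integrable lebesgue g" "AE x in lebesgue. f x = g x"
  shows "AE x in lebesgue. Te f x = Te g x"
proof -
  obtain r where r: "\<And>n. norm_L1 (\<lambda>x. trunc (r n) f x - f x) \<le> (1/4) ^ n"
    using fast_subsequence[OF trunc_tendsto_L1[OF assms(1)], of "\<lambda>n. (1/4) ^ n"] by auto
  have "norm_L1 (\<lambda>x. trunc (r n) f x - g x) = norm_L1 (\<lambda>x. trunc (r n) f x - f x)" for n
    using assms trunc_integrable[OF assms(1)]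
    by (intro integral_cong_AE) (auto elim!: AE_mp)
  then have "AE x in lebesgue. (\<lambda>n. T (trunc (r n) f) x) \<longlonglongrightarrow> Te g x"
    using r assms trunc_integrable[OF assms(1)] by (intro Te_AE_limit) auto
  moreover have "AE x in lebesgue. (\<lambda>n. T (trunc (r n) f) x) \<longlonglongrightarrow> Te f x"
    using r assms trunc_integrable[OF assms(1)] by (intro Te_AE_limit) auto
  ultimately show ?thesis
    by eventually_elim (rule LIMSEQ_unique)
qed

lemma K_far:
  assumes "x \<in> dcube c" "y \<notin> tripled c"
  shows "\<bar>K x y\<bar> \<le> \<kappa> / side c ^ CARD('n)"
proof -
  have d: "side c \<le> norm (x - y)"
    by (rule dist_ge_outside_tripled[OF assms])
  then have pos: "0 < norm (x - y)"
    using side_pos[of c] by linarith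
  then have "\<bar>K x y\<bar> \<le> \<kappa> / norm (x - y) ^ CARD('n)"
    by (intro K_size) auto
  also have "\<dots> \<le> \<kappa> / side c ^ CARD('n)"
    using \<kappa>_nonneg pos d by (intro divide_left_mono power_mono mult_pos_pos zero_less_power) (auto simp: less_imp_le)
  finally show ?thesis .
qed

text \<open>
  Measurability of \<open>\<lambda>y. K x y * g y\<close> comes from the truncations of \<open>g\<close>, for which it is part of
  the kernel representation; the limit is justified by the size of the kernel off the triple.
\<close>

lemma Te_kernel:
  assumes g: "integrable lebesgue g" and zero: "\<And>y. y \<in> tripled c \<Longrightarrow> g y = 0"
  shows "AE x in lebesgue. x \<in> dcube c \<longrightarrow> has_bochner_integral lebesgue (\<lambda>y. K x y * g y) (Te g x)"
proof -
  obtain r where r: "strict_mono r" "\<And>n. norm_L1 (\<lambda>x. trunc (r n) g x - g x) \<le> (1/4) ^ n"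
    using fast_subsequence[OF trunc_tendsto_L1[OF g], of "\<lambda>n. (1/4) ^ n"] by auto
  let ?h = "\<lambda>n. trunc (r n) g"
  note tr = trunc_integrable[OF g]
  have lim: "AE x in lebesgue. (\<lambda>n. T (?h n) x) \<longlonglongrightarrow> Te g x"
    using r tr g by (intro Te_AE_limit) auto
  have "AE x in lebesgue. \<forall>n. x \<notin> ess_support (?h n) \<longrightarrow>
      has_bochner_integral lebesgue (\<lambda>y. K x y * ?h n y) (T (?h n) x)"
    unfolding AE_all_countable using T_kernel tr by blast
  then show ?thesis
    using lim
  proof eventually_elim
    case (elim x)
    show ?case
    proof
      assume x: "x \<in> dcube c"
      have "x \<notin> ess_support (?h n)" for n
      proof (rule not_in_ess_supportI)
        show "open (interior (tripled c))" "x \<in> interior (tripled c)"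
          using x dcube_subset_interior_tripled[of c] by auto
        show "?h n y = 0" if "y \<in> interior (tripled c)" for y
          using that interior_subset zero[of y] by (auto simp: trunc_def)
      qed
      then have rep: "has_bochner_integral lebesgue (\<lambda>y. K x y * ?h n y) (T (?h n) x)" for n
        using elim by blast
      have ptw: "(\<lambda>n. K x y * ?h n y) \<longlonglongrightarrow> K x y * g y" for y
      proof (intro tendsto_mult tendsto_const tendsto_eventually)
        show "\<forall>\<^sub>F n in sequentially. ?h n y = g y"
          using filterlim_subseq[OF r(1)] trunc_eventually_eq[of g y] by (auto simp: filterlim_iff)
      qed
      have meas: "(\<lambda>y. K x y * ?h n y) \<in> borel_measurable lebesgue" for n
        using rep[of n] by (auto simp: has_bochner_integral_iff)
      have meas': "(\<lambda>y. K x y * g y) \<in> borel_measurable lebesgue"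
        using meas ptw by (rule borel_measurable_LIMSEQ_metric)
      have dom: "integrable lebesgue (\<lambda>y. \<kappa> / side c ^ CARD('n) * \<bar>g y\<bar>)"
        using g by simp
      have bound: "AE y in lebesgue. norm (K x y * ?h n y) \<le> \<kappa> / side c ^ CARD('n) * \<bar>g y\<bar>" for n
      proof (rule AE_I2)
        fix y
        show "norm (K x y * ?h n y) \<le> \<kappa> / side c ^ CARD('n) * \<bar>g y\<bar>"
        proof (cases "g y = 0")
          case False
          then have "y \<notin> tripled c"
            using zero by blast
          then have "\<bar>K x y\<bar> \<le> \<kappa> / side c ^ CARD('n)"
            by (rule K_far[OF x])
          then have "\<bar>K x y\<bar> * \<bar>?h n y\<bar> \<le> \<kappa> / side c ^ CARD('n) * \<bar>g y\<bar>"
            using \<kappa>_nonneg by (intro mult_mono) (auto simp: trunc_def less_imp_le)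
          then show ?thesis
            by (simp add: abs_mult)
        qed (simp add: trunc_def)
      qed
      have "(\<lambda>n. LINT y|lebesgue. K x y * ?h n y) \<longlonglongrightarrow> (LINT y|lebesgue. K x y * g y)"
        by (rule integral_dominated_convergence[OF meas' meas dom AE_I2[OF ptw] bound])
      then have "(\<lambda>n. T (?h n) x) \<longlonglongrightarrow> (LINT y|lebesgue. K x y * g y)"
        by (simp add: has_bochner_integral_integral_eq[OF rep])
      then have "(LINT y|lebesgue. K x y * g y) = Te g x"
        using elim LIMSEQ_unique by blast
      moreover have "integrable lebesgue (\<lambda>y. K x y * g y)"
        by (rule integrable_dominated_convergence[OF meas' meas dom AE_I2[OF ptw] bound])
      ultimately show "has_bochner_integral lebesgue (\<lambda>y. K x y * g y) (Te g x)"
        by (simp add: has_bochner_integral_iff)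
    qed
  qed
qed

end

section \<open>Control of the far part on a cube\<close>

context calderon_zygmund
begin

lemma averages_bound:
  fixes y :: "real ^ 'n"
  assumes y: "y \<notin> large_averages A F" and A: "0 < A" and R: "0 < R"
  shows "(\<integral>\<^sup>+z\<in>ball y R. F z \<partial>lebesgue) \<le> ennreal (A * unit_ball_vol (real CARD('n)) * R ^ CARD('n))"
proof -
  have "y \<in> ball y R"
    using R by simp
  then have "\<not> ennreal A * emeasure lebesgue (ball y R) < (\<integral>\<^sup>+z\<in>ball y R. F z \<partial>lebesgue)"
    using y R unfolding large_averages_def by blast
  then have "(\<integral>\<^sup>+z\<in>ball y R. F z \<partial>lebesgue) \<le> ennreal A * emeasure lebesgue (ball y R)"
    by (simp only: not_less)
  also have "\<dots> = ennreal (A * unit_ball_vol (real CARD('n)) * R ^ CARD('n))"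
    using A R by (subst emeasure_ball_cart) (auto simp: mult.assoc simp flip: ennreal_mult)
  finally show ?thesis .
qed

text \<open>
  Within distance \<open>2 * r\<close> of \<open>x\<close>, where \<open>r\<close> bounds the diameter of the cube, the size of the kernel
  suffices, and beyond it the smoothness, summed over annuli.
\<close>

lemma kernel_increment_bound:
  fixes g :: "real ^ 'n \<Rightarrow> real"
  assumes g: "integrable lebesgue g" and zero: "\<And>y. y \<in> tripled c \<Longrightarrow> g y = 0"
    and \<xi>: "\<xi> \<in> dcube c" and x: "x \<in> dcube c" and A: "0 < A"
    and avg: "x \<notin> large_averages A (\<lambda>y. ennreal \<bar>g y\<bar>)"
    and meas: "(\<lambda>y. (K x y - K \<xi> y) * g y) \<in> borel_measurable lebesgue"
  shows "(\<integral>\<^sup>+y. ennreal \<bar>(K x y - K \<xi> y) * g y\<bar> \<partial>lebesgue)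
    \<le> ennreal ((2 * \<kappa> * unit_ball_vol (real CARD('n)) * (2 * real CARD('n)) ^ CARD('n)
        + 2 ^ CARD('n) * unit_ball_vol (real CARD('n)) * D) * A)"
proof -
  let ?N = "CARD('n)" and ?v = "unit_ball_vol (real CARD('n))"
  let ?F = "\<lambda>y. ennreal \<bar>(K x y - K \<xi> y) * g y\<bar>"
  have [measurable]: "g \<in> borel_measurable lebesgue"
    using g by auto
  have F: "?F \<in> borel_measurable lebesgue"
    using meas by measurable
  define r where "r = real ?N * side c"
  have r: "0 < r"
    by (simp add: r_def)
  have near_r: "norm (x - \<xi>) \<le> r"
    unfolding r_def by (rule dist_le_in_dcube[OF x \<xi>])
  let ?S = "{y. 2 * r \<le> norm (x - y)}"
  have S: "?S \<in> sets lebesgue"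
  proof -
    have "closed ?S"
      by (intro closed_Collect_le continuous_intros)
    then show ?thesis by auto
  qed
  have growth: "(\<integral>\<^sup>+y\<in>ball x R. ennreal \<bar>g y\<bar> \<partial>lebesgue) \<le> ennreal (A * ?v * R ^ ?N)" if "r \<le> R" for R
    using that r by (intro averages_bound avg A) simp
  have far: "(\<integral>\<^sup>+y\<in>?S. ?F y \<partial>lebesgue) \<le> ennreal (2 ^ ?N * (A * ?v) * D)"
    unfolding D_def
  proof (rule annuli_bound[where G = "\<lambda>y. ennreal \<bar>g y\<bar>"])
    show "AE y in lebesgue. \<forall>k\<ge>1. 2 ^ k * r \<le> norm (x - y) \<longrightarrow> norm (x - y) < 2 ^ Suc k * r \<longrightarrow>
        ?F y \<le> ennreal (\<omega> ((1/2) ^ k) / (2 ^ k * r) ^ ?N) * ennreal \<bar>g y\<bar>"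
    proof (intro AE_I2 allI impI)
      fix y k assume k: "1 \<le> k" "2 ^ k * r \<le> norm (x - y)"
      let ?c = "\<omega> ((1/2) ^ k) / (2 ^ k * r) ^ ?N"
      have "\<bar>(K x y - K \<xi> y) * g y\<bar> \<le> ?c * \<bar>g y\<bar>"
        unfolding abs_mult by (intro mult_right_mono K_smooth_annulus(1) near_r r k) simp
      moreover have "0 \<le> ?c"
        using r by (intro divide_nonneg_nonneg \<omega>_nonneg) auto
      ultimately show "?F y \<le> ennreal ?c * ennreal \<bar>g y\<bar>"
        by (simp add: ennreal_leI flip: ennreal_mult)
    qed
    show "0 \<le> A * ?v"
      using A by simp
  qed (use F r growth in \<open>auto intro: \<omega>_nonneg \<omega>_summable\<close>)
  let ?q = "2 * \<kappa> / side c ^ ?N"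
  have q: "0 \<le> ?q"
    using \<kappa>_nonneg by (simp add: less_imp_le)
  have "(\<integral>\<^sup>+y\<in>- ?S. ?F y \<partial>lebesgue) \<le> (\<integral>\<^sup>+y. ennreal ?q * (ennreal \<bar>g y\<bar> * indicator (ball x (2 * r)) y) \<partial>lebesgue)"
  proof (intro nn_integral_mono)
    fix y
    show "?F y * indicator (- ?S) y \<le> ennreal ?q * (ennreal \<bar>g y\<bar> * indicator (ball x (2 * r)) y)"
    proof (cases "y \<in> ?S \<or> g y = 0")
      case False
      then have y: "y \<notin> tripled c" "y \<in> ball x (2 * r)"
        using zero by (auto simp: dist_norm)
      have "?q = \<kappa> / side c ^ ?N + \<kappa> / side c ^ ?N"
        by (simp only: mult_2 add_divide_distrib distrib_right)
      then have "\<bar>K x y - K \<xi> y\<bar> \<le> ?q"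
        using K_far[OF x y(1)] K_far[OF \<xi> y(1)] abs_triangle_ineq4[of "K x y" "K \<xi> y"] by linarith
      then have "\<bar>(K x y - K \<xi> y) * g y\<bar> \<le> ?q * \<bar>g y\<bar>"
        unfolding abs_mult by (rule mult_right_mono) simp
      then have "?F y \<le> ennreal ?q * ennreal \<bar>g y\<bar>"
        using q by (simp add: ennreal_leI flip: ennreal_mult)
      then show ?thesis
        using False y by simp
    qed auto
  qed
  also have "\<dots> = ennreal ?q * (\<integral>\<^sup>+y\<in>ball x (2 * r). ennreal \<bar>g y\<bar> \<partial>lebesgue)"
    by (rule nn_integral_cmult) (intro borel_measurable_times_ennreal borel_measurable_indicator; simp)
  also have "\<dots> \<le> ennreal ?q * ennreal (A * ?v * (2 * r) ^ ?N)"
    using r by (intro mult_left_mono growth) auto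
  also have "\<dots> = ennreal (?q * (A * ?v * (2 * r) ^ ?N))"
    using q by (rule ennreal_mult'[symmetric])
  also have "?q * (A * ?v * (2 * r) ^ ?N) = 2 * \<kappa> * ?v * (2 * real ?N) ^ ?N * A"
  proof -
    have "side c \<noteq> 0"
      using side_pos[of c] by linarith
    then show ?thesis
      by (simp add: r_def power_mult_distrib)
  qed
  finally have near: "(\<integral>\<^sup>+y\<in>- ?S. ?F y \<partial>lebesgue) \<le> ennreal (2 * \<kappa> * ?v * (2 * real ?N) ^ ?N * A)" .
  have cS: "- ?S \<in> sets lebesgue"
    using sets.compl_sets[OF S] by (simp add: Compl_eq_Diff_UNIV)
  have "(\<integral>\<^sup>+y. ?F y \<partial>lebesgue) = (\<integral>\<^sup>+y. ?F y * indicator (- ?S) y + ?F y * indicator ?S y \<partial>lebesgue)"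
    by (intro nn_integral_cong) (auto split: split_indicator)
  also have "\<dots> = (\<integral>\<^sup>+y\<in>- ?S. ?F y \<partial>lebesgue) + (\<integral>\<^sup>+y\<in>?S. ?F y \<partial>lebesgue)"
    by (intro nn_integral_add borel_measurable_times_ennreal borel_measurable_indicator F S cS)
  also have "\<dots> \<le> ennreal (2 * \<kappa> * ?v * (2 * real ?N) ^ ?N * A) + ennreal (2 ^ ?N * (A * ?v) * D)"
    by (intro add_mono near far)
  also have "\<dots> = ennreal ((2 * \<kappa> * ?v * (2 * real ?N) ^ ?N + 2 ^ ?N * ?v * D) * A)"
    using \<kappa>_nonneg A D_nonneg by (subst ennreal_plus[symmetric]) (auto simp: algebra_simps)
  finally show ?thesis .
qed

text \<open>
  The weak type inequality, applied to the part of \<open>g\<close> on the triple, provides one point \<open>x\<close> of the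
  cube at which \<open>Te\<close> of this part, hence also of the far part, is at most a multiple of \<open>A\<close>; and on
  the cube \<open>Te\<close> of the far part varies by at most a multiple of \<open>A\<close>.  The comparison with a single
  point plays the role of a maximal inequality for truncations of the operator.
\<close>

theorem far_part_bound:
  obtains C where "0 \<le> C"
    "\<And>g A c. integrable lebesgue g \<Longrightarrow> 0 < A \<Longrightarrow>
      emeasure lebesgue (dcube c \<inter> ({x. A < \<bar>Te g x\<bar>} \<union> large_averages A (\<lambda>y. ennreal \<bar>g y\<bar>)))
        \<le> ennreal (side c ^ CARD('n) / 2) \<Longrightarrow>
      AE \<xi> in lebesgue. \<xi> \<in> dcube c \<longrightarrow> \<bar>Te (\<lambda>y. g y * indicator (- tripled c) y) \<xi>\<bar> \<le> C * A"
proof -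
  let ?N = "CARD('n)" and ?v = "unit_ball_vol (real CARD('n))"
  define q where "q = ?v * (3 * real ?N) ^ ?N"
  define I where "I = 2 * \<kappa> * ?v * (2 * real ?N) ^ ?N + 2 ^ ?N * ?v * D"
  \<comment> \<open>\<open>A * q\<close> bounds the average of the near part; with \<open>s\<close> as below, \<open>Te\<close> of the near part
    exceeds \<open>s * A\<close> on at most a quarter of the cube\<close>
  define s where "s = 8 * W * q + 1"
  have q: "0 \<le> q"
    by (simp add: q_def)
  have I: "0 \<le> I"
    using \<kappa>_nonneg D_nonneg by (simp add: I_def)
  have s: "0 < s"
    using q W_nonneg by (auto simp: s_def intro: add_nonneg_pos)
  show thesis
  proof (rule that[of "1 + s + I"])
    show "0 \<le> 1 + s + I"
      using s I by simp
    fix g :: "real ^ 'n \<Rightarrow> real" and A :: real and c :: "'n dyadic"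
    assume g: "integrable lebesgue g" and A: "0 < A"
      and half: "emeasure lebesgue (dcube c \<inter> ({x. A < \<bar>Te g x\<bar>} \<union> large_averages A (\<lambda>y. ennreal \<bar>g y\<bar>)))
        \<le> ennreal (side c ^ ?N / 2)"
    define M where "M = side c ^ ?N"
    have M: "0 < M" "emeasure lebesgue (dcube c) = ennreal M"
      by (auto simp: M_def emeasure_dcube)
    define bad where "bad = {x. A < \<bar>Te g x\<bar>} \<union> large_averages A (\<lambda>y. ennreal \<bar>g y\<bar>)"
    define g1 where "g1 y = g y * indicator (tripled c) y" for y
    define g2 where "g2 y = g y * indicator (- tripled c) y" for y
    have cT: "- tripled c \<in> sets lebesgue"
      using sets.compl_sets[OF tripled_lebesgue[of c]] by (simp add: Compl_eq_Diff_UNIV)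
    have g1: "integrable lebesgue g1" and g2: "integrable lebesgue g2"
      unfolding g1_def g2_def by (intro integrable_mult_ind g tripled_lebesgue cT)+
    have [measurable]: "Te g \<in> borel_measurable lebesgue" "Te g1 \<in> borel_measurable lebesgue"
      by (intro Te_measurable g g1)+
    have bad_sets [measurable]: "bad \<in> sets lebesgue"
      unfolding bad_def by (intro sets.Un superlevel_lebesgue large_averages_lebesgue) measurable
    have half': "emeasure lebesgue (dcube c \<inter> bad) \<le> ennreal (M / 2)"
      using half by (simp add: bad_def M_def)
    have "\<exists>y0\<in>dcube c. y0 \<notin> bad"
    proof (rule ccontr)
      assume "\<not> (\<exists>y0\<in>dcube c. y0 \<notin> bad)"
      then have "dcube c \<inter> bad = dcube c" by blast
      with half' M show False
        by simp
    qed
    then obtain y0 where y0: "y0 \<in> dcube c" "y0 \<notin> bad"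
      by blast
    have g1_norm: "norm_L1 g1 \<le> A * q * M"
    proof -
      have "ennreal (norm_L1 g1) = (\<integral>\<^sup>+y. ennreal \<bar>g1 y\<bar> \<partial>lebesgue)"
        by (rule nn_integral_real[OF g1, symmetric])
      also have "\<dots> \<le> (\<integral>\<^sup>+y\<in>ball y0 (3 * real ?N * side c). ennreal \<bar>g y\<bar> \<partial>lebesgue)"
      proof (intro nn_integral_mono)
        fix y
        have "y \<in> ball y0 (3 * real ?N * side c)" if "y \<in> tripled c"
        proof -
          define p where "p = real ?N * side c"
          have "0 < p" "norm (y0 - y) \<le> 2 * p"
            using dist_le_in_tripled[OF y0(1) that] by (simp_all add: p_def mult_ac)
          then have "norm (y0 - y) < 3 * p"
            by linarith
          then show ?thesis
            by (simp add: dist_norm p_def mult.assoc)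
        qed
        then show "ennreal \<bar>g1 y\<bar> \<le> ennreal \<bar>g y\<bar> * indicator (ball y0 (3 * real ?N * side c)) y"
          by (auto simp: g1_def split: split_indicator)
      qed
      also have "\<dots> \<le> ennreal (A * ?v * (3 * real ?N * side c) ^ ?N)"
        using y0 A by (intro averages_bound) (auto simp: bad_def)
      also have "A * ?v * (3 * real ?N * side c) ^ ?N = A * q * M"
        by (simp add: q_def M_def power_mult_distrib)
      finally show ?thesis
        using A q M by simp
    qed
    have "emeasure lebesgue {x. s * A < \<bar>Te g1 x\<bar>} \<le> ennreal (M / 4)"
    proof (rule order_trans[OF Te_weak_type[OF g1]], use s A in simp, rule ennreal_leI)
      have "2 * W * norm_L1 g1 \<le> 2 * W * (A * q * M)"
        using W_nonneg by (intro mult_left_mono g1_norm) simp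
      also have "\<dots> \<le> M / 4 * (s * A)"
        using A M by (simp add: s_def algebra_simps)
      finally show "2 * W * norm_L1 g1 / (s * A) \<le> M / 4"
        using s A by (simp add: pos_divide_le_eq)
    qed
    note quarter = this
    have split: "AE x in lebesgue. Te g x = Te g1 x + Te g2 x"
    proof -
      have "g = (\<lambda>y. 1 * g1 y + 1 * g2 y)"
        by (auto simp: g1_def g2_def split: split_indicator)
      then show ?thesis
        using Te_linear[OF g1 g2, of 1 1] by simp
    qed
    have rep: "AE x in lebesgue. x \<in> dcube c \<longrightarrow> has_bochner_integral lebesgue (\<lambda>y. K x y * g2 y) (Te g2 x)"
      by (rule Te_kernel[OF g2]) (simp add: g2_def)
    have "\<exists>x\<in>dcube c. x \<notin> bad \<and> \<bar>Te g1 x\<bar> \<le> s * A \<and> Te g x = Te g1 x + Te g2 x \<and>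
        has_bochner_integral lebesgue (\<lambda>y. K x y * g2 y) (Te g2 x)"
    proof (rule ccontr)
      assume none: "\<not> ?thesis"
      have "emeasure lebesgue (dcube c) \<le> emeasure lebesgue ((dcube c \<inter> bad) \<union> {x. s * A < \<bar>Te g1 x\<bar>})"
      proof (rule emeasure_mono_AE)
        show "AE x in lebesgue. x \<in> dcube c \<longrightarrow> x \<in> (dcube c \<inter> bad) \<union> {x. s * A < \<bar>Te g1 x\<bar>}"
          using split rep by eventually_elim (use none in \<open>force simp: not_le\<close>)
        show "(dcube c \<inter> bad) \<union> {x. s * A < \<bar>Te g1 x\<bar>} \<in> sets lebesgue"
          by (intro sets.Un sets.Int superlevel_lebesgue bad_sets dcube_lebesgue) measurable
      qed
      also have "\<dots> \<le> emeasure lebesgue (dcube c \<inter> bad) + emeasure lebesgue {x. s * A < \<bar>Te g1 x\<bar>}"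
        by (intro emeasure_subadditive sets.Int superlevel_lebesgue bad_sets dcube_lebesgue) measurable
      also have "\<dots> \<le> ennreal (M / 2) + ennreal (M / 4)"
        by (intro add_mono half' quarter)
      also have "\<dots> = ennreal (M / 2 + M / 4)"
        using M by (subst ennreal_plus) auto
      finally show False
        using M by simp
    qed
    then obtain x where x: "x \<in> dcube c" "x \<notin> bad" "\<bar>Te g1 x\<bar> \<le> s * A" "Te g x = Te g1 x + Te g2 x"
      and x_rep: "has_bochner_integral lebesgue (\<lambda>y. K x y * g2 y) (Te g2 x)"
      by blast
    have x_bd: "\<bar>Te g2 x\<bar> \<le> A + s * A"
      using x(2-4) by (auto simp: bad_def)
    have avg2: "x \<notin> large_averages A (\<lambda>y. ennreal \<bar>g2 y\<bar>)"
    proof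
      assume "x \<in> large_averages A (\<lambda>y. ennreal \<bar>g2 y\<bar>)"
      then obtain z r where zr: "0 < r" "x \<in> ball z r"
        "ennreal A * emeasure lebesgue (ball z r) < (\<integral>\<^sup>+y\<in>ball z r. ennreal \<bar>g2 y\<bar> \<partial>lebesgue)"
        unfolding large_averages_def by blast
      note zr(3)
      also have "(\<integral>\<^sup>+y\<in>ball z r. ennreal \<bar>g2 y\<bar> \<partial>lebesgue) \<le> (\<integral>\<^sup>+y\<in>ball z r. ennreal \<bar>g y\<bar> \<partial>lebesgue)"
        by (intro nn_integral_mono) (auto simp: g2_def split: split_indicator)
      finally have "x \<in> large_averages A (\<lambda>y. ennreal \<bar>g y\<bar>)"
        using zr(1,2) unfolding large_averages_def by blast
      then show False
        using x(2) by (simp add: bad_def)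
    qed
    have "AE \<xi> in lebesgue. \<xi> \<in> dcube c \<longrightarrow> \<bar>Te g2 \<xi>\<bar> \<le> (1 + s + I) * A"
      using rep
    proof (rule AE_mp, intro AE_I2 impI)
      fix \<xi> assume rep: "\<xi> \<in> dcube c \<longrightarrow> has_bochner_integral lebesgue (\<lambda>y. K \<xi> y * g2 y) (Te g2 \<xi>)"
        and \<xi>: "\<xi> \<in> dcube c"
      have diff: "has_bochner_integral lebesgue (\<lambda>y. (K x y - K \<xi> y) * g2 y) (Te g2 x - Te g2 \<xi>)"
        using has_bochner_integral_diff[OF x_rep rep[rule_format, OF \<xi>]] by (simp add: left_diff_distrib)
      then have meas: "(\<lambda>y. (K x y - K \<xi> y) * g2 y) \<in> borel_measurable lebesgue"
        and int: "integrable lebesgue (\<lambda>y. (K x y - K \<xi> y) * g2 y)"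
        by (auto simp: has_bochner_integral_iff)
      have "ennreal \<bar>Te g2 x - Te g2 \<xi>\<bar> = ennreal (norm (LINT y|lebesgue. (K x y - K \<xi> y) * g2 y))"
        using diff by (simp add: has_bochner_integral_integral_eq)
      also have "\<dots> \<le> (\<integral>\<^sup>+y. ennreal (norm ((K x y - K \<xi> y) * g2 y)) \<partial>lebesgue)"
        by (rule integral_norm_bound_ennreal[OF int])
      also have "\<dots> \<le> ennreal (I * A)"
        unfolding I_def real_norm_def
        by (rule kernel_increment_bound[OF g2 _ \<xi> x(1) A avg2 meas]) (simp add: g2_def)
      finally have "\<bar>Te g2 x - Te g2 \<xi>\<bar> \<le> I * A"
        using I A by simp
      then show "\<bar>Te g2 \<xi>\<bar> \<le> (1 + s + I) * A"
        using x_bd by (simp add: distrib_right)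
    qed
    then show "AE \<xi> in lebesgue. \<xi> \<in> dcube c \<longrightarrow> \<bar>Te (\<lambda>y. g y * indicator (- tripled c) y) \<xi>\<bar> \<le> (1 + s + I) * A"
      by (simp add: g2_def[abs_def])
  qed
qed

end

section \<open>Convex body averages\<close>

text \<open>
  The \<open>m\<close>-fold dilate of the convex body average.  In terms of the multipliers \<open>\<phi>\<close> dilates are
  added and scaled simply by adding and scaling \<open>\<phi>\<close>.
\<close>

definition scaled_body :: "real \<Rightarrow> (real ^ 'n) set \<Rightarrow> (real ^ 'n \<Rightarrow> real ^ 'd) \<Rightarrow> (real ^ 'd) set" where
  "scaled_body m Q f =
     {average Q (\<lambda>x. \<phi> x *\<^sub>R f x) |\<phi>.
        \<phi> \<in> borel_measurable (lebesgue_on Q) \<and> (AE x in lebesgue_on Q. \<bar>\<phi> x\<bar> \<le> m)}"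

lemma integrable_bounded_scaleR:
  fixes f :: "'a \<Rightarrow> 'b::{banach, second_countable_topology}"
  assumes f: "integrable M f" and [measurable]: "\<phi> \<in> borel_measurable M"
    and m: "AE x in M. \<bar>\<phi> x\<bar> \<le> m"
  shows "integrable M (\<lambda>x. \<phi> x *\<^sub>R f x)"
proof (rule Bochner_Integration.integrable_bound)
  have [measurable]: "f \<in> borel_measurable M"
    using f by auto
  show "integrable M (\<lambda>x. m *\<^sub>R f x)"
    using f by simp
  show "(\<lambda>x. \<phi> x *\<^sub>R f x) \<in> borel_measurable M"
    by measurable
  show "AE x in M. norm (\<phi> x *\<^sub>R f x) \<le> norm (m *\<^sub>R f x)"
    using m by (rule AE_mp) (auto intro!: AE_I2 mult_right_mono)
qed

lemma scaled_bodyI: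
  "\<phi> \<in> borel_measurable (lebesgue_on Q) \<Longrightarrow> AE x in lebesgue_on Q. \<bar>\<phi> x\<bar> \<le> m \<Longrightarrow>
    average Q (\<lambda>x. \<phi> x *\<^sub>R f x) \<in> scaled_body m Q f"
  by (auto simp: scaled_body_def)

lemma scaled_bodyE:
  assumes "u \<in> scaled_body m Q f"
  obtains \<phi> where "\<phi> \<in> borel_measurable (lebesgue_on Q)" "AE x in lebesgue_on Q. \<bar>\<phi> x\<bar> \<le> m"
    "u = average Q (\<lambda>x. \<phi> x *\<^sub>R f x)"
  using assms by (auto simp: scaled_body_def)

lemma zero_in_scaled_body: "0 \<le> m \<Longrightarrow> 0 \<in> scaled_body m Q f"
  using scaled_bodyI[of "\<lambda>_. 0" Q m f] by (simp add: average_def)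

lemma scaled_body_mono: "m \<le> m' \<Longrightarrow> scaled_body m Q f \<subseteq> scaled_body m' Q f"
  unfolding scaled_body_def by (fastforce elim!: AE_mp)

lemma scaled_body_add:
  assumes f: "integrable (lebesgue_on Q) f" and u: "u \<in> scaled_body a Q f" and v: "v \<in> scaled_body b Q f"
  shows "u + v \<in> scaled_body (a + b) Q f"
proof -
  obtain \<phi> where \<phi>: "\<phi> \<in> borel_measurable (lebesgue_on Q)" "AE x in lebesgue_on Q. \<bar>\<phi> x\<bar> \<le> a"
    "u = average Q (\<lambda>x. \<phi> x *\<^sub>R f x)"
    using u by (rule scaled_bodyE)
  obtain \<psi> where \<psi>: "\<psi> \<in> borel_measurable (lebesgue_on Q)" "AE x in lebesgue_on Q. \<bar>\<psi> x\<bar> \<le> b"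
    "v = average Q (\<lambda>x. \<psi> x *\<^sub>R f x)"
    using v by (rule scaled_bodyE)
  have "u + v = average Q (\<lambda>x. (\<phi> x + \<psi> x) *\<^sub>R f x)"
    using integrable_bounded_scaleR[OF f \<phi>(1,2)] integrable_bounded_scaleR[OF f \<psi>(1,2)]
    by (simp add: \<phi>(3) \<psi>(3) average_def scaleR_add_left scaleR_add_right)
  also have "\<dots> \<in> scaled_body (a + b) Q f"
  proof (rule scaled_bodyI)
    show "(\<lambda>x. \<phi> x + \<psi> x) \<in> borel_measurable (lebesgue_on Q)"
      using \<phi>(1) \<psi>(1) by measurable
    show "AE x in lebesgue_on Q. \<bar>\<phi> x + \<psi> x\<bar> \<le> a + b"
      using \<phi>(2) \<psi>(2) by eventually_elim auto
  qed
  finally show ?thesis .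
qed

lemma scaled_body_scaleR:
  assumes u: "u \<in> scaled_body a Q f"
  shows "t *\<^sub>R u \<in> scaled_body (\<bar>t\<bar> * a) Q f"
proof -
  obtain \<phi> where \<phi>: "\<phi> \<in> borel_measurable (lebesgue_on Q)" "AE x in lebesgue_on Q. \<bar>\<phi> x\<bar> \<le> a"
    "u = average Q (\<lambda>x. \<phi> x *\<^sub>R f x)"
    using u by (rule scaled_bodyE)
  have "t *\<^sub>R u = average Q (\<lambda>x. (t * \<phi> x) *\<^sub>R f x)"
    by (simp add: \<phi>(3) average_def scaleR_left_commute flip: scaleR_scaleR)
  also have "\<dots> \<in> scaled_body (\<bar>t\<bar> * a) Q f"
  proof (rule scaled_bodyI)
    show "(\<lambda>x. t * \<phi> x) \<in> borel_measurable (lebesgue_on Q)"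
      using \<phi>(1) by measurable
    show "AE x in lebesgue_on Q. \<bar>t * \<phi> x\<bar> \<le> \<bar>t\<bar> * a"
      using \<phi>(2) by eventually_elim (simp add: abs_mult mult_left_mono)
  qed
  finally show ?thesis .
qed

lemma scaled_body_sum:
  assumes f: "integrable (lebesgue_on Q) f" and "finite I" "\<And>i. i \<in> I \<Longrightarrow> u i \<in> scaled_body a Q f"
  shows "(\<Sum>i\<in>I. u i) \<in> scaled_body (real (card I) * a) Q f"
  using assms(2,3)
proof (induction I)
  case empty
  then show ?case by (simp add: zero_in_scaled_body)
next
  case (insert i I)
  have "u i + (\<Sum>i\<in>I. u i) \<in> scaled_body (a + real (card I) * a) Q f"
    using insert by (intro scaled_body_add[OF f]) auto
  then show ?case
    using insert by (simp add: distrib_right)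
qed

lemma scaled_body_eq_image:
  assumes "0 < m" "u \<in> scaled_body m Q f"
  obtains v where "v \<in> convex_body_average Q f" "u = m *\<^sub>R v"
proof
  show "(1 / m) *\<^sub>R u \<in> convex_body_average Q f"
    using scaled_body_scaleR[OF assms(2), of "1 / m"] assms(1)
    by (simp add: scaled_body_def convex_body_average_def)
  show "u = m *\<^sub>R ((1 / m) *\<^sub>R u)"
    using assms(1) by simp
qed

lemma inner_average:
  assumes "integrable (lebesgue_on Q) f"
  shows "l \<bullet> average Q f = (LINT x|lebesgue_on Q. l \<bullet> f x) / measure lebesgue Q"
  using assms by (simp add: average_def)

lemma inner_scaled_body_le:
  assumes f: "integrable (lebesgue_on Q) f" and u: "u \<in> scaled_body m Q f"
  shows "\<bar>l \<bullet> u\<bar> \<le> m * (LINT x|lebesgue_on Q. \<bar>l \<bullet> f x\<bar>) / measure lebesgue Q"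
proof -
  obtain \<phi> where \<phi>: "\<phi> \<in> borel_measurable (lebesgue_on Q)" "AE x in lebesgue_on Q. \<bar>\<phi> x\<bar> \<le> m"
    "u = average Q (\<lambda>x. \<phi> x *\<^sub>R f x)"
    using u by (rule scaled_bodyE)
  have int: "integrable (lebesgue_on Q) (\<lambda>x. \<phi> x *\<^sub>R f x)"
    by (rule integrable_bounded_scaleR[OF f \<phi>(1,2)])
  have "\<bar>LINT x|lebesgue_on Q. l \<bullet> (\<phi> x *\<^sub>R f x)\<bar> \<le> (LINT x|lebesgue_on Q. \<bar>l \<bullet> (\<phi> x *\<^sub>R f x)\<bar>)"
    by (rule integral_abs_bound)
  also have "\<dots> \<le> (LINT x|lebesgue_on Q. m * \<bar>l \<bullet> f x\<bar>)"
  proof (rule integral_mono_AE)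
    show "integrable (lebesgue_on Q) (\<lambda>x. \<bar>l \<bullet> (\<phi> x *\<^sub>R f x)\<bar>)"
      by (intro integrable_abs integrable_inner_right impI int)
    show "integrable (lebesgue_on Q) (\<lambda>x. m * \<bar>l \<bullet> f x\<bar>)"
      by (intro integrable_abs integrable_mult_right integrable_inner_right impI f)
    show "AE x in lebesgue_on Q. \<bar>l \<bullet> (\<phi> x *\<^sub>R f x)\<bar> \<le> m * \<bar>l \<bullet> f x\<bar>"
      using \<phi>(2) by eventually_elim (simp add: abs_mult mult_right_mono)
  qed
  also have "\<dots> = m * (LINT x|lebesgue_on Q. \<bar>l \<bullet> f x\<bar>)"
    by simp
  finally show ?thesis
    unfolding \<phi>(3) inner_average[OF int] by (simp add: divide_right_mono)
qed

text \<open>The choice \<open>\<phi> = sgn (l \<bullet> f)\<close> shows that a functional attains its \<open>L\<^sup>1\<close> average on the body.\<close>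

lemma inner_scaled_body_attained:
  assumes f: "integrable (lebesgue_on Q) f"
  obtains u where "u \<in> scaled_body 1 Q f"
    "l \<bullet> u = (LINT x|lebesgue_on Q. \<bar>l \<bullet> f x\<bar>) / measure lebesgue Q"
proof
  have [measurable]: "f \<in> borel_measurable (lebesgue_on Q)"
    using f by auto
  let ?\<phi> = "\<lambda>x. sgn (l \<bullet> f x)"
  have "?\<phi> \<in> borel_measurable (lebesgue_on Q)"
    by measurable
  moreover have "AE x in lebesgue_on Q. \<bar>?\<phi> x\<bar> \<le> 1"
    by (simp add: sgn_if)
  ultimately have \<phi>: "?\<phi> \<in> borel_measurable (lebesgue_on Q)" "AE x in lebesgue_on Q. \<bar>?\<phi> x\<bar> \<le> 1"
    by this+
  show "average Q (\<lambda>x. ?\<phi> x *\<^sub>R f x) \<in> scaled_body 1 Q f"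
    by (rule scaled_bodyI[OF \<phi>])
  have "l \<bullet> (?\<phi> x *\<^sub>R f x) = \<bar>l \<bullet> f x\<bar>" for x
    by (simp add: sgn_mult_abs mult.commute abs_sgn[symmetric])
  then show "l \<bullet> average Q (\<lambda>x. ?\<phi> x *\<^sub>R f x) = (LINT x|lebesgue_on Q. \<bar>l \<bullet> f x\<bar>) / measure lebesgue Q"
    by (subst inner_average[OF integrable_bounded_scaleR[OF f \<phi>]]) simp
qed

lemma AE_zero_of_trivial_body:
  fixes f :: "real ^ 'n \<Rightarrow> real ^ 'd"
  assumes f: "integrable (lebesgue_on Q) f" and Q: "0 < measure lebesgue Q"
    and trivial: "scaled_body 1 Q f \<subseteq> {0}"
  shows "AE x in lebesgue_on Q. f x = 0"
proof -
  have "AE x in lebesgue_on Q. b \<bullet> f x = 0" for b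
  proof -
    obtain u where u: "u \<in> scaled_body 1 Q f"
      "b \<bullet> u = (LINT x|lebesgue_on Q. \<bar>b \<bullet> f x\<bar>) / measure lebesgue Q"
      using inner_scaled_body_attained[OF f] by blast
    have "u = 0"
      using trivial u(1) by blast
    then have "(LINT x|lebesgue_on Q. \<bar>b \<bullet> f x\<bar>) = 0"
      using u(2) Q by simp
    moreover have "integrable (lebesgue_on Q) (\<lambda>x. \<bar>b \<bullet> f x\<bar>)"
      by (intro integrable_abs integrable_inner_right impI f)
    ultimately have "AE x in lebesgue_on Q. \<bar>b \<bullet> f x\<bar> = 0"
      by (subst (asm) integral_nonneg_eq_0_iff_AE) auto
    then show ?thesis by simp
  qed
  then have "AE x in lebesgue_on Q. \<forall>i. axis i 1 \<bullet> f x = 0"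
    by (simp add: AE_all_countable)
  then show ?thesis
    by eventually_elim (simp add: vec_eq_iff inner_axis')
qed

text \<open>
  Subtracting from \<open>f\<close> its component along an almost longest vector \<open>e\<close> of the body lowers the
  dimension spanned by the body.  Since \<open>e\<close> is almost longest, the component has average at most
  \<open>2\<close>, and a vector of the new body lies in three times the old one.
\<close>

lemma body_coordinates_aux:
  fixes f :: "real ^ 'n \<Rightarrow> real ^ 'd"
  assumes Q: "0 < measure lebesgue Q"
  shows "integrable (lebesgue_on Q) f \<Longrightarrow> dim (scaled_body 1 Q f) \<le> n \<Longrightarrow>
    \<exists>e l. (\<forall>i<n. e i \<in> scaled_body (3 ^ n) Q f) \<and>
      (\<forall>i<n. (LINT x|lebesgue_on Q. \<bar>l i \<bullet> f x\<bar>) \<le> 2 * measure lebesgue Q) \<and>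
      (AE x in lebesgue_on Q. f x = (\<Sum>i<n. (l i \<bullet> f x) *\<^sub>R e i))"
proof (induction n arbitrary: f)
  case 0
  then have "AE x in lebesgue_on Q. f x = 0"
    by (intro AE_zero_of_trivial_body Q) auto
  then show ?case by simp
next
  case (Suc n)
  note f = Suc.prems(1)
  let ?M = "lebesgue_on Q" and ?K = "scaled_body 1 Q f" and ?q = "measure lebesgue Q"
  show ?case
  proof (cases "?K \<subseteq> {0}")
    case True
    then have "AE x in ?M. f x = 0"
      by (intro AE_zero_of_trivial_body Q f)
    then show ?thesis
      by (intro exI[of _ "\<lambda>_. 0"]) (use Q in \<open>auto simp: zero_in_scaled_body\<close>)
  next
    case False
    then obtain v where v: "v \<in> ?K" "v \<noteq> 0"
      by blast
    have bdd: "bdd_above (norm ` ?K)"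
    proof (rule bdd_aboveI2)
      fix u assume u: "u \<in> ?K"
      have "norm u \<le> (\<Sum>i\<in>UNIV. \<bar>u $ i\<bar>)"
        by (rule norm_le_l1_cart)
      also have "\<dots> \<le> (\<Sum>i\<in>UNIV. 1 * (LINT x|?M. \<bar>axis i 1 \<bullet> f x\<bar>) / ?q)"
        using inner_scaled_body_le[OF f u] by (intro sum_mono) (metis inner_axis' real_inner_1_left)
      finally show "norm u \<le> (\<Sum>i\<in>UNIV. 1 * (LINT x|?M. \<bar>axis i 1 \<bullet> f x\<bar>) / ?q)" .
    qed
    define s where "s = Sup (norm ` ?K)"
    have le_s: "norm u \<le> s" if "u \<in> ?K" for u
      unfolding s_def using that bdd by (intro cSup_upper) auto
    have "0 < s"
      using le_s[OF v(1)] v(2) by (metis less_le_trans zero_less_norm_iff)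
    then have "s / 2 < s" by simp
    then obtain e where e: "e \<in> ?K" "s / 2 < norm e"
      using less_cSup_iff[of "norm ` ?K" "s / 2"] bdd v(1) by (auto simp: s_def)
    have e0: "0 < norm e"
      using e(2) \<open>0 < s\<close> by linarith
    define l where "l = (1 / (norm e)\<^sup>2) *\<^sub>R e"
    have le: "l \<bullet> e = 1"
      using e0 by (simp add: l_def power2_norm_eq_inner)
    have el: "e \<bullet> u = (norm e)\<^sup>2 * (l \<bullet> u)" for u
      using e0 by (simp add: l_def)
    have l_f: "(LINT x|?M. \<bar>l \<bullet> f x\<bar>) \<le> 2 * ?q"
    proof -
      obtain u where u: "u \<in> ?K" "l \<bullet> u = (LINT x|?M. \<bar>l \<bullet> f x\<bar>) / ?q"
        using inner_scaled_body_attained[OF f] by blast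
      have "l \<bullet> u \<le> norm l * norm u"
        by (rule norm_cauchy_schwarz)
      also have "\<dots> \<le> norm l * (2 * norm e)"
        using le_s[OF u(1)] e(2) by (intro mult_left_mono) auto
      also have "\<dots> = 2"
        using e0 by (simp add: l_def power2_eq_square)
      finally show ?thesis
        using u(2) Q by (simp add: pos_divide_le_eq)
    qed
    define g where "g x = f x - (l \<bullet> f x) *\<^sub>R e" for x
    have lf_int: "integrable ?M (\<lambda>x. l \<bullet> f x)"
      using f by simp
    have g: "integrable ?M g"
      unfolding g_def by (intro Bochner_Integration.integrable_diff integrable_scaleR_left impI lf_int f)
    have avg_g: "average Q (\<lambda>x. \<phi> x *\<^sub>R g x) = u - (l \<bullet> u) *\<^sub>R e"
      if "\<phi> \<in> borel_measurable ?M" "AE x in ?M. \<bar>\<phi> x\<bar> \<le> m" and u: "u = average Q (\<lambda>x. \<phi> x *\<^sub>R f x)" for \<phi> m u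
    proof -
      have int: "integrable ?M (\<lambda>x. \<phi> x *\<^sub>R f x)"
        by (rule integrable_bounded_scaleR[OF f that(1,2)])
      have int': "integrable ?M (\<lambda>x. l \<bullet> (\<phi> x *\<^sub>R f x))"
        by (rule integrable_inner_right[OF int])
      have "(LINT x|?M. \<phi> x *\<^sub>R g x) = (LINT x|?M. \<phi> x *\<^sub>R f x - (l \<bullet> (\<phi> x *\<^sub>R f x)) *\<^sub>R e)"
        by (simp add: g_def scaleR_diff_right)
      also have "\<dots> = (LINT x|?M. \<phi> x *\<^sub>R f x) - (LINT x|?M. l \<bullet> (\<phi> x *\<^sub>R f x)) *\<^sub>R e"
        using int int' by (subst Bochner_Integration.integral_diff) auto
      finally show ?thesis
        unfolding u inner_average[OF int] by (simp add: average_def scaleR_diff_right)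
    qed
    let ?K' = "scaled_body 1 Q g"
    have K': "\<exists>u\<in>?K. w = u - (l \<bullet> u) *\<^sub>R e" if w: "w \<in> ?K'" for w
    proof -
      obtain \<phi> where \<phi>: "\<phi> \<in> borel_measurable ?M" "AE x in ?M. \<bar>\<phi> x\<bar> \<le> 1" "w = average Q (\<lambda>x. \<phi> x *\<^sub>R g x)"
        using w by (rule scaled_bodyE)
      show ?thesis
        using avg_g[OF \<phi>(1,2) refl] \<phi>(3) scaled_bodyI[OF \<phi>(1,2), of f] by auto
    qed
    have "span ?K' \<subset> span ?K"
    proof
      show "span ?K' \<subseteq> span ?K"
      proof (rule span_minimal)
        show "?K' \<subseteq> span ?K"
          using K' e(1) by (auto intro!: span_diff span_scale intro: span_base)
      qed (rule subspace_span)
      have "span ?K' \<subseteq> {w. e \<bullet> w = 0}"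
      proof (rule span_minimal)
        show "?K' \<subseteq> {w. e \<bullet> w = 0}"
        proof
          fix w assume "w \<in> ?K'"
          then obtain u where "w = u - (l \<bullet> u) *\<^sub>R e"
            using K' by blast
          then have "l \<bullet> w = 0"
            using le by (simp add: inner_diff_right)
          then show "w \<in> {w. e \<bullet> w = 0}"
            using el[of w] by simp
        qed
        show "subspace {w. e \<bullet> w = 0}"
          by (rule subspace_hyperplane)
      qed
      moreover have "e \<bullet> e \<noteq> 0"
        using e0 by auto
      ultimately have "e \<notin> span ?K'"
        by blast
      moreover have "e \<in> span ?K"
        by (rule span_base[OF e(1)])
      ultimately show "span ?K' \<noteq> span ?K"
        by blast
    qed
    then have "dim ?K' < dim ?K"
      by (rule dim_psubset)
    then have "dim ?K' \<le> n"
      using Suc.prems(2) by simp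
    from Suc.IH[OF g this] obtain e' l' where
      e': "\<forall>i<n. e' i \<in> scaled_body (3 ^ n) Q g"
      and l': "\<forall>i<n. (LINT x|?M. \<bar>l' i \<bullet> g x\<bar>) \<le> 2 * ?q"
      and rep: "AE x in ?M. g x = (\<Sum>i<n. (l' i \<bullet> g x) *\<^sub>R e' i)"
      by blast
    define E where "E i = (case i of 0 \<Rightarrow> e | Suc j \<Rightarrow> e' j)" for i
    define L where "L i = (case i of 0 \<Rightarrow> l | Suc j \<Rightarrow> l' j - (l' j \<bullet> e) *\<^sub>R l)" for i
    have L: "L (Suc j) \<bullet> f x = l' j \<bullet> g x" for j x
      by (simp add: L_def g_def inner_diff_left inner_diff_right mult.commute)
    have E: "e' j \<in> scaled_body (3 ^ Suc n) Q f" if j: "j < n" for j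
    proof -
      obtain \<phi> where \<phi>: "\<phi> \<in> borel_measurable ?M" "AE x in ?M. \<bar>\<phi> x\<bar> \<le> 3 ^ n" "e' j = average Q (\<lambda>x. \<phi> x *\<^sub>R g x)"
        using e' j by (blast elim: scaled_bodyE)
      define u where "u = average Q (\<lambda>x. \<phi> x *\<^sub>R f x)"
      have u: "u \<in> scaled_body (3 ^ n) Q f"
        unfolding u_def by (rule scaled_bodyI[OF \<phi>(1,2)])
      have "\<bar>l \<bullet> u\<bar> \<le> 3 ^ n * (LINT x|?M. \<bar>l \<bullet> f x\<bar>) / ?q"
        by (rule inner_scaled_body_le[OF f u])
      also have "\<dots> \<le> 3 ^ n * (2 * ?q) / ?q"
        using l_f Q by (intro divide_right_mono mult_left_mono) auto
      also have "\<dots> = 2 * 3 ^ n"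
        using Q by simp
      finally have lu: "\<bar>- (l \<bullet> u)\<bar> * 1 \<le> 2 * 3 ^ n"
        by simp
      have "u + (- (l \<bullet> u)) *\<^sub>R e \<in> scaled_body (3 ^ n + 2 * 3 ^ n) Q f"
        by (intro scaled_body_add[OF f u] subsetD[OF scaled_body_mono[OF lu] scaled_body_scaleR[OF e(1)]])
      moreover have "e' j = u + (- (l \<bullet> u)) *\<^sub>R e"
        using avg_g[OF \<phi>(1,2) u_def] \<phi>(3) by simp
      ultimately show ?thesis
        by simp
    qed
    have "e \<in> scaled_body (3 ^ Suc n) Q f"
      by (rule subsetD[OF scaled_body_mono e(1)]) (rule one_le_power, simp)
    with E have 1: "\<forall>i<Suc n. E i \<in> scaled_body (3 ^ Suc n) Q f"
      by (auto simp: E_def split: nat.split)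
    have 2: "\<forall>i<Suc n. (LINT x|?M. \<bar>L i \<bullet> f x\<bar>) \<le> 2 * ?q"
    proof (intro allI impI)
      fix i assume "i < Suc n"
      then show "(LINT x|?M. \<bar>L i \<bullet> f x\<bar>) \<le> 2 * ?q"
        using l_f l' L by (cases i) (auto simp: L_def[of 0])
    qed
    have 3: "AE x in ?M. f x = (\<Sum>i<Suc n. (L i \<bullet> f x) *\<^sub>R E i)"
      using rep
    proof eventually_elim
      case (elim x)
      have "f x = (l \<bullet> f x) *\<^sub>R e + g x"
        by (simp add: g_def)
      also have "g x = (\<Sum>i<n. (L (Suc i) \<bullet> f x) *\<^sub>R E (Suc i))"
        unfolding L by (subst elim) (simp add: E_def)
      finally show ?case
        by (subst sum.lessThan_Suc_shift) (simp add: L_def[of 0] E_def[of 0])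
    qed
    show ?thesis
      using 1 2 3 by blast
  qed
qed

text \<open>
  The vectors \<open>e i\<close> span a parallelepiped comparable with the body; in its coordinates every
  component of \<open>f\<close> has a bounded average, which reduces vector estimates to scalar ones.
\<close>

theorem body_coordinates:
  fixes f :: "real ^ 'n \<Rightarrow> real ^ 'd"
  assumes "0 < measure lebesgue Q" "integrable (lebesgue_on Q) f"
  obtains e l where "\<And>i. i < CARD('d) \<Longrightarrow> e i \<in> scaled_body (3 ^ CARD('d)) Q f"
    "\<And>i. i < CARD('d) \<Longrightarrow> (LINT x|lebesgue_on Q. \<bar>l i \<bullet> f x\<bar>) \<le> 2 * measure lebesgue Q"
    "AE x in lebesgue_on Q. f x = (\<Sum>i<CARD('d). (l i \<bullet> f x) *\<^sub>R e i)"
proof -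
  have "dim (scaled_body 1 Q f) \<le> CARD('d)"
    using dim_subset_UNIV[of "scaled_body 1 Q f"] by simp
  then show thesis
    using body_coordinates_aux[OF assms, of "CARD('d)"] that by blast
qed

section \<open>One step of the stopping-time argument\<close>

context calderon_zygmund
begin

lemma Te_sum:
  fixes m :: nat
  assumes "\<And>k. k < m \<Longrightarrow> integrable lebesgue (\<phi> k)"
  shows "AE x in lebesgue. Te (\<lambda>y. \<Sum>k<m. a k * \<phi> k y) x = (\<Sum>k<m. a k * Te (\<phi> k) x)"
  using assms
proof (induction m)
  case 0
  have "integrable lebesgue (\<lambda>y :: real ^ 'n. 0 :: real)"
    by simp
  from Te_linear[OF this this, of 0 0] show ?case
    by simp
next
  case (Suc m)
  have "integrable lebesgue (\<lambda>y. \<Sum>k<m. a k * \<phi> k y)"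
    using Suc.prems by (intro Bochner_Integration.integrable_sum integrable_mult_right) auto
  from Te_linear[OF this Suc.prems[of m], of 1 "a m"]
  have "AE x in lebesgue. Te (\<lambda>y. (\<Sum>k<m. a k * \<phi> k y) + a m * \<phi> m y) x
      = Te (\<lambda>y. \<Sum>k<m. a k * \<phi> k y) x + a m * Te (\<phi> m) x"
    by simp
  moreover have "AE x in lebesgue. Te (\<lambda>y. \<Sum>k<m. a k * \<phi> k y) x = (\<Sum>k<m. a k * Te (\<phi> k) x)"
    using Suc by simp
  ultimately show ?case
    by eventually_elim simp
qed

lemma integrable_component:
  fixes f :: "'a \<Rightarrow> real ^ 'd"
  shows "integrable M f \<Longrightarrow> integrable M (\<lambda>x. f x $ i)"
  using integrable_inner_right[of "axis i 1" M f] by (simp add: inner_axis')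

lemma vector_extension_cong:
  assumes "integrable lebesgue f" "integrable lebesgue g" "AE x in lebesgue. f x = g x"
  shows "AE x in lebesgue. vector_extension T f x = vector_extension T g x"
proof -
  have "AE x in lebesgue. Te (\<lambda>y. f y $ i) x = Te (\<lambda>y. g y $ i) x" for i
    using assms by (intro Te_cong integrable_component) (auto elim!: AE_mp)
  then have "AE x in lebesgue. \<forall>i. Te (\<lambda>y. f y $ i) x = Te (\<lambda>y. g y $ i) x"
    by (simp add: AE_all_countable)
  then show ?thesis
    by eventually_elim (simp add: vector_extension_def)
qed

lemma vector_extension_coordinates:
  fixes F :: "real ^ 'n \<Rightarrow> real ^ 'd" and m :: nat
  assumes F: "integrable lebesgue F" and \<phi>: "\<And>k. k < m \<Longrightarrow> integrable lebesgue (\<phi> k)"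
    and rep: "AE y in lebesgue. F y = (\<Sum>k<m. \<phi> k y *\<^sub>R e k)"
  shows "AE x in lebesgue. vector_extension T F x = (\<Sum>k<m. Te (\<phi> k) x *\<^sub>R e k)"
proof -
  have "AE x in lebesgue. Te (\<lambda>y. F y $ i) x = (\<Sum>k<m. e k $ i * Te (\<phi> k) x)" for i
  proof -
    have "AE x in lebesgue. Te (\<lambda>y. F y $ i) x = Te (\<lambda>y. \<Sum>k<m. e k $ i * \<phi> k y) x"
    proof (rule Te_cong)
      show "integrable lebesgue (\<lambda>y. F y $ i)"
        by (rule integrable_component[OF F])
      show "integrable lebesgue (\<lambda>y. \<Sum>k<m. e k $ i * \<phi> k y)"
        using \<phi> by (intro Bochner_Integration.integrable_sum integrable_mult_right) auto
      show "AE y in lebesgue. F y $ i = (\<Sum>k<m. e k $ i * \<phi> k y)"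
        using rep by eventually_elim (simp add: mult.commute)
    qed
    moreover have "AE x in lebesgue. Te (\<lambda>y. \<Sum>k<m. e k $ i * \<phi> k y) x = (\<Sum>k<m. e k $ i * Te (\<phi> k) x)"
      by (rule Te_sum) (rule \<phi>)
    ultimately show ?thesis
      by eventually_elim simp
  qed
  then have "AE x in lebesgue. \<forall>i. Te (\<lambda>y. F y $ i) x = (\<Sum>k<m. e k $ i * Te (\<phi> k) x)"
    by (simp add: AE_all_countable)
  then show ?thesis
    by eventually_elim (simp add: vector_extension_def vec_eq_iff mult.commute)
qed

abbreviation localized :: "(real ^ 'n \<Rightarrow> 'b::real_vector) \<Rightarrow> 'n dyadic \<Rightarrow> real ^ 'n \<Rightarrow> 'b" where
  "localized f c \<equiv> (\<lambda>y. indicator (tripled c) y *\<^sub>R f y)"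

lemma scaled_body_of_coordinates:
  fixes m :: nat
  assumes f: "integrable (lebesgue_on Q) f" and e: "\<And>k. k < m \<Longrightarrow> e k \<in> scaled_body b Q f"
    and a: "\<And>k. k < m \<Longrightarrow> \<bar>a k\<bar> \<le> A" and b: "0 \<le> b"
  shows "(\<Sum>k<m. a k *\<^sub>R e k) \<in> scaled_body (real m * (A * b)) Q f"
proof -
  have "a k *\<^sub>R e k \<in> scaled_body (A * b) Q f" if "k < m" for k
  proof -
    have "\<bar>a k\<bar> * b \<le> A * b"
      using a[OF that] b by (rule mult_right_mono)
    then show ?thesis
      using scaled_body_scaleR[OF e[OF that]] scaled_body_mono by blast
  qed
  then have "(\<Sum>k<m. a k *\<^sub>R e k) \<in> scaled_body (real (card {..<m}) * (A * b)) Q f"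
    by (intro scaled_body_sum[OF f]) auto
  then show ?thesis
    by simp
qed

text \<open>
  In the coordinates of the body every component of \<open>f\<close> has average at most \<open>2\<close>, so off a small
  exceptional set the scalar estimates hold for all components at once.  The children of \<open>c\<close> are
  the stopping cubes at which the density of the exceptional set exceeds \<open>2 ^ -(N + 1)\<close>.
\<close>

theorem stopping_children:
  obtains C where "0 < C"
    "\<And>(f :: real ^ 'n \<Rightarrow> real ^ 'd) c. integrable lebesgue f \<Longrightarrow>
      \<exists>Ch. disjoint_family_on dcube Ch \<and> (\<forall>b\<in>Ch. dcube b \<subseteq> dcube c) \<and>
        emeasure lebesgue (\<Union>b\<in>Ch. dcube b) \<le> ennreal (side c ^ CARD('n) / 2) \<and>
        (AE x in lebesgue. x \<in> dcube c \<longrightarrow>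
          (x \<notin> (\<Union>b\<in>Ch. dcube b) \<longrightarrow>
            vector_extension T (localized f c) x \<in> scaled_body C (tripled c) f) \<and>
          (\<forall>b\<in>Ch. x \<in> dcube b \<longrightarrow>
            vector_extension T (localized f c) x - vector_extension T (localized f b) x
              \<in> scaled_body C (tripled c) f))"
proof -
  let ?N = "CARD('n)" and ?d = "CARD('d)"
  obtain C0 where C0: "0 \<le> C0" and far:
    "\<And>g A c. integrable lebesgue g \<Longrightarrow> 0 < A \<Longrightarrow>
      emeasure lebesgue (dcube c \<inter> ({x. A < \<bar>Te g x\<bar>} \<union> large_averages A (\<lambda>y. ennreal \<bar>g y\<bar>)))
        \<le> ennreal (side c ^ ?N / 2) \<Longrightarrow>
      AE \<xi> in lebesgue. \<xi> \<in> dcube c \<longrightarrow> \<bar>Te (\<lambda>y. g y * indicator (- tripled c) y) \<xi>\<bar> \<le> C0 * A"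
    using far_part_bound by blast
  define J :: real where "J = 4 * W + 2 * 5 ^ ?N"
  have J: "0 < J"
    using W_nonneg by (simp add: J_def add_nonneg_pos)
  \<comment> \<open>with this \<open>A\<close> the exceptional sets of all components fill at most \<open>2 ^ -(N + 2)\<close> of the cube\<close>
  define A where "A = real ?d * J * 3 ^ ?N * (4 * 2 ^ ?N)"
  have A: "0 < A"
    using J by (simp add: A_def)
  define C where "C = real ?d * ((1 + C0) * A * 3 ^ ?d)"
  show thesis
  proof (rule that[of C])
    show "0 < C"
      using A C0 by (simp add: C_def)
    fix f :: "real ^ 'n \<Rightarrow> real ^ 'd" and c :: "'n dyadic"
    assume f: "integrable lebesgue f"
    define M where "M = side c ^ ?N"
    have M: "0 < M"
      by (simp add: M_def)
    let ?Q = "tripled c"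
    have Q: "measure lebesgue ?Q = 3 ^ ?N * M"
      by (simp add: measure_tripled M_def power_mult_distrib)
    have fQ: "integrable (lebesgue_on ?Q) f"
      using f by (simp add: integrable_restrict_space integrable_mult_indicator)
    obtain e l where e: "\<And>i. i < ?d \<Longrightarrow> e i \<in> scaled_body (3 ^ ?d) ?Q f"
      and l: "\<And>i. i < ?d \<Longrightarrow> (LINT x|lebesgue_on ?Q. \<bar>l i \<bullet> f x\<bar>) \<le> 2 * measure lebesgue ?Q"
      and rep: "AE x in lebesgue_on ?Q. f x = (\<Sum>i<?d. (l i \<bullet> f x) *\<^sub>R e i)"
      using body_coordinates[OF _ fQ] Q M by auto
    define \<phi> where "\<phi> k y = (l k \<bullet> f y) * indicator ?Q y" for k y
    have \<phi>: "integrable lebesgue (\<phi> k)" for k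
      unfolding \<phi>_def by (intro integrable_mult_ind integrable_inner_right f tripled_lebesgue)
    have \<phi>_norm: "norm_L1 (\<lambda>y. \<phi> k y) \<le> 2 * 3 ^ ?N * M" if "k < ?d" for k
    proof -
      have "(LINT x|lebesgue_on ?Q. \<bar>l k \<bullet> f x\<bar>) = norm_L1 (\<lambda>y. \<phi> k y)"
        by (subst integral_restrict_space) (auto simp: \<phi>_def abs_mult mult.commute)
      then show ?thesis
        using l[OF that] Q by simp
    qed
    have rep': "AE y in lebesgue. y \<in> ?Q \<longrightarrow> f y = (\<Sum>k<?d. (l k \<bullet> f y) *\<^sub>R e k)"
      using rep by (subst (asm) AE_restrict_space_iff) auto
    define bad where "bad k = {x. A < \<bar>Te (\<phi> k) x\<bar>} \<union> large_averages A (\<lambda>y. ennreal \<bar>\<phi> k y\<bar>)" for k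
    have Te_meas [measurable]: "Te (\<phi> k) \<in> borel_measurable lebesgue" for k
      by (rule Te_measurable[OF \<phi>])
    have \<phi>_meas [measurable]: "\<phi> k \<in> borel_measurable lebesgue" for k
      using \<phi>[of k] by auto
    have bad_sets [measurable]: "bad k \<in> sets lebesgue" for k
      unfolding bad_def by (intro sets.Un superlevel_lebesgue large_averages_lebesgue) measurable
    have bad: "emeasure lebesgue (bad k) \<le> ennreal (J * 3 ^ ?N * M / A)" if k: "k < ?d" for k
    proof -
      let ?I = "LINT y|lebesgue. \<bar>\<phi> k y\<bar>"
      have I: "0 \<le> ?I" "?I \<le> 2 * 3 ^ ?N * M"
        using \<phi>_norm[OF k] by auto
      have "ennreal A * emeasure lebesgue (large_averages A (\<lambda>y. ennreal \<bar>\<phi> k y\<bar>)) \<le> 5 ^ ?N * (\<integral>\<^sup>+y. ennreal \<bar>\<phi> k y\<bar> \<partial>lebesgue)"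
        using A by (intro hardy_littlewood_weak_type) measurable
      also have "\<dots> = ennreal (5 ^ ?N * ?I)"
        unfolding nn_integral_real[OF \<phi>] by (subst ennreal_mult) (auto simp flip: ennreal_power)
      finally have "emeasure lebesgue (large_averages A (\<lambda>y. ennreal \<bar>\<phi> k y\<bar>)) \<le> ennreal (5 ^ ?N * ?I / A)"
        using A I by (intro emeasure_le_divide) auto
      moreover have "emeasure lebesgue {x. A < \<bar>Te (\<phi> k) x\<bar>} \<le> ennreal (2 * W * ?I / A)"
        by (rule Te_weak_type[OF \<phi> A])
      moreover have "emeasure lebesgue (bad k) \<le> emeasure lebesgue {x. A < \<bar>Te (\<phi> k) x\<bar>}
          + emeasure lebesgue (large_averages A (\<lambda>y. ennreal \<bar>\<phi> k y\<bar>))"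
        unfolding bad_def by (intro emeasure_subadditive superlevel_lebesgue large_averages_lebesgue) measurable
      ultimately have "emeasure lebesgue (bad k) \<le> ennreal (2 * W * ?I / A) + ennreal (5 ^ ?N * ?I / A)"
        by (meson add_mono order_trans)
      also have "\<dots> = ennreal ((2 * W + 5 ^ ?N) * ?I / A)"
        using A I W_nonneg by (subst ennreal_plus[symmetric]) (auto simp: distrib_right add_divide_distrib)
      also have "\<dots> \<le> ennreal ((2 * W + 5 ^ ?N) * (2 * 3 ^ ?N * M) / A)"
        using A I W_nonneg by (intro ennreal_leI divide_right_mono mult_left_mono) auto
      also have "(2 * W + 5 ^ ?N) * (2 * 3 ^ ?N * M) / A = J * 3 ^ ?N * M / A"
        by (simp add: J_def algebra_simps)
      finally show ?thesis .
    qed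
    define E where "E = dcube c \<inter> (\<Union>k<?d. bad k)"
    have E_sets [measurable]: "E \<in> sets lebesgue"
      unfolding E_def by (intro sets.Int dcube_lebesgue sets.finite_UN bad_sets) simp
    have E: "emeasure lebesgue E \<le> ennreal (M / (4 * 2 ^ ?N))"
    proof -
      have "emeasure lebesgue E \<le> emeasure lebesgue (\<Union>k<?d. bad k)"
        by (intro emeasure_mono sets.finite_UN bad_sets) (auto simp: E_def)
      also have "\<dots> \<le> (\<Sum>k<?d. emeasure lebesgue (bad k))"
        by (intro emeasure_subadditive_finite) auto
      also have "\<dots> \<le> (\<Sum>k<?d. ennreal (J * 3 ^ ?N * M / A))"
        by (intro sum_mono bad) simp
      also have "\<dots> = ennreal (real ?d * (J * 3 ^ ?N * M / A))"
        using J M A by (simp add: ennreal_of_nat_eq_real_of_nat flip: ennreal_mult)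
      also have "real ?d * (J * 3 ^ ?N * M / A) = M / (4 * 2 ^ ?N)"
        using J by (simp add: A_def)
      finally show ?thesis .
    qed
    define \<alpha> :: real where "\<alpha> = 1 / (2 * 2 ^ ?N)"
    have \<alpha>: "0 < \<alpha>" "\<alpha> < 1" "2 ^ ?N * \<alpha> = 1 / 2"
    proof -
      have "1 < 2 * (2::real) ^ ?N"
        using one_le_power[of "2::real" ?N] by linarith
      then show "0 < \<alpha>" "\<alpha> < 1" "2 ^ ?N * \<alpha> = 1 / 2"
        by (simp_all add: \<alpha>_def)
    qed
    have indE: "(\<integral>\<^sup>+x\<in>dcube b. indicator E x \<partial>lebesgue) = emeasure lebesgue (dcube b \<inter> E)" for b
    proof -
      have "(\<integral>\<^sup>+x\<in>dcube b. indicator E x \<partial>lebesgue) = (\<integral>\<^sup>+x. indicator (dcube b \<inter> E) x \<partial>lebesgue)"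
        by (intro nn_integral_cong) (auto split: split_indicator)
      also have "\<dots> = emeasure lebesgue (dcube b \<inter> E)"
        by (intro nn_integral_indicator sets.Int dcube_lebesgue E_sets)
      finally show ?thesis .
    qed
    obtain Ch where Ch: "disjoint_family_on dcube Ch"
      "\<And>b. b \<in> Ch \<Longrightarrow> ennreal \<alpha> * emeasure lebesgue (dcube b) < (\<integral>\<^sup>+x\<in>dcube b. indicator E x \<partial>lebesgue)"
      "\<And>b. b \<in> Ch \<Longrightarrow> (\<integral>\<^sup>+x\<in>dcube b. indicator E x \<partial>lebesgue) \<le> ennreal (2 ^ ?N * \<alpha>) * emeasure lebesgue (dcube b)"
      "AE x in lebesgue. x \<notin> (\<Union>b\<in>Ch. dcube b) \<longrightarrow> indicator E x \<le> ennreal \<alpha>"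
    proof (rule calderon_zygmund_cubes[of "indicator E :: real ^ 'n \<Rightarrow> ennreal" \<alpha>])
      show "(indicator E :: real ^ 'n \<Rightarrow> ennreal) \<in> borel_measurable lebesgue"
        by measurable
      show "(\<integral>\<^sup>+x. indicator E x \<partial>lebesgue) < \<infinity>"
        using E by (simp add: less_top[symmetric]) (auto simp: top_unique)
    qed (use \<alpha> in auto)
    \<comment> \<open>a cube as large as \<open>c\<close> has density at most \<open>2 ^ -(N + 2)\<close> and is not selected\<close>
    have sub: "dcube b \<subseteq> dcube c" if b: "b \<in> Ch" for b
    proof -
      have dens: "ennreal \<alpha> * emeasure lebesgue (dcube b) < emeasure lebesgue (dcube b \<inter> E)"
        using Ch(2)[OF b] by (simp only: indE)
      then have "dcube b \<inter> E \<noteq> {}"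
        by auto
      then obtain x where x: "x \<in> dcube b" "x \<in> dcube c"
        by (auto simp: E_def)
      have "fst b \<le> fst c"
      proof (rule ccontr)
        assume "\<not> fst b \<le> fst c"
        then have "dcube c \<subseteq> dcube b"
          using x by (intro dcube_nested[of x]) auto
        then have "emeasure lebesgue (dcube c) \<le> emeasure lebesgue (dcube b)"
          by (intro emeasure_mono) auto
        then have "ennreal \<alpha> * ennreal M \<le> ennreal \<alpha> * emeasure lebesgue (dcube b)"
          unfolding emeasure_dcube[of c] M_def by (rule mult_left_mono) simp
        also note dens
        also have "emeasure lebesgue (dcube b \<inter> E) \<le> emeasure lebesgue E"
          by (intro emeasure_mono) auto
        also note E
        finally have "\<alpha> * M < M / (4 * 2 ^ ?N)"
          using \<alpha> M by (subst (asm) ennreal_mult[symmetric]) (auto simp: ennreal_less_iff)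
        moreover have "M / (4 * 2 ^ ?N) = \<alpha> * M / 2" "0 < \<alpha> * M"
          using M \<alpha> by (simp_all add: \<alpha>_def)
        ultimately show False
          by linarith
      qed
      then show ?thesis
        by (rule dcube_nested[OF x])
    qed
    have small: "emeasure lebesgue (\<Union>b\<in>Ch. dcube b) \<le> ennreal (M / 2)"
    proof -
      have "emeasure (density lebesgue (\<lambda>_. ennreal \<alpha>)) (\<Union>b\<in>Ch. dcube b) \<le> emeasure (density lebesgue (indicator E)) (\<Union>b\<in>Ch. dcube b)"
      proof (rule emeasure_dyadic_union_mono[OF Ch(1)])
        fix b assume "b \<in> Ch"
        from Ch(2)[OF this]
        show "emeasure (density lebesgue (\<lambda>_. ennreal \<alpha>)) (dcube b) \<le> emeasure (density lebesgue (indicator E)) (dcube b)"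
          by (simp add: emeasure_density_const_mult emeasure_density less_imp_le)
      qed simp_all
      also have "\<dots> = (\<integral>\<^sup>+x\<in>(\<Union>b\<in>Ch. dcube b). indicator E x \<partial>lebesgue)"
        by (rule emeasure_density) auto
      also have "\<dots> \<le> (\<integral>\<^sup>+x. indicator E x \<partial>lebesgue)"
        by (rule nn_integral_mono) (auto split: split_indicator)
      also have "\<dots> \<le> ennreal (M / (4 * 2 ^ ?N))"
        using E by simp
      finally have "ennreal \<alpha> * emeasure lebesgue (\<Union>b\<in>Ch. dcube b) \<le> ennreal (M / (4 * 2 ^ ?N))"
        by (simp add: emeasure_density_const_mult)
      then have "emeasure lebesgue (\<Union>b\<in>Ch. dcube b) \<le> ennreal (M / (4 * 2 ^ ?N) / \<alpha>)"
        by (rule emeasure_le_divide[OF _ \<alpha>(1)]) (use M in simp)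
      also have "M / (4 * 2 ^ ?N) / \<alpha> = M / 2"
        by (simp add: \<alpha>_def)
      finally show ?thesis .
    qed
    have loc_int: "integrable lebesgue (localized f b)" for b
      using f by (intro integrable_mult_indicator) auto
    have body: "(\<Sum>k<?d. a k *\<^sub>R e k) \<in> scaled_body C ?Q f" if "\<And>k. k < ?d \<Longrightarrow> \<bar>a k\<bar> \<le> (1 + C0) * A" for a
      unfolding C_def by (rule scaled_body_of_coordinates[OF fQ e that]) auto
    have AE_c: "AE x in lebesgue. vector_extension T (localized f c) x = (\<Sum>k<?d. Te (\<phi> k) x *\<^sub>R e k)"
    proof (rule vector_extension_coordinates[OF loc_int \<phi>])
      show "AE y in lebesgue. localized f c y = (\<Sum>k<?d. \<phi> k y *\<^sub>R e k)"
        using rep'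
      proof eventually_elim
        case (elim y)
        show ?case
          by (cases "y \<in> ?Q") (use elim in \<open>simp_all add: \<phi>_def\<close>)
      qed
    qed
    have AE_b: "AE x in lebesgue. x \<in> dcube b \<longrightarrow>
        vector_extension T (localized f c) x - vector_extension T (localized f b) x \<in> scaled_body C ?Q f"
      if b: "b \<in> Ch" for b
    proof -
      have bc: "tripled b \<subseteq> ?Q"
        by (rule tripled_mono[OF sub[OF b]])
      have cT: "- tripled b \<in> sets lebesgue"
        using sets.compl_sets[OF tripled_lebesgue[of b]] by (simp add: Compl_eq_Diff_UNIV)
      define near where "near k y = \<phi> k y * indicator (tripled b) y" for k y
      define rest where "rest k y = \<phi> k y * indicator (- tripled b) y" for k y
      have near: "integrable lebesgue (near k)" and rest: "integrable lebesgue (rest k)" for k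
        unfolding near_def rest_def by (intro integrable_mult_ind \<phi> tripled_lebesgue cT)+
      have "AE x in lebesgue. vector_extension T (localized f b) x = (\<Sum>k<?d. Te (near k) x *\<^sub>R e k)"
      proof (rule vector_extension_coordinates[OF loc_int near])
        show "AE y in lebesgue. localized f b y = (\<Sum>k<?d. near k y *\<^sub>R e k)"
          using rep'
        proof eventually_elim
          case (elim y)
          show ?case
            by (cases "y \<in> tripled b") (use elim bc in \<open>auto simp: near_def \<phi>_def\<close>)
        qed
      qed
      moreover have "AE x in lebesgue. \<forall>k. Te (\<phi> k) x = Te (near k) x + Te (rest k) x"
        unfolding AE_all_countable
      proof
        fix k
        have "\<phi> k = (\<lambda>y. 1 * near k y + 1 * rest k y)"
          by (auto simp: near_def rest_def split: split_indicator)
        then show "AE x in lebesgue. Te (\<phi> k) x = Te (near k) x + Te (rest k) x"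
          using Te_linear[OF near[of k] rest[of k], of 1 1] by simp
      qed
      moreover have "AE x in lebesgue. \<forall>k. k < ?d \<longrightarrow> x \<in> dcube b \<longrightarrow> \<bar>Te (rest k) x\<bar> \<le> C0 * A"
        unfolding AE_all_countable
      proof
        fix k
        show "AE x in lebesgue. k < ?d \<longrightarrow> x \<in> dcube b \<longrightarrow> \<bar>Te (rest k) x\<bar> \<le> C0 * A"
        proof (cases "k < ?d")
          case True
          have "emeasure lebesgue (dcube b \<inter> bad k) \<le> emeasure lebesgue (dcube b \<inter> E)"
            using sub[OF b] True by (intro emeasure_mono) (auto simp: E_def)
          also have "\<dots> \<le> ennreal (1 / 2) * emeasure lebesgue (dcube b)"
            using Ch(3)[OF b] by (simp only: indE \<alpha>(3))
          also have "\<dots> = ennreal (side b ^ ?N / 2)"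
            unfolding emeasure_dcube by (subst ennreal_mult[symmetric]) (auto simp: less_imp_le)
          finally show ?thesis
            using far[OF \<phi> A, of b k] True by (simp add: bad_def rest_def[abs_def])
        qed simp
      qed
      ultimately show ?thesis
        using AE_c
      proof eventually_elim
        case (elim x)
        show ?case
        proof
          assume x: "x \<in> dcube b"
          have "vector_extension T (localized f c) x - vector_extension T (localized f b) x
              = (\<Sum>k<?d. Te (rest k) x *\<^sub>R e k)"
            using elim by (simp add: scaleR_add_left sum.distrib)
          also have "\<dots> \<in> scaled_body C ?Q f"
          proof (rule body)
            fix k assume "k < ?d"
            then have "\<bar>Te (rest k) x\<bar> \<le> C0 * A"
              using elim x by blast
            then show "\<bar>Te (rest k) x\<bar> \<le> (1 + C0) * A"
              using A by (simp add: distrib_right)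
          qed
          finally show "vector_extension T (localized f c) x - vector_extension T (localized f b) x \<in> scaled_body C ?Q f" .
        qed
      qed
    qed
    have "AE x in lebesgue. \<forall>b. b \<in> Ch \<longrightarrow> x \<in> dcube b \<longrightarrow>
        vector_extension T (localized f c) x - vector_extension T (localized f b) x \<in> scaled_body C ?Q f"
      unfolding AE_all_countable
    proof
      show "AE x in lebesgue. b \<in> Ch \<longrightarrow> x \<in> dcube b \<longrightarrow>
          vector_extension T (localized f c) x - vector_extension T (localized f b) x \<in> scaled_body C ?Q f" for b
        using AE_b by (cases "b \<in> Ch") auto
    qed
    then have "AE x in lebesgue. x \<in> dcube c \<longrightarrow>
          (x \<notin> (\<Union>b\<in>Ch. dcube b) \<longrightarrow>
            vector_extension T (localized f c) x \<in> scaled_body C ?Q f) \<and>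
          (\<forall>b\<in>Ch. x \<in> dcube b \<longrightarrow>
            vector_extension T (localized f c) x - vector_extension T (localized f b) x
              \<in> scaled_body C ?Q f)"
      using AE_c Ch(4)
    proof eventually_elim
      case (elim x)
      have "vector_extension T (localized f c) x \<in> scaled_body C ?Q f"
        if x: "x \<in> dcube c" "x \<notin> (\<Union>b\<in>Ch. dcube b)"
      proof -
        have "x \<notin> E"
        proof
          assume "x \<in> E"
          then have "1 \<le> ennreal \<alpha>"
            using elim(3) x(2) by simp
          then show False
            using \<alpha> by (simp flip: ennreal_1)
        qed
        have "(\<Sum>k<?d. Te (\<phi> k) x *\<^sub>R e k) \<in> scaled_body C ?Q f"
        proof (rule body)
          fix k assume "k < ?d"
          then have "x \<notin> bad k"
            using \<open>x \<notin> E\<close> x(1) by (auto simp: E_def)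
          then have "\<bar>Te (\<phi> k) x\<bar> \<le> A"
            by (simp add: bad_def)
          also have "A \<le> (1 + C0) * A"
            using A C0 by simp
          finally show "\<bar>Te (\<phi> k) x\<bar> \<le> (1 + C0) * A" .
        qed
        then show ?thesis
          by (simp only: elim(2))
      qed
      then show ?case
        using elim(1) by blast
    qed
    then show "\<exists>Ch. disjoint_family_on dcube Ch \<and> (\<forall>b\<in>Ch. dcube b \<subseteq> dcube c) \<and>
        emeasure lebesgue (\<Union>b\<in>Ch. dcube b) \<le> ennreal (side c ^ ?N / 2) \<and>
        (AE x in lebesgue. x \<in> dcube c \<longrightarrow>
          (x \<notin> (\<Union>b\<in>Ch. dcube b) \<longrightarrow>
            vector_extension T (localized f c) x \<in> scaled_body C (tripled c) f) \<and>
          (\<forall>b\<in>Ch. x \<in> dcube b \<longrightarrow>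
            vector_extension T (localized f c) x - vector_extension T (localized f b) x
              \<in> scaled_body C (tripled c) f))"
      using Ch(1) sub small unfolding M_def by blast
  qed
qed

end

section \<open>The stopping tree\<close>

text \<open>The shift keeps the origin at relative distance \<open>1/3\<close> from the boundary of its cube.\<close>

lemma cube_at_origin:
  fixes x :: "real ^ 'n"
  assumes "norm x < 2 powi k / 3"
  shows "cube_at k x = cube_at k 0"
proof -
  have "\<lfloor>x $ i / 2 powi k + shift k\<rfloor> = \<lfloor>shift k\<rfloor>" for i
  proof -
    have p: "0 < (2::real) powi k"
      by simp
    have "\<bar>x $ i\<bar> < 2 powi k / 3"
      using component_le_norm_cart[of x i] assms by linarith
    then have "\<bar>x $ i\<bar> / 2 powi k < 1 / 3"
      using p by (simp add: pos_divide_less_eq)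
    then have t: "\<bar>x $ i / 2 powi k\<bar> < 1 / 3"
      by simp
    obtain t where t_eq: "x $ i / 2 powi k = t"
      by simp
    have "- (1 / 3) < t" "t < 1 / 3"
      using t unfolding t_eq by (simp_all add: abs_less_iff)
    note t = this
    have "\<lfloor>t + shift k\<rfloor> = \<lfloor>shift k\<rfloor>"
    proof (cases "even k")
      case True
      then have "\<lfloor>t + shift k\<rfloor> = 0" "\<lfloor>shift k\<rfloor> = 0"
        using t by (auto simp: shift_def intro!: floor_unique)
      then show ?thesis by simp
    next
      case False
      then have "\<lfloor>t + shift k\<rfloor> = - 1" "\<lfloor>shift k\<rfloor> = - 1"
        using t by (auto simp: shift_def intro!: floor_unique)
      then show ?thesis by simp
    qed
    then show ?thesis
      by (simp only: t_eq)
  qed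
  then show ?thesis
    by (simp add: cube_at_def vec_eq_iff)
qed

lemma parent_subset_tripled: "dcube (cube_at (k + 1) x) \<subseteq> tripled (cube_at k x)"
proof
  fix y assume y: "y \<in> dcube (cube_at (k + 1) x)"
  let ?c = "cube_at k x" and ?p = "cube_at (k + 1) x"
  have side: "side ?p = 2 * side ?c"
    by (simp add: side_def power_int_add)
  have sub: "dcube ?c \<subseteq> dcube ?p"
    by (rule dcube_nested[of x]) simp_all
  show "y \<in> tripled ?c"
    unfolding mem_tripled_bounds
  proof
    fix i
    show "corner ?c $ i - side ?c \<le> y $ i \<and> y $ i \<le> corner ?c $ i + 2 * side ?c"
      using dcube_subset_bounds[OF sub, of i] y[unfolded mem_dcube_bounds, rule_format, of i] side
      by linarith
  qed
qed

text \<open>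
  Every point is put into the smallest cube through it, among those of side at least \<open>1\<close>, whose
  parent contains the ball: the triple of a cube contains its parent.
\<close>

lemma partition_with_large_triples:
  fixes B :: real
  obtains R :: "'n::finite dyadic set" where "disjoint_family_on dcube R"
    "(\<Union>c\<in>R. dcube c) = UNIV" "\<And>c. c \<in> R \<Longrightarrow> cball 0 B \<subseteq> tripled c"
proof -
  define P where "P n x \<longleftrightarrow> cball 0 B \<subseteq> dcube (cube_at (int n + 1) x)" for n and x :: "real ^ 'n"
  have "\<exists>n. P n x" for x
  proof -
    obtain n :: nat where n: "3 * max (norm x) B < 2 ^ n"
      using real_arch_pow[of 2 "3 * max (norm x) B"] by auto
    have "(2::real) powi (int n + 1) = 2 * 2 ^ n"
      by (simp add: power_int_add)
    moreover have "(0::real) < 2 ^ n"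
      by simp
    ultimately have big: "max (norm x) B < 2 powi (int n + 1) / 3"
      using n by linarith
    have near: "cube_at (int n + 1) z = cube_at (int n + 1) 0" if "norm z \<le> max (norm x) B" for z :: "real ^ 'n"
      using that big by (intro cube_at_origin) linarith
    have "P n x"
      unfolding P_def
    proof
      fix z :: "real ^ 'n" assume "z \<in> cball 0 B"
      then show "z \<in> dcube (cube_at (int n + 1) x)"
        using near[of z] near[of x] by (simp add: mem_dcube_iff le_max_iff_disj)
    qed
    then show ?thesis ..
  qed
  define m where "m x = (LEAST n. P n x)" for x
  have m: "P (m x) x" for x
    unfolding m_def by (rule LeastI_ex) fact
  have m_le: "m x \<le> n" if "P n x" for n x
    unfolding m_def using that by (rule Least_le)
  have m_eq: "m w = m x" if w: "w \<in> dcube (cube_at (int (m x)) x)" for w x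
  proof -
    have eq: "cube_at (int (m x)) w = cube_at (int (m x)) x"
      using w by (simp add: mem_dcube_iff)
    then have "cube_at (int (m x) + 1) w = cube_at (int (m x) + 1) x"
      by (rule cube_at_coarser) simp
    then have "P (m x) w"
      using m[of x] by (simp add: P_def)
    then have le: "m w \<le> m x"
      by (rule m_le)
    show ?thesis
    proof (rule ccontr)
      assume "m w \<noteq> m x"
      then obtain j where j: "m x = Suc j" "m w \<le> j"
        using le by (cases "m x") auto
      have "dcube (cube_at (int (m w) + 1) w) \<subseteq> dcube (cube_at (int j + 1) w)"
        using j by (intro dcube_nested[of w]) auto
      also have "cube_at (int j + 1) w = cube_at (int j + 1) x"
        using eq j(1) by (simp add: add.commute)
      finally have "P j x"
        using m[of w] by (auto simp: P_def)
      then show False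
        using m_le[of j x] j(1) by simp
    qed
  qed
  show thesis
  proof (rule that[of "range (\<lambda>x. cube_at (int (m x)) x)"])
    show "disjoint_family_on dcube (range (\<lambda>x. cube_at (int (m x)) x))"
      unfolding disjoint_family_on_def
    proof (intro ballI impI equals0I)
      fix b c w assume "b \<in> range (\<lambda>x. cube_at (int (m x)) x)" "c \<in> range (\<lambda>x. cube_at (int (m x)) x)"
        and ne: "b \<noteq> c" and w: "w \<in> dcube b \<inter> dcube c"
      then obtain x y where xy: "b = cube_at (int (m x)) x" "c = cube_at (int (m y)) y"
        by blast
      then have "m w = m x" "m w = m y"
        using w by (auto intro: m_eq)
      then have "b = c"
        using w xy by (intro dcube_same_scale[of w]) auto
      with ne show False ..
    qed
    show "(\<Union>c\<in>range (\<lambda>x. cube_at (int (m x)) x). dcube c) = UNIV"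
      using mem_dcube_at by blast
    show "cball 0 B \<subseteq> tripled c" if "c \<in> range (\<lambda>x. cube_at (int (m x)) x)" for c
      using that m parent_subset_tripled unfolding P_def by blast
  qed
qed

primrec level :: "('n::finite dyadic \<Rightarrow> 'n dyadic set) \<Rightarrow> 'n dyadic set \<Rightarrow> nat \<Rightarrow> 'n dyadic set" where
  "level Ch R 0 = R"
| "level Ch R (Suc n) = (\<Union>c\<in>level Ch R n. Ch c)"

locale stopping_tree =
  fixes Ch :: "'n::finite dyadic \<Rightarrow> 'n dyadic set" and R :: "'n dyadic set"
  assumes roots_disjoint: "disjoint_family_on dcube R"
    and roots_cover: "(\<Union>c\<in>R. dcube c) = UNIV"
    and children_disjoint: "disjoint_family_on dcube (Ch c)"
    and child_subset: "b \<in> Ch c \<Longrightarrow> dcube b \<subseteq> dcube c"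
    and children_small: "emeasure lebesgue (\<Union>b\<in>Ch c. dcube b) \<le> ennreal (side c ^ CARD('n) / 2)"
begin

abbreviation lev :: "nat \<Rightarrow> 'n dyadic set" where "lev \<equiv> level Ch R"

definition U :: "nat \<Rightarrow> (real ^ 'n) set" where "U n = (\<Union>c\<in>lev n. dcube c)"

lemma U_lebesgue [measurable]: "U n \<in> sets lebesgue"
  by (simp add: U_def)

lemma level_disjoint: "disjoint_family_on dcube (lev n)"
proof (induction n)
  case 0
  then show ?case by (simp add: roots_disjoint)
next
  case (Suc n)
  show ?case
    unfolding disjoint_family_on_def
  proof (intro ballI impI equals0I)
    fix b b' x assume "b \<in> lev (Suc n)" "b' \<in> lev (Suc n)" and ne: "b \<noteq> b'" and x: "x \<in> dcube b \<inter> dcube b'"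
    then obtain c c' where c: "c \<in> lev n" "b \<in> Ch c" "c' \<in> lev n" "b' \<in> Ch c'"
      by auto
    then have "x \<in> dcube c \<inter> dcube c'"
      using x child_subset by blast
    then have "c = c'"
      using Suc c unfolding disjoint_family_on_def by blast
    then show False
      using c ne x children_disjoint[of c] unfolding disjoint_family_on_def by blast
  qed
qed

lemma level_unique: "b \<in> lev n \<Longrightarrow> c \<in> lev n \<Longrightarrow> x \<in> dcube b \<Longrightarrow> x \<in> dcube c \<Longrightarrow> b = c"
  using level_disjoint[of n] unfolding disjoint_family_on_def by blast

lemma child_of_ancestor:
  assumes "b \<in> lev (Suc n)" "x \<in> dcube b" "c \<in> lev n" "x \<in> dcube c"
  shows "b \<in> Ch c"
proof -
  obtain c' where c': "c' \<in> lev n" "b \<in> Ch c'"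
    using assms(1) by auto
  then have "x \<in> dcube c'"
    using assms(2) child_subset by blast
  then have "c' = c"
    using c' assms level_unique by blast
  then show ?thesis
    using c' by simp
qed

lemma U_Suc_subset: "U (Suc n) \<subseteq> U n"
  using child_subset by (fastforce simp: U_def)

lemma U_antimono: "m \<le> n \<Longrightarrow> U n \<subseteq> U m"
  by (rule lift_Suc_antimono_le[of U]) (rule U_Suc_subset)

lemma U_Suc_inter: "c \<in> lev n \<Longrightarrow> dcube c \<inter> U (Suc n) = (\<Union>b\<in>Ch c. dcube b)"
  using child_of_ancestor[of _ n _ c] child_subset[of _ c] unfolding U_def level.simps by blast

lemma level_inside_root: "c \<in> lev n \<Longrightarrow> r \<in> R \<Longrightarrow> x \<in> dcube c \<Longrightarrow> x \<in> dcube r \<Longrightarrow> dcube c \<subseteq> dcube r"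
proof (induction n arbitrary: c)
  case 0
  then show ?case
    using level_unique[of c 0 r x] by simp
next
  case (Suc n)
  then obtain p where p: "p \<in> lev n" "c \<in> Ch p"
    by auto
  then have "dcube c \<subseteq> dcube p" "dcube p \<subseteq> dcube r"
    using child_subset[of c p] Suc by blast+
  then show ?case by blast
qed

text \<open>The cubes of one level are disjoint, and the children of each fill at most half of it.\<close>

lemma root_inter_U_halves:
  assumes r: "r \<in> R"
  shows "emeasure lebesgue (dcube r \<inter> U (Suc n)) \<le> ennreal (1 / 2) * emeasure lebesgue (dcube r \<inter> U n)"
proof -
  let ?M = "density lebesgue (indicator (dcube r \<inter> U (Suc n)))"
  let ?M' = "density lebesgue (\<lambda>x. ennreal (1 / 2) * indicator (dcube r) x)"
  have M: "emeasure ?M X = emeasure lebesgue (X \<inter> (dcube r \<inter> U (Suc n)))" if "X \<in> sets lebesgue" for X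
  proof -
    have "emeasure ?M X = (\<integral>\<^sup>+x\<in>X. indicator (dcube r \<inter> U (Suc n)) x \<partial>lebesgue)"
      using that by (intro emeasure_density) auto
    also have "\<dots> = (\<integral>\<^sup>+x. indicator (X \<inter> (dcube r \<inter> U (Suc n))) x \<partial>lebesgue)"
      by (intro nn_integral_cong) (auto split: split_indicator)
    also have "\<dots> = emeasure lebesgue (X \<inter> (dcube r \<inter> U (Suc n)))"
      using that by (intro nn_integral_indicator) auto
    finally show ?thesis .
  qed
  have M': "emeasure ?M' X = ennreal (1 / 2) * emeasure lebesgue (X \<inter> dcube r)" if "X \<in> sets lebesgue" for X
  proof -
    have "emeasure ?M' X = (\<integral>\<^sup>+x\<in>X. ennreal (1 / 2) * indicator (dcube r) x \<partial>lebesgue)"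
      using that by (intro emeasure_density) auto
    also have "\<dots> = (\<integral>\<^sup>+x. ennreal (1 / 2) * indicator (X \<inter> dcube r) x \<partial>lebesgue)"
      by (intro nn_integral_cong) (auto split: split_indicator)
    also have "\<dots> = ennreal (1 / 2) * emeasure lebesgue (X \<inter> dcube r)"
      using that by (intro nn_integral_cmult_indicator) auto
    finally show ?thesis .
  qed
  have "dcube r \<inter> U (Suc n) = U n \<inter> (dcube r \<inter> U (Suc n))"
    using U_Suc_subset by blast
  then have "emeasure lebesgue (dcube r \<inter> U (Suc n)) = emeasure ?M (\<Union>c\<in>lev n. dcube c)"
    by (subst M) (auto simp: U_def[of n, symmetric])
  also have "\<dots> \<le> emeasure ?M' (\<Union>c\<in>lev n. dcube c)"
  proof (rule emeasure_dyadic_union_mono[OF level_disjoint])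
    fix c assume c: "c \<in> lev n"
    show "emeasure ?M (dcube c) \<le> emeasure ?M' (dcube c)"
    proof (cases "dcube c \<inter> dcube r = {}")
      case True
      then have "dcube c \<inter> (dcube r \<inter> U (Suc n)) = {}"
        by blast
      then show ?thesis
        by (simp add: M)
    next
      case False
      then have sub: "dcube c \<subseteq> dcube r"
        using level_inside_root[OF c r] by blast
      then have "dcube c \<inter> (dcube r \<inter> U (Suc n)) = (\<Union>b\<in>Ch c. dcube b)"
        using U_Suc_inter[OF c] by blast
      moreover have "dcube c \<inter> dcube r = dcube c"
        using sub by blast
      moreover have "ennreal (side c ^ CARD('n) / 2) = ennreal (1 / 2) * emeasure lebesgue (dcube c)"
        unfolding emeasure_dcube by (subst ennreal_mult[symmetric]) (auto simp: less_imp_le)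
      ultimately show ?thesis
        using children_small[of c] by (simp only: M M' dcube_lebesgue)
    qed
  qed simp_all
  also have "\<dots> = ennreal (1 / 2) * emeasure lebesgue (dcube r \<inter> U n)"
    by (subst M') (auto simp: U_def[symmetric] Int_commute)
  finally show ?thesis .
qed

lemma AE_finitely_many_levels: "AE x in lebesgue. \<exists>n. x \<notin> U n"
proof -
  have "AE x in lebesgue. r \<in> R \<longrightarrow> x \<in> dcube r \<longrightarrow> (\<exists>n. x \<notin> U n)" for r
  proof (cases "r \<in> R")
    case r: True
    have le: "emeasure lebesgue (dcube r \<inter> U n) \<le> ennreal ((1/2) ^ n * side r ^ CARD('n))" for n
    proof (induction n)
      case 0
      have "emeasure lebesgue (dcube r \<inter> U 0) \<le> emeasure lebesgue (dcube r)"
        by (intro emeasure_mono) auto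
      then show ?case
        unfolding emeasure_dcube by simp
    next
      case (Suc n)
      have "emeasure lebesgue (dcube r \<inter> U (Suc n)) \<le> ennreal (1 / 2) * ennreal ((1/2) ^ n * side r ^ CARD('n))"
        by (rule order_trans[OF root_inter_U_halves[OF r] mult_left_mono[OF Suc]]) simp
      also have "\<dots> = ennreal ((1/2) ^ Suc n * side r ^ CARD('n))"
        by (subst ennreal_mult[symmetric]) (auto simp: less_imp_le)
      finally show ?case .
    qed
    have "(\<lambda>n. ennreal ((1/2) ^ n * side r ^ CARD('n))) \<longlonglongrightarrow> ennreal (0 * side r ^ CARD('n))"
      by (intro tendsto_ennrealI tendsto_mult tendsto_const LIMSEQ_power_zero) simp
    then have lim: "(\<lambda>n. ennreal ((1/2) ^ n * side r ^ CARD('n))) \<longlonglongrightarrow> 0"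
      by simp
    have "emeasure lebesgue (dcube r \<inter> (\<Inter>n. U n)) \<le> 0"
    proof (rule LIMSEQ_le_const[OF lim], intro exI allI impI)
      fix n :: nat
      have "emeasure lebesgue (dcube r \<inter> (\<Inter>n. U n)) \<le> emeasure lebesgue (dcube r \<inter> U n)"
        by (intro emeasure_mono) auto
      then show "emeasure lebesgue (dcube r \<inter> (\<Inter>n. U n)) \<le> ennreal ((1/2) ^ n * side r ^ CARD('n))"
        using le[of n] by (rule order_trans)
    qed
    moreover have "dcube r \<inter> (\<Inter>n. U n) \<in> sets lebesgue"
      by measurable
    ultimately have "dcube r \<inter> (\<Inter>n. U n) \<in> null_sets lebesgue"
      by (simp add: null_sets_def)
    from AE_not_in[OF this] show ?thesis
      by eventually_elim auto
  qed simp
  then have "AE x in lebesgue. \<forall>r. r \<in> R \<longrightarrow> x \<in> dcube r \<longrightarrow> (\<exists>n. x \<notin> U n)"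
    unfolding AE_all_countable by blast
  then show ?thesis
    by eventually_elim (use roots_cover in blast)
qed

lemma child_smaller: "b \<in> Ch c \<Longrightarrow> fst b < fst c"
proof (rule ccontr)
  assume b: "b \<in> Ch c" and "\<not> fst b < fst c"
  then have "side c \<le> side b"
    unfolding side_def by (intro power_int_increasing) auto
  then have "side c ^ CARD('n) \<le> side b ^ CARD('n)"
    by (intro power_mono) (auto simp: less_imp_le)
  have "ennreal (side b ^ CARD('n)) \<le> ennreal (side c ^ CARD('n) / 2)"
    unfolding emeasure_dcube[symmetric]
    by (rule order_trans[OF emeasure_mono children_small]) (use b in auto)
  then have "side b ^ CARD('n) \<le> side c ^ CARD('n) / 2"
    by (subst (asm) ennreal_le_iff) (auto simp: less_imp_le)
  moreover have "0 < side c ^ CARD('n)"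
    by simp
  ultimately show False
    using \<open>side c ^ CARD('n) \<le> side b ^ CARD('n)\<close> by linarith
qed

lemma chain_through_point:
  assumes "x \<notin> U n"
  obtains m c where "\<And>i. i \<le> m \<Longrightarrow> c i \<in> lev i" "\<And>i. i \<le> m \<Longrightarrow> x \<in> dcube (c i)"
    "\<And>i. i < m \<Longrightarrow> c (Suc i) \<in> Ch (c i)" "x \<notin> (\<Union>b\<in>Ch (c m). dcube b)"
proof -
  define k where "k = (LEAST n. x \<notin> U n)"
  have k: "x \<notin> U k"
    unfolding k_def by (rule LeastI) fact
  have "x \<in> U 0"
    using roots_cover by (simp add: U_def)
  then obtain m where m: "k = Suc m"
    using k by (cases k) auto
  have "x \<in> U i" if "i \<le> m" for i
    using not_less_Least[of i "\<lambda>n. x \<notin> U n"] that m by (auto simp: k_def)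
  then have "\<forall>i. \<exists>c. i \<le> m \<longrightarrow> c \<in> lev i \<and> x \<in> dcube c"
    unfolding U_def by blast
  then obtain c where c: "\<And>i. i \<le> m \<Longrightarrow> c i \<in> lev i \<and> x \<in> dcube (c i)"
    by metis
  show thesis
  proof (rule that[of m c])
    show "c (Suc i) \<in> Ch (c i)" if "i < m" for i
      using that c[of i] c[of "Suc i"] by (intro child_of_ancestor[of _ i x]) auto
    show "x \<notin> (\<Union>b\<in>Ch (c m). dcube b)"
      using c[of m] k m U_Suc_inter[of "c m" m] by blast
  qed (use c in auto)
qed

text \<open>
  The part of a cube outside its children is at least half of the cube, hence the fraction
  \<open>3 ^ -N / 2\<close> of its triple, and these parts are disjoint.
\<close>

lemma tripled_tree_sparse: "weakly_sparse ((1/3) ^ CARD('n) / 2) (tripled ` (\<Union>n. lev n))"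
proof -
  let ?F = "\<Union>n. lev n"
  have inj: "inj (tripled :: 'n dyadic \<Rightarrow> (real ^ 'n) set)"
    by (auto simp: inj_def tripled_inject)
  define E where "E c = dcube c - (\<Union>b\<in>Ch c. dcube b)" for c
  have E_disj: "E b \<inter> E c = {}" if "b \<in> lev m" "c \<in> lev n" "b \<noteq> c" "m \<le> n" for b c m n
  proof (rule equals0I)
    fix x assume x: "x \<in> E b \<inter> E c"
    then have xb: "x \<in> dcube b" "x \<notin> (\<Union>b\<in>Ch b. dcube b)" "x \<in> dcube c"
      by (auto simp: E_def)
    show False
    proof (cases "m = n")
      case True
      then show ?thesis
        using level_unique[of b n c x] that xb by simp
    next
      case False
      have "x \<in> U n"
        using that(2) xb(3) unfolding U_def by blast
      then have "x \<in> U (Suc m)"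
        using U_antimono[of "Suc m" n] that(4) False by auto
      then show ?thesis
        using U_Suc_inter[OF that(1)] xb by blast
    qed
  qed
  have E_meas: "side c ^ CARD('n) / 2 \<le> measure lebesgue (E c)" for c
  proof -
    let ?V = "\<Union>b\<in>Ch c. dcube b"
    have V: "?V \<in> lmeasurable"
      using children_small[of c] by (auto simp: fmeasurable_def less_top[symmetric] top_unique)
    have "measure lebesgue ?V \<le> side c ^ CARD('n) / 2"
      using children_small[of c] unfolding measure_def by (intro enn2real_leI) (auto simp: less_imp_le)
    moreover have "measure lebesgue (E c) = measure lebesgue (dcube c) - measure lebesgue ?V"
      unfolding E_def
    proof (rule measure_Diff)
      show "(\<Union>b\<in>Ch c. dcube b) \<subseteq> dcube c"
        using child_subset[of _ c] by blast
    qed (use V in \<open>auto simp: emeasure_dcube\<close>)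
    ultimately show ?thesis
      by (simp add: measure_dcube)
  qed
  have small: "(1/3::real) ^ CARD('n) / 2 < 1"
    using power_le_one[of "1/3::real" "CARD('n)"] by simp
  show ?thesis
    unfolding weakly_sparse_def
  proof (intro conjI exI[of _ "\<lambda>Q. E (inv tripled Q)"] ballI small)
    show "is_cube Q" if "Q \<in> tripled ` ?F" for Q
      using that is_cube_tripled by blast
    show "disjoint_family_on (\<lambda>Q. E (inv tripled Q)) (tripled ` ?F)"
      unfolding disjoint_family_on_def
    proof (intro ballI impI)
      fix P Q assume "P \<in> tripled ` ?F" "Q \<in> tripled ` ?F" "P \<noteq> Q"
      then obtain b c m n where bc: "P = tripled b" "Q = tripled c" "b \<in> lev m" "c \<in> lev n" "b \<noteq> c"
        by blast
      then have "E b \<inter> E c = {}"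
        using E_disj[of b m c n] E_disj[of c n b m] by (cases "m \<le> n") auto
      then show "E (inv tripled P) \<inter> E (inv tripled Q) = {}"
        using bc inj by simp
    qed
    fix Q assume "Q \<in> tripled ` ?F"
    then obtain c where Q: "Q = tripled c"
      by blast
    then have inv: "inv tripled Q = c"
      using inj by simp
    show "E (inv tripled Q) \<in> sets lebesgue"
      unfolding inv E_def by (intro sets.Diff dcube_lebesgue dyadic_union_lebesgue)
    show "E (inv tripled Q) \<subseteq> Q"
      unfolding inv unfolding E_def Q using dcube_subset_tripled[of c] by blast
    have "(1/3) ^ CARD('n) / 2 * measure lebesgue Q = side c ^ CARD('n) / 2"
    proof -
      have "(1/3) ^ CARD('n) * (3 * side c) ^ CARD('n) = side c ^ CARD('n)"
        unfolding power_mult_distrib[symmetric] by simp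
      then show ?thesis
        by (simp only: Q measure_tripled times_divide_eq_left)
    qed
    then show "(1/3) ^ CARD('n) / 2 * measure lebesgue Q \<le> measure lebesgue (E (inv tripled Q))"
      unfolding inv using E_meas[of c] by simp
  qed simp
qed

end

section \<open>Sparse domination\<close>

lemma AE_zero_outside_ess_support:
  fixes f :: "real ^ 'n \<Rightarrow> 'b::zero"
  shows "AE x in lebesgue. x \<notin> ess_support f \<longrightarrow> f x = 0"
proof -
  let ?F = "{U. open U \<and> (AE x in lebesgue. x \<in> U \<longrightarrow> f x = 0)}"
  obtain F where F: "F \<subseteq> ?F" "countable F" "\<Union>F = \<Union>?F"
    using Lindelof[of ?F] by blast
  have "AE x in lebesgue. \<forall>U\<in>F. x \<in> U \<longrightarrow> f x = 0"
    using F by (intro AE_ball_countable') auto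
  then show ?thesis
    by eventually_elim (use F(3) in \<open>auto simp: ess_support_def\<close>)
qed

lemma sparse_operatorI:
  fixes w :: "nat \<Rightarrow> real ^ 'd" and f :: "real ^ 'n \<Rightarrow> real ^ 'd"
  assumes Q: "\<And>i. i \<le> m \<Longrightarrow> Q i \<in> S" "\<And>i. i \<le> m \<Longrightarrow> x \<in> Q i" "inj_on Q {..m}"
    and w: "\<And>i. i \<le> m \<Longrightarrow> w i \<in> convex_body_average (Q i) f"
  shows "(\<Sum>i\<le>m. w i) \<in> sparse_operator S f x"
proof -
  define v where "v P = (if P \<in> Q ` {..m} then w (inv_into {..m} Q P) else 0)" for P
  have vQ: "v (Q i) = w i" if "i \<le> m" for i
    using that Q(3) by (simp add: v_def)
  have "v P \<in> convex_body_average P f" for P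
  proof (cases "P \<in> Q ` {..m}")
    case True
    then show ?thesis
      using vQ w by auto
  next
    case False
    have "0 \<in> convex_body_average P f"
      using zero_in_scaled_body[of 1 P f] by (simp add: scaled_body_def convex_body_average_def)
    then show ?thesis
      using False by (simp add: v_def)
  qed
  moreover have fin: "(g has_sum (\<Sum>P\<in>Q ` {..m}. g P)) {P \<in> S. x \<in> P}"
    if "\<And>P. P \<notin> Q ` {..m} \<Longrightarrow> g P = 0" for g :: "(real ^ 'n) set \<Rightarrow> 'e::real_normed_vector"
  proof -
    have "(g has_sum (\<Sum>P\<in>Q ` {..m}. g P)) (Q ` {..m})"
      by (rule has_sum_finite) simp
    then show ?thesis
      by (rule has_sum_cong_neutral[THEN iffD1, rotated -1]) (use Q that in auto)
  qed
  have "(v has_sum (\<Sum>P\<in>Q ` {..m}. v P)) {P \<in> S. x \<in> P}"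
    by (rule fin) (simp add: v_def)
  moreover have "(\<Sum>P\<in>Q ` {..m}. v P) = (\<Sum>i\<le>m. w i)"
    using vQ by (subst sum.reindex[OF Q(3)]) (auto intro!: sum.cong)
  moreover have "(\<lambda>P. norm (v P)) summable_on {P \<in> S. x \<in> P}"
    using fin[of "\<lambda>P. norm (v P)"] by (auto simp: v_def summable_on_def)
  ultimately show ?thesis
    unfolding sparse_operator_def by auto
qed

context calderon_zygmund
begin

text \<open>
  Almost every point lies in only finitely many cubes of the tree.  Along the chain of these cubes
  the value of the operator telescopes into differences, each of which is controlled by the body
  of the larger cube.
\<close>

theorem convex_body_domination:
  obtains C where "0 < C"
    "\<And>f :: real ^ 'n \<Rightarrow> real ^ 'd. integrable lebesgue f \<Longrightarrow> compact (ess_support f) \<Longrightarrow>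
      \<exists>S. weakly_sparse ((1/3) ^ CARD('n) / 2) S \<and>
        (AE x in lebesgue. vector_extension T f x \<in> (\<lambda>v. C *\<^sub>R v) ` sparse_operator S f x)"
proof -
  obtain C where C: "0 < C" and step:
    "\<And>(f :: real ^ 'n \<Rightarrow> real ^ 'd) c. integrable lebesgue f \<Longrightarrow>
      \<exists>Ch. disjoint_family_on dcube Ch \<and> (\<forall>b\<in>Ch. dcube b \<subseteq> dcube c) \<and>
        emeasure lebesgue (\<Union>b\<in>Ch. dcube b) \<le> ennreal (side c ^ CARD('n) / 2) \<and>
        (AE x in lebesgue. x \<in> dcube c \<longrightarrow>
          (x \<notin> (\<Union>b\<in>Ch. dcube b) \<longrightarrow>
            vector_extension T (localized f c) x \<in> scaled_body C (tripled c) f) \<and>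
          (\<forall>b\<in>Ch. x \<in> dcube b \<longrightarrow>
            vector_extension T (localized f c) x - vector_extension T (localized f b) x
              \<in> scaled_body C (tripled c) f))"
    using stopping_children by blast
  show thesis
  proof (rule that[OF C])
    fix f :: "real ^ 'n \<Rightarrow> real ^ 'd"
    assume f: "integrable lebesgue f" and supp: "compact (ess_support f)"
    define V where "V c = vector_extension T (localized f c)" for c
    define ok where "ok c X \<longleftrightarrow> disjoint_family_on dcube X \<and> (\<forall>b\<in>X. dcube b \<subseteq> dcube c) \<and>
        emeasure lebesgue (\<Union>b\<in>X. dcube b) \<le> ennreal (side c ^ CARD('n) / 2) \<and>
        (AE x in lebesgue. x \<in> dcube c \<longrightarrow>
          (x \<notin> (\<Union>b\<in>X. dcube b) \<longrightarrow> V c x \<in> scaled_body C (tripled c) f) \<and>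
          (\<forall>b\<in>X. x \<in> dcube b \<longrightarrow> V c x - V b x \<in> scaled_body C (tripled c) f))" for c X
    have "\<exists>X. ok c X" for c
      unfolding ok_def V_def by (rule step[OF f])
    then have "\<forall>c. \<exists>X. ok c X"
      by (rule allI)
    from choice[OF this] obtain Ch where ok: "\<forall>c. ok c (Ch c)"
      by blast
    note ok' = spec[OF ok, unfolded ok_def]
    note Ch = conjunct1[OF ok'] bspec[OF conjunct1[OF conjunct2[OF ok']]]
      conjunct1[OF conjunct2[OF conjunct2[OF ok']]]
    note dom = conjunct2[OF conjunct2[OF conjunct2[OF ok']]]
    obtain B where "\<forall>x\<in>ess_support f. norm x \<le> B"
      using compact_imp_bounded[OF supp] unfolding bounded_iff by (elim exE)
    then have B: "ess_support f \<subseteq> cball 0 B"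
      by auto
    obtain R :: "'n dyadic set" where R: "disjoint_family_on dcube R" "(\<Union>c\<in>R. dcube c) = UNIV"
      "\<And>c. c \<in> R \<Longrightarrow> cball 0 B \<subseteq> tripled c"
    proof (rule partition_with_large_triples[of B])
    qed (rule that)
    interpret stopping_tree Ch R
    proof
      show "disjoint_family_on dcube R" "(\<Union>c\<in>R. dcube c) = UNIV"
        by (fact R)+
      show "disjoint_family_on dcube (Ch c)" for c
        by (fact Ch)
      show "dcube b \<subseteq> dcube c" if "b \<in> Ch c" for b c
        using that by (rule Ch)
      show "emeasure lebesgue (\<Union>b\<in>Ch c. dcube b) \<le> ennreal (side c ^ CARD('n) / 2)" for c
        by (fact Ch)
    qed
    have root: "AE x in lebesgue. \<forall>r. r \<in> R \<longrightarrow> vector_extension T f x = V r x"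
      unfolding AE_all_countable
    proof
      fix r
      show "AE x in lebesgue. r \<in> R \<longrightarrow> vector_extension T f x = V r x"
      proof (cases "r \<in> R")
        case True
        have "AE x in lebesgue. vector_extension T f x = V r x"
          unfolding V_def
        proof (rule vector_extension_cong[OF f])
          show "integrable lebesgue (localized f r)"
            using f by (intro integrable_mult_indicator) auto
          show "AE x in lebesgue. f x = localized f r x"
            using AE_zero_outside_ess_support[of f]
          proof eventually_elim
            case (elim x)
            then show ?case
              using B R(3)[OF True] by (cases "x \<in> tripled r") auto
          qed
        qed
        then show ?thesis by simp
      qed simp
    qed
    have dom': "AE x in lebesgue. \<forall>c. x \<in> dcube c \<longrightarrow>
          (x \<notin> (\<Union>b\<in>Ch c. dcube b) \<longrightarrow> V c x \<in> scaled_body C (tripled c) f) \<and>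
          (\<forall>b\<in>Ch c. x \<in> dcube b \<longrightarrow> V c x - V b x \<in> scaled_body C (tripled c) f)"
      unfolding AE_all_countable by (rule allI, rule dom)
    have "AE x in lebesgue. vector_extension T f x \<in> (\<lambda>v. C *\<^sub>R v) ` sparse_operator (tripled ` (\<Union>n. lev n)) f x"
      using AE_finitely_many_levels root dom'
    proof eventually_elim
      case (elim x)
      from elim(1) obtain n where "x \<notin> U n" by blast
      then obtain m c where c: "\<And>i. i \<le> m \<Longrightarrow> c i \<in> lev i" "\<And>i. i \<le> m \<Longrightarrow> x \<in> dcube (c i)"
        "\<And>i. i < m \<Longrightarrow> c (Suc i) \<in> Ch (c i)" "x \<notin> (\<Union>b\<in>Ch (c m). dcube b)"
      proof (rule chain_through_point)
      qed (rule that)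
      define u where "u i = (if i < m then V (c i) x - V (c (Suc i)) x else V (c i) x)" for i
      have "u i \<in> scaled_body C (tripled (c i)) f" if i: "i \<le> m" for i
      proof (cases "i < m")
        case True
        then show ?thesis
          using elim(3)[rule_format, of "c i"] c(2)[of i] c(2)[of "Suc i"] c(3)[of i] by (auto simp: u_def)
      next
        case False
        then have "i = m"
          using i by simp
        then show ?thesis
          using elim(3)[rule_format, of "c m"] c(2)[of m] c(4) by (auto simp: u_def)
      qed
      then have "\<forall>i. \<exists>w. i \<le> m \<longrightarrow> w \<in> convex_body_average (tripled (c i)) f \<and> u i = C *\<^sub>R w"
        by (blast elim: scaled_body_eq_image[OF C])
      then obtain w where w: "\<And>i. i \<le> m \<Longrightarrow> w i \<in> convex_body_average (tripled (c i)) f \<and> u i = C *\<^sub>R w i"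
        by metis
      have decr: "fst (c j) < fst (c i)" if "i < j" "j \<le> m" for i j
        using that
      proof (induction j)
        case (Suc j)
        then have "fst (c (Suc j)) < fst (c j)"
          by (intro child_smaller c(3)) simp
        moreover have "i = j \<or> fst (c j) < fst (c i)"
          using Suc.IH Suc.prems by (cases "i = j") simp_all
        ultimately show ?case
          by auto
      qed simp
      have inj: "inj_on (\<lambda>i. tripled (c i)) {..m}"
      proof (rule inj_onI)
        fix i j assume "i \<in> {..m}" "j \<in> {..m}" "tripled (c i) = tripled (c j)"
        then have "c i = c j" "i \<le> m" "j \<le> m"
          by (auto simp: tripled_inject)
        then show "i = j"
          using decr[of i j] decr[of j i] by (cases i j rule: linorder_cases) auto
      qed
      have "vector_extension T f x = V (c 0) x"
        using elim(2)[rule_format, of "c 0"] c(1)[of 0] by simp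
      also have "\<dots> = (\<Sum>i<m. V (c i) x - V (c (Suc i)) x) + V (c m) x"
        using sum_lessThan_telescope'[of "\<lambda>i. V (c i) x" m] by simp
      also have "\<dots> = (\<Sum>i\<le>m. u i)"
        by (simp add: u_def lessThan_Suc_atMost[symmetric])
      also have "\<dots> = C *\<^sub>R (\<Sum>i\<le>m. w i)"
        using w by (simp add: scaleR_sum_right)
      finally have eq: "vector_extension T f x = C *\<^sub>R (\<Sum>i\<le>m. w i)" .
      have "(\<Sum>i\<le>m. w i) \<in> sparse_operator (tripled ` (\<Union>n. lev n)) f x"
      proof (rule sparse_operatorI[where Q = "\<lambda>i. tripled (c i)"])
        show "tripled (c i) \<in> tripled ` (\<Union>n. lev n)" if "i \<le> m" for i
          using c(1)[OF that] by blast
        show "x \<in> tripled (c i)" if "i \<le> m" for i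
          using c(2)[OF that] dcube_subset_tripled[of "c i"] by blast
      qed (use w inj in auto)
      then show ?case
        unfolding eq by blast
    qed
    then show "\<exists>S. weakly_sparse ((1/3) ^ CARD('n) / 2) S \<and>
        (AE x in lebesgue. vector_extension T f x \<in> (\<lambda>v. C *\<^sub>R v) ` sparse_operator S f x)"
      using tripled_tree_sparse by blast
  qed
qed

end

text \<open>On \<open>(2 ^ -(k + 1), 2 ^ -k]\<close> the integrand is at least \<open>2 ^ k * \<omega> (2 ^ -(k + 1))\<close>.\<close>

lemma dini_summable:
  assumes \<omega>: "modulus_of_continuity \<omega>" and dini: "dini \<omega>"
  shows "summable (\<lambda>k. \<omega> ((1/2) ^ k))"
proof -
  have mono: "\<omega> s \<le> \<omega> t" if "0 \<le> s" "s \<le> t" for s t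
    using \<omega> that by (auto simp: modulus_of_continuity_def intro: mono_onD)
  have nn: "0 \<le> \<omega> t" if "0 \<le> t" for t
    using mono[of 0 t] \<omega> that by (simp add: modulus_of_continuity_def)
  have int: "set_integrable lborel {0<..1} (\<lambda>x. \<omega> x / x)"
    using dini by (simp add: dini_def)
  define I where "I a b = (LINT x:{a<..b}|lborel. \<omega> x / x)" for a b :: real
  have sub: "set_integrable lborel {a<..b} (\<lambda>x. \<omega> x / x)" if "0 \<le> a" "b \<le> 1" for a b
    by (rule set_integrable_subset[OF int]) (use that in auto)
  have le: "\<omega> ((1/2) ^ Suc k) / 2 \<le> I ((1/2) ^ Suc k) ((1/2) ^ k)" for k
  proof -
    let ?a = "(1/2) ^ Suc k :: real" and ?b = "(1/2) ^ k :: real"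
    have b: "0 < ?b" "?b \<le> 1" "?a = ?b / 2"
      by (auto simp: power_le_one)
    have "(LINT x:{?a<..?b}|lborel. \<omega> ?a / ?b) = \<omega> ?a / 2"
      using b by (simp add: set_lebesgue_integral_def field_simps)
    moreover have "(LINT x:{?a<..?b}|lborel. \<omega> ?a / ?b) \<le> I ?a ?b"
      unfolding I_def
    proof (rule set_integral_mono)
      show "set_integrable lborel {?a<..?b} (\<lambda>x. \<omega> ?a / ?b)"
        unfolding set_integrable_def by (intro integrable_scaleR_left integrable_real_indicator) auto
      show "set_integrable lborel {?a<..?b} (\<lambda>x. \<omega> x / x)"
        using b by (intro sub) auto
      show "\<omega> ?a / ?b \<le> \<omega> x / x" if x: "x \<in> {?a<..?b}" for x
      proof (rule frac_le)
        show "0 \<le> \<omega> x" "\<omega> ?a \<le> \<omega> x" "0 < x" "x \<le> ?b"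
          using x b by (auto intro!: nn mono)
      qed
    qed
    ultimately show ?thesis
      by (simp only:)
  qed
  have partial: "(\<Sum>k<n. \<omega> ((1/2) ^ Suc k) / 2) \<le> I ((1/2) ^ n) 1" for n
  proof (induction n)
    case 0
    then show ?case by (simp add: I_def set_lebesgue_integral_def)
  next
    case (Suc n)
    let ?a = "(1/2) ^ Suc n :: real" and ?b = "(1/2) ^ n :: real"
    have b: "0 < ?b" "?b \<le> 1" "?a = ?b / 2"
      by (auto simp: power_le_one)
    have "I ?a 1 = (LINT x:({?a<..?b} \<union> {?b<..1})|lborel. \<omega> x / x)"
      using b by (simp only: I_def ivl_disj_un(8)) (auto simp: ivl_disj_un)
    also have "\<dots> = I ?a ?b + I ?b 1"
      unfolding I_def using b by (intro set_integral_Un sub) auto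
    finally show ?case
      using Suc le[of n] by simp
  qed
  have "summable (\<lambda>k. \<omega> ((1/2) ^ Suc k) / 2)"
  proof (rule summableI_nonneg_bounded)
    show "0 \<le> \<omega> ((1/2) ^ Suc n) / 2" for n
      using nn[of "(1/2) ^ Suc n"] by simp
    show "(\<Sum>k<n. \<omega> ((1/2) ^ Suc k) / 2) \<le> I 0 1" for n
    proof (rule order_trans[OF partial])
      let ?b = "(1/2) ^ n :: real"
      have b: "0 < ?b" "?b \<le> 1"
        by (auto simp: power_le_one)
      show "I ?b 1 \<le> I 0 1"
        unfolding I_def set_lebesgue_integral_def
      proof (rule integral_mono)
        show "integrable lborel (\<lambda>x. indicator {?b<..1} x *\<^sub>R (\<omega> x / x))"
          using sub[of ?b 1] b by (simp add: set_integrable_def)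
        show "integrable lborel (\<lambda>x. indicator {0<..1} x *\<^sub>R (\<omega> x / x))"
          using int by (simp add: set_integrable_def)
        show "indicator {?b<..1} x *\<^sub>R (\<omega> x / x) \<le> indicator {0<..1} x *\<^sub>R (\<omega> x / x)" for x
        proof (cases "0 < x")
          case True
          then have "0 \<le> \<omega> x / x"
            using nn[of x] by simp
          then show ?thesis
            using b True by (auto split: split_indicator)
        next
          case False
          then have "\<not> ?b < x"
            using b by linarith
          then show ?thesis
            using False by simp
        qed
      qed
    qed
  qed
  then have "summable (\<lambda>k. \<omega> ((1/2) ^ Suc k))"
    using summable_mult[of "\<lambda>k. \<omega> ((1/2) ^ Suc k) / 2" 2] by simp
  then show ?thesis
    by (rule iffD1[OF summable_Suc_iff[of "\<lambda>k. \<omega> ((1/2) ^ k)"]])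
qed

theorem theorem3p4:
  fixes T :: "(real^'n \<Rightarrow> real) \<Rightarrow> real^'n \<Rightarrow> real"
    and \<omega> :: "real \<Rightarrow> real"
  assumes "modulus_of_continuity \<omega>"
    and "dini \<omega>"
    and "CZ_operator \<omega> T"
  shows "\<exists>C>0. \<forall>f :: real^'n \<Rightarrow> real^'d.
           integrable lebesgue f \<longrightarrow> compact (ess_support f) \<longrightarrow>
           (\<exists>S. weakly_sparse ((1/3) ^ CARD('n) / 2) S \<and>
                (AE x in lebesgue.
                   vector_extension T f x \<in> (\<lambda>v. C *\<^sub>R v) ` sparse_operator S f x))"
proof -
  obtain K where T: "bounded_operator_L2 T" and K: "CZ_kernel \<omega> K"
    and rep: "\<And>f. square_integrable f \<Longrightarrow>
        AE x in lebesgue. x \<notin> ess_support f \<longrightarrow> has_bochner_integral lebesgue (\<lambda>y. K x y * f y) (T f x)"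
    using assms(3) unfolding CZ_operator_def by blast
  obtain B where B: "\<And>f. square_integrable f \<Longrightarrow> norm_L2 (T f) \<le> B * norm_L2 f"
    using T unfolding bounded_operator_L2_def by blast
  obtain \<kappa> where \<kappa>: "\<And>x y. x \<noteq> y \<Longrightarrow> \<bar>K x y\<bar> \<le> \<kappa> / norm (x - y) ^ CARD('n)"
    using K unfolding CZ_kernel_def by blast
  interpret calderon_zygmund T K \<omega> "\<bar>B\<bar>" "\<bar>\<kappa>\<bar>"
  proof unfold_locales
    show "mono_on {0..} \<omega>" "\<omega> 0 = 0"
      using assms(1) by (auto simp: modulus_of_continuity_def)
    show "summable (\<lambda>k. \<omega> ((1/2) ^ k))"
      by (rule dini_summable[OF assms(1,2)])
    show "square_integrable (T f)" if "square_integrable f" for f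
      using T that unfolding bounded_operator_L2_def by blast
    show "AE x in lebesgue. T (\<lambda>y. a * f y + b * g y) x = a * T f x + b * T g x"
      if "square_integrable f" "square_integrable g" for f g a b
      using T that unfolding bounded_operator_L2_def by blast
    show "norm_L2 (T f) \<le> \<bar>B\<bar> * norm_L2 f" if "square_integrable f" for f
    proof -
      have "0 \<le> norm_L2 f"
        by (auto simp: norm_L2_def intro: integral_nonneg_AE)
      then have "B * norm_L2 f \<le> \<bar>B\<bar> * norm_L2 f"
        by (intro mult_right_mono) auto
      then show ?thesis
        using B[OF that] by linarith
    qed
    show "\<bar>K x y\<bar> \<le> \<bar>\<kappa>\<bar> / norm (x - y) ^ CARD('n)" if "x \<noteq> y" for x y
    proof -
      have "\<kappa> / norm (x - y) ^ CARD('n) \<le> \<bar>\<kappa>\<bar> / norm (x - y) ^ CARD('n)"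
        by (intro divide_right_mono) auto
      then show ?thesis
        using \<kappa>[OF that] by linarith
    qed
    show "\<bar>K x y - K x' y\<bar> + \<bar>K y x - K y x'\<bar>
          \<le> \<omega> (norm (x - x') / norm (x - y)) / norm (x - y) ^ CARD('n)"
      if "x \<noteq> y" "2 * norm (x - x') \<le> norm (x - y)" for x y x'
      using K that unfolding CZ_kernel_def by blast
  qed (use rep in auto)
  obtain C where "0 < C"
    "\<And>f :: real ^ 'n \<Rightarrow> real ^ 'd. integrable lebesgue f \<Longrightarrow> compact (ess_support f) \<Longrightarrow>
      \<exists>S. weakly_sparse ((1/3) ^ CARD('n) / 2) S \<and>
        (AE x in lebesgue. vector_extension T f x \<in> (\<lambda>v. C *\<^sub>R v) ` sparse_operator S f x)"
    using convex_body_domination by blast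
  then show ?thesis
    by blast
qed

end
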